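(* Let $\psi$ be the solution of $$d\psi-\mathbf{i}\,(\Delta\psi+\mathbf{i}\alpha\psi+\lambda|\psi|^2\psi)\,dt=\epsilon Q\,dW,\quad t\ge 0,\ x\in[0,1],\qquad \psi(t,0)=\psi(t,1)=0,\qquad \psi(0,x)=\psi_0(x),$$ where $\alpha>0$, $\epsilon\ge0$, $\lambda=\pm1$ and $\eta:=\sum_{k=1}^\infty\eta_k<\infty$. Assume that $\mathbb{E}\|\psi_0\|_{L^2}^2<\infty$. Then the solution is uniformly bounded (in mean square, uniformly in time), with, for all $t\ge0$, $$\mathbb{E}\|\psi(t)\|_{L^2}^2=e^{-2\alpha t}\,\mathbb{E}\|\psi_0\|_{L^2}^2+\frac{\epsilon^2\eta}{\alpha}\left(1-e^{-2\alpha t}\right).$$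
   Context: $L^2=L^2(0,1)$ (complex-valued). On a filtered probability space $(\Omega,\mathcal F,\{\mathcal F_t\}_{t\ge0},\mathbb P)$, $W$ is a complex-valued Wiener process and $Q$ is a linear positive operator on $L^2$ commuting with the Dirichlet Laplacian $\Delta$, with $Qe_k=\sqrt{\eta_k}\,e_k$ for the eigenbasis $e_k(x)=\sqrt2\sin(k\pi x)$, $k\ge1$. Thus $QW(t,x)=\sum_{k\ge1}\sqrt{\eta_k}\,e_k(x)\beta_k(t)$, where $\beta_k=\beta_k^1+\mathbf{i}\beta_k^2$ and $\{\beta_k^i\}_{k\ge1,\,i=1,2}$ is a family of independent standard real-valued $\{\mathcal F_t\}$-Brownian motions. The initial datum $\psi_0$ may be random and is $\mathcal F_0$-measurable. *)

theory Defs
  imports "HOL-Probability.Probability"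
begin

section \<open>Function spaces and the Dirichlet Laplacian\<close>

text \<open>Elements of \<open>L\<^sup>p\<close> are represented by functions; all notions below respect
  almost-everywhere equality.\<close>

definition interval_measure_on :: "real \<Rightarrow> real \<Rightarrow> real measure" where
  "interval_measure_on a b = restrict_space lborel {a..b}"

abbreviation I01 :: "real measure" where
  "I01 \<equiv> interval_measure_on 0 1"

definition Lp :: "nat \<Rightarrow> 'a measure \<Rightarrow> ('a \<Rightarrow> complex) set" where
  "Lp p N = {f \<in> borel_measurable N. integrable N (\<lambda>x. norm (f x) ^ p)}"

abbreviation L2 :: "(real \<Rightarrow> complex) set" where
  "L2 \<equiv> Lp 2 I01"

definition l2inner :: "(real \<Rightarrow> complex) \<Rightarrow> (real \<Rightarrow> complex) \<Rightarrow> complex" where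
  "l2inner f g = (\<integral>x. f x * cnj (g x) \<partial>I01)"

definition l2norm :: "(real \<Rightarrow> complex) \<Rightarrow> real" where
  "l2norm f = sqrt (\<integral>x. (norm (f x))\<^sup>2 \<partial>I01)"

text \<open>\<open>dirichlet_laplacian f g\<close> means that \<open>f\<close> lies in the domain
  \<open>H\<^sup>2(0,1) \<inter> H\<^sup>1\<^sub>0(0,1)\<close> of the Dirichlet Laplacian and \<open>\<Delta>f = g\<close>: up to a null set, \<open>f\<close> is a
  \<open>C\<^sup>1\<close> function vanishing at both end points whose derivative is absolutely
  continuous with density \<open>g\<close>.\<close>

definition dirichlet_laplacian :: "(real \<Rightarrow> complex) \<Rightarrow> (real \<Rightarrow> complex) \<Rightarrow> bool" where
  "dirichlet_laplacian f g \<longleftrightarrow> f \<in> L2 \<and> g \<in> L2 \<and>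
     (\<exists>u u'. (AE x in I01. f x = u x) \<and> u 0 = 0 \<and> u 1 = 0 \<and>
        (\<forall>x\<in>{0..1}. (u has_vector_derivative u' x) (at x within {0..1})) \<and>
        (\<forall>x\<in>{0..1}. u' x = u' 0 + (\<integral>y. g y \<partial>interval_measure_on 0 x)))"

definition sine_basis :: "nat \<Rightarrow> real \<Rightarrow> complex" where
  "sine_basis k x = complex_of_real (sqrt 2 * sin (real k * pi * x))"

definition positive_operator :: "((real \<Rightarrow> complex) \<Rightarrow> real \<Rightarrow> complex) \<Rightarrow> bool" where
  "positive_operator Q \<longleftrightarrow>
     (\<forall>f\<in>L2. Q f \<in> L2) \<and>
     (\<forall>f\<in>L2. \<forall>g\<in>L2. (AE x in I01. f x = g x) \<longrightarrow> (AE x in I01. Q f x = Q g x)) \<and>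
     (\<forall>f\<in>L2. \<forall>g\<in>L2. \<forall>a b. AE x in I01. Q (\<lambda>y. a * f y + b * g y) x = a * Q f x + b * Q g x) \<and>
     (\<forall>f\<in>L2. Im (l2inner (Q f) f) = 0 \<and> Re (l2inner (Q f) f) \<ge> 0)"

definition commutes_with_laplacian :: "((real \<Rightarrow> complex) \<Rightarrow> real \<Rightarrow> complex) \<Rightarrow> bool" where
  "commutes_with_laplacian Q \<longleftrightarrow>
     (\<forall>f g. dirichlet_laplacian f g \<longrightarrow> dirichlet_laplacian (Q f) (Q g))"

section \<open>Filtrations, Brownian motions and the noise\<close>

text \<open>Time is \<open>[0,\<infinity>)\<close>: values of the filtration and of processes at negative times play no role.\<close>

locale filtered_prob_space = prob_space M for M :: "'w measure" +
  fixes F :: "real \<Rightarrow> 'w measure"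
  assumes F_subalgebra: "\<And>t. 0 \<le> t \<Longrightarrow> subalgebra M (F t)"
    and F_mono: "\<And>s t. 0 \<le> s \<Longrightarrow> s \<le> t \<Longrightarrow> sets (F s) \<subseteq> sets (F t)"

definition brownian_motion ::
  "'w measure \<Rightarrow> (real \<Rightarrow> 'w measure) \<Rightarrow> (real \<Rightarrow> 'w \<Rightarrow> real) \<Rightarrow> bool" where
  "brownian_motion M F B \<longleftrightarrow>
     (\<forall>t\<ge>0. B t \<in> borel_measurable (F t)) \<and>
     (AE \<omega> in M. B 0 \<omega> = 0) \<and>
     (AE \<omega> in M. continuous_on {0..} (\<lambda>t. B t \<omega>)) \<and>
     (\<forall>s\<ge>0. \<forall>t>s.
        distributed M lborel (\<lambda>\<omega>. B t \<omega> - B s \<omega>) (normal_density 0 (sqrt (t - s))) \<and>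
        prob_space.indep_set M (sets (F s))
          {(\<lambda>\<omega>. B t \<omega> - B s \<omega>) -` A \<inter> space M | A. A \<in> sets borel})"

text \<open>Independence of the family is independence of the whole processes, viewed as random
  elements of the product space \<open>\<real>\<^bsup>[0,\<infinity>)\<^esup>\<close>. The second index \<open>i \<in> {1,2}\<close> selects
  the real and imaginary part.\<close>

definition brownian_family ::
  "'w measure \<Rightarrow> (real \<Rightarrow> 'w measure) \<Rightarrow> (nat \<Rightarrow> nat \<Rightarrow> real \<Rightarrow> 'w \<Rightarrow> real) \<Rightarrow> bool" where
  "brownian_family M F \<beta> \<longleftrightarrow>
     (\<forall>k\<ge>1. \<forall>i\<in>{1,2}. brownian_motion M F (\<beta> k i)) \<and>
     prob_space.indep_vars M (\<lambda>_. \<Pi>\<^sub>M t\<in>{0..}. borel)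
       (\<lambda>(k,i) \<omega>. \<lambda>t\<in>{0..}. \<beta> k i t \<omega>) ({1..} \<times> {1,2})"

text \<open>Borel measurability of an \<open>L\<^sup>2\<close>-valued map; since \<open>L\<^sup>2\<close> is separable, its open balls
  generate the Borel sets, so measurability of all distance functions is enough.\<close>

definition l2_measurable :: "'w measure \<Rightarrow> ('w \<Rightarrow> real \<Rightarrow> complex) \<Rightarrow> bool" where
  "l2_measurable N X \<longleftrightarrow>
     (\<forall>\<omega>\<in>space N. X \<omega> \<in> L2) \<and>
     (\<forall>g\<in>L2. (\<lambda>\<omega>. l2norm (\<lambda>x. X \<omega> x - g x)) \<in> borel_measurable N)"

text \<open>\<open>QW(t) = \<Sum>\<^sub>k \<beta>\<^sub>k(t) Q e\<^sub>k\<close> with \<open>\<beta>\<^sub>k = \<beta>\<^sub>k\<^sup>1 + \<i> \<beta>\<^sub>k\<^sup>2\<close>, the series converging in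
  \<open>L\<^sup>2(\<Omega>; L\<^sup>2(0,1))\<close>.\<close>

definition Q_wiener_process ::
  "'w measure \<Rightarrow> (real \<Rightarrow> 'w measure) \<Rightarrow> (nat \<Rightarrow> nat \<Rightarrow> real \<Rightarrow> 'w \<Rightarrow> real) \<Rightarrow>
   ((real \<Rightarrow> complex) \<Rightarrow> real \<Rightarrow> complex) \<Rightarrow> (real \<Rightarrow> 'w \<Rightarrow> real \<Rightarrow> complex) \<Rightarrow> bool" where
  "Q_wiener_process M F \<beta> Q QW \<longleftrightarrow>
     (\<forall>t\<ge>0. l2_measurable (F t) (QW t) \<and>
        (\<lambda>n. \<integral>\<^sup>+\<omega>. ennreal ((l2norm (\<lambda>x. QW t \<omega> x -
            (\<Sum>k=1..n. Complex (\<beta> k 1 t \<omega>) (\<beta> k 2 t \<omega>) * Q (sine_basis k) x)))\<^sup>2) \<partial>M)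
          \<longlonglongrightarrow> 0)"

section \<open>Solutions of the damped stochastic nonlinear Schroedinger equation\<close>

text \<open>The (analytically) weak formulation, tested against the domain of the self-adjoint
  operator \<open>\<Delta>\<close>; this incorporates the Dirichlet boundary conditions. The noise is additive, so
  its stochastic integral over \<open>[0,t]\<close> is \<open>\<epsilon> QW(t)\<close>. The paths lie in the class
  \<open>C([0,\<infinity>); L\<^sup>2) \<inter> L\<^sup>4\<^sub>l\<^sub>o\<^sub>c([0,\<infinity>); L\<^sup>4)\<close> in which the cubic equation is well-posed for
  \<open>L\<^sup>2\<close> data.\<close>

definition nls_solution ::
  "'w measure \<Rightarrow> (real \<Rightarrow> 'w measure) \<Rightarrow> (real \<Rightarrow> 'w \<Rightarrow> real \<Rightarrow> complex) \<Rightarrow>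
   real \<Rightarrow> real \<Rightarrow> real \<Rightarrow> ('w \<Rightarrow> real \<Rightarrow> complex) \<Rightarrow> (real \<Rightarrow> 'w \<Rightarrow> real \<Rightarrow> complex) \<Rightarrow> bool" where
  "nls_solution M F QW \<alpha> \<epsilon> lam \<psi>\<^sub>0 \<psi> \<longleftrightarrow>
     (\<forall>t\<ge>0. l2_measurable (F t) (\<psi> t)) \<and>
     (AE \<omega> in M. \<forall>t\<ge>0. ((\<lambda>s. l2norm (\<lambda>x. \<psi> s \<omega> x - \<psi> t \<omega> x)) \<longlongrightarrow> 0) (at t within {0..})) \<and>
     (AE \<omega> in M. \<forall>T>0. (\<lambda>(t, x). \<psi> t \<omega> x) \<in> Lp 4 (interval_measure_on 0 T \<Otimes>\<^sub>M I01)) \<and>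
     (AE \<omega> in M. AE x in I01. \<psi> 0 \<omega> x = \<psi>\<^sub>0 \<omega> x) \<and>
     (\<forall>\<phi> \<Delta>\<phi>. dirichlet_laplacian \<phi> \<Delta>\<phi> \<longrightarrow> (\<forall>t\<ge>0. AE \<omega> in M.
        l2inner (\<psi> t \<omega>) \<phi> = l2inner (\<psi>\<^sub>0 \<omega>) \<phi> +
          (\<integral>s. \<i> * (l2inner (\<psi> s \<omega>) \<Delta>\<phi> + \<i> * of_real \<alpha> * l2inner (\<psi> s \<omega>) \<phi> +
                 of_real lam * l2inner (\<lambda>x. of_real ((norm (\<psi> s \<omega> x))\<^sup>2) * \<psi> s \<omega> x) \<phi>)
             \<partial>interval_measure_on 0 t) +
          of_real \<epsilon> * l2inner (QW t \<omega>) \<phi>))"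

end

theory Submission
  imports Defs
begin

text \<open>The energy identity is obtained from the Fourier coefficients of the solution without stochastic
  integration. On a time grid the increments of \<open>e\<^bsup>2\<alpha>t\<^esup> |c\<^sub>k(t)|\<^sup>2\<close>, with \<open>c\<^sub>k\<close> the \<open>k\<close>-th sine coefficient of
  \<open>\<psi>\<close>, split into a drift part, which converges pathwise as the mesh shrinks, and a martingale part, which is
  centered and bounded in \<open>L\<^sup>2\<close>. The coefficients are summed with Fejer weights, since the Fejer kernel is
  positive: this bounds the contribution of the cubic term by \<open>2 \<integral>|\<psi>|\<^sup>4\<close>, so that by dominated convergence it
  tends along each path to \<open>Im \<integral>|\<psi>|\<^sup>4 = 0\<close> as the number of modes grows. No moments of \<open>\<psi>(t)\<close> are known in
  advance; they come from stopping at the exit time of \<open>\<parallel>\<psi>\<parallel>\<close> from a ball and Fatou's lemma. With these moments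
  the same limits without stopping give the identity.\<close>

text \<open>The obstacle is regularity: a path is only continuous in \<open>L2\<close> and
  fourth-power integrable in space and time, so neither the Laplacian nor the cubic term need lie in
  \<open>L2\<close>, and the energy cannot be differentiated directly. For a single sine mode it
  can: there the Laplacian only rotates the phase, and the weight exp(2\<alpha>t) absorbs the
  damping exactly. Two real Brownian motions, each with variance rate \<epsilon>^2 \<eta>_k, drive
  mode k; integrating 2 \<epsilon>^2 \<eta>_k against exp(2\<alpha>s) gives (\<epsilon>^2 \<eta>_k /
  \<alpha>) (exp(2\<alpha>t) - 1), the origin of the constant in the theorem. The cubic term does
  not cancel mode by mode, only in the sum over all modes. With a sharp cut-off, controlling that
  sum would require boundedness of Fourier projections on L^4; with Fejer weights it takes only a
  positive kernel of mass 1 and a Young inequality between the values of the path at two points. All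
  martingale bounds are uniform in the mesh and in the number of modes, so the two limits can be
  taken one after the other.\<close>

lemma space_interval_measure_on [simp]: "space (interval_measure_on a b) = {a..b}"
  by (simp add: interval_measure_on_def space_restrict_space)

lemma finite_measure_interval_measure_on: "finite_measure (interval_measure_on a b)"
  unfolding interval_measure_on_def
  by (rule finite_measureI) (simp add: emeasure_restrict_space space_restrict_space emeasure_lborel_Icc_eq)

lemma measure_I01 [simp]: "measure I01 {0..1} = 1"
  by (simp add: interval_measure_on_def measure_restrict_space)

lemma integral_const_I01 [simp]: "(\<integral>x. c \<partial>I01) = (c :: 'a :: {banach, second_countable_topology})"
  using lebesgue_integral_const[of I01 c] by (simp add: measure_I01)

lemma borel_measurable_interval_measure_on [measurable (raw)]:
  "f \<in> borel_measurable borel \<Longrightarrow> f \<in> borel_measurable (interval_measure_on a b)"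
  unfolding interval_measure_on_def by (rule measurable_restrict_space1) simp

lemma integrable_interval_measure_on_iff:
  "integrable (interval_measure_on a b) f \<longleftrightarrow> set_integrable lborel {a..b} f"
  for f :: "real \<Rightarrow> 'a :: {banach, second_countable_topology}"
  unfolding interval_measure_on_def set_integrable_def by (rule integrable_restrict_space) simp

lemma integral_interval_measure_on:
  "(\<integral>x. f x \<partial>interval_measure_on a b) = (LINT x:{a..b}|lborel. f x)"
  for f :: "real \<Rightarrow> 'a :: {banach, second_countable_topology}"
  unfolding interval_measure_on_def set_lebesgue_integral_def by (rule integral_restrict_space) simp

lemma integrable_const_I01 [simp]: "integrable (interval_measure_on a b) (\<lambda>x. c :: 'a :: {banach, second_countable_topology})"
  using finite_measure.integrable_const[OF finite_measure_interval_measure_on] .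

lemma AE_interval_measure_on: "(AE x in interval_measure_on a b. P x) \<longleftrightarrow> (AE x in lborel. x \<in> {a..b} \<longrightarrow> P x)"
  unfolding interval_measure_on_def by (rule AE_restrict_space_iff) simp

section \<open>The space \<open>L\<^sup>2(0,1)\<close>\<close>

lemma L2_iff: "f \<in> L2 \<longleftrightarrow> f \<in> borel_measurable I01 \<and> integrable I01 (\<lambda>x. (norm (f x))\<^sup>2)"
  by (simp add: Lp_def)

lemma L2_measurable: "f \<in> L2 \<Longrightarrow> f \<in> borel_measurable I01"
  by (simp add: L2_iff)

lemma L2_integrable: "f \<in> L2 \<Longrightarrow> integrable I01 (\<lambda>x. (norm (f x))\<^sup>2)"
  by (simp add: L2_iff)

lemma L2_bounded:
  assumes "f \<in> borel_measurable I01" "\<And>x. x \<in> {0..1} \<Longrightarrow> norm (f x) \<le> B"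
  shows "f \<in> L2"
proof -
  have "integrable I01 (\<lambda>x. (norm (f x))\<^sup>2)"
  proof (rule Bochner_Integration.integrable_bound[where f="\<lambda>x. B\<^sup>2"])
    show "AE x in I01. norm ((norm (f x))\<^sup>2) \<le> norm (B\<^sup>2)"
      using assms(2) by (intro AE_I2) (auto intro: power_mono)
  qed (use assms(1) in auto)
  with assms(1) show ?thesis by (simp add: L2_iff)
qed

lemma L2_integrable_prod:
  assumes "f \<in> L2" "g \<in> L2"
  shows "integrable I01 (\<lambda>x. norm (f x) * norm (g x))"
proof (rule Bochner_Integration.integrable_bound[where f="\<lambda>x. (norm (f x))\<^sup>2 + (norm (g x))\<^sup>2"])
  note [measurable] = assms[THEN L2_measurable]
  show "(\<lambda>x. norm (f x) * norm (g x)) \<in> borel_measurable I01" by measurable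
  have "norm (norm a * norm b) \<le> norm ((norm a)\<^sup>2 + (norm b)\<^sup>2)" for a b :: complex
    using sum_squares_bound[of "norm a" "norm b"] mult_nonneg_nonneg[of "norm a" "norm b"]
    by (simp add: norm_mult del: mult_nonneg_nonneg)
  then show "AE x in I01. norm (norm (f x) * norm (g x)) \<le> norm ((norm (f x))\<^sup>2 + (norm (g x))\<^sup>2)"
    by simp
qed (use assms in \<open>auto intro: L2_integrable\<close>)

lemma L2_integrable_cnj:
  assumes "f \<in> L2" "g \<in> L2"
  shows "integrable I01 (\<lambda>x. f x * cnj (g x))"
proof (rule Bochner_Integration.integrable_bound[OF L2_integrable_prod[OF assms]])
  note [measurable] = assms[THEN L2_measurable]
  have [measurable]: "cnj \<in> borel_measurable borel" by (intro borel_measurable_continuous_onI continuous_intros)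
  show "(\<lambda>x. f x * cnj (g x)) \<in> borel_measurable I01" by measurable
qed (simp add: norm_mult)

lemma L2_add:
  assumes "f \<in> L2" "g \<in> L2"
  shows "(\<lambda>x. f x + g x) \<in> L2"
proof -
  note [measurable] = assms[THEN L2_measurable]
  have "integrable I01 (\<lambda>x. (norm (f x + g x))\<^sup>2)"
  proof (rule Bochner_Integration.integrable_bound[where f="\<lambda>x. 2 * (norm (f x))\<^sup>2 + 2 * (norm (g x))\<^sup>2"])
    have "(norm (a + b))\<^sup>2 \<le> 2 * (norm a)\<^sup>2 + 2 * (norm b)\<^sup>2" for a b :: complex
    proof -
      have "(norm (a + b))\<^sup>2 \<le> (norm a + norm b)\<^sup>2" by (intro power_mono norm_triangle_ineq) auto
      also have "\<dots> \<le> 2 * (norm a)\<^sup>2 + 2 * (norm b)\<^sup>2"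
        using sum_squares_bound[of "norm a" "norm b"] by (simp add: power2_sum)
      finally show ?thesis .
    qed
    then show "AE x in I01. norm ((norm (f x + g x))\<^sup>2) \<le> norm (2 * (norm (f x))\<^sup>2 + 2 * (norm (g x))\<^sup>2)"
      by simp
  qed (use assms in \<open>auto intro!: Bochner_Integration.integrable_add integrable_mult_right L2_integrable\<close>)
  then show ?thesis by (simp add: L2_iff)
qed

lemma L2_cmult: "f \<in> L2 \<Longrightarrow> (\<lambda>x. c * f x) \<in> L2"
  by (auto simp: L2_iff norm_mult power_mult_distrib)

lemma L2_diff:
  assumes "f \<in> L2" "g \<in> L2" shows "(\<lambda>x. f x - g x) \<in> L2"
  using L2_add[OF assms(1) L2_cmult[OF assms(2), of "-1"]] by simp

lemma L2_zero: "(\<lambda>x. 0) \<in> L2"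
  by (simp add: L2_iff)

lemma L2_sum: "(\<And>i. i \<in> A \<Longrightarrow> f i \<in> L2) \<Longrightarrow> (\<lambda>x. \<Sum>i\<in>A. f i x) \<in> L2"
  by (induction A rule: infinite_finite_induct) (auto intro: L2_add L2_zero)

section \<open>Inner product and norm of \<open>L2\<close>\<close>

lemma l2inner_commute: "l2inner g f = cnj (l2inner f g)"
  using Bochner_Integration.integral_cnj[of I01 "\<lambda>x. f x * cnj (g x)"]
  unfolding l2inner_def by (simp add: mult.commute)

lemma l2inner_add_left: "\<lbrakk>f \<in> L2; g \<in> L2; h \<in> L2\<rbrakk> \<Longrightarrow> l2inner (\<lambda>x. f x + g x) h = l2inner f h + l2inner g h"
  unfolding l2inner_def by (simp add: distrib_right L2_integrable_cnj)

lemma l2inner_diff_left: "\<lbrakk>f \<in> L2; g \<in> L2; h \<in> L2\<rbrakk> \<Longrightarrow> l2inner (\<lambda>x. f x - g x) h = l2inner f h - l2inner g h"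
  unfolding l2inner_def by (simp add: left_diff_distrib L2_integrable_cnj)

lemma l2inner_diff_right: "\<lbrakk>f \<in> L2; g \<in> L2; h \<in> L2\<rbrakk> \<Longrightarrow> l2inner h (\<lambda>x. f x - g x) = l2inner h f - l2inner h g"
  unfolding l2inner_def by (simp add: right_diff_distrib L2_integrable_cnj)

lemma l2inner_cmult_left: "l2inner (\<lambda>x. c * f x) h = c * l2inner f h"
  unfolding l2inner_def by (simp add: mult.assoc)

lemma l2inner_cmult_right: "l2inner h (\<lambda>x. c * f x) = cnj c * l2inner h f"
  unfolding l2inner_def by (simp add: mult.left_commute)

lemma l2inner_zero_left: "l2inner (\<lambda>x. 0) h = 0"
  by (simp add: l2inner_def)

lemma l2inner_sum_left:
  assumes "\<And>i. i \<in> A \<Longrightarrow> f i \<in> L2" "h \<in> L2"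
  shows "l2inner (\<lambda>x. \<Sum>i\<in>A. f i x) h = (\<Sum>i\<in>A. l2inner (f i) h)"
  using assms
  by (induction A rule: infinite_finite_induct) (auto simp: l2inner_zero_left l2inner_add_left L2_sum)

lemma l2inner_cong_AE:
  assumes "f \<in> L2" "g \<in> L2" "h \<in> L2" "AE x in I01. f x = g x"
  shows "l2inner f h = l2inner g h"
  unfolding l2inner_def
  by (rule integral_cong_AE) (use assms(4) in \<open>auto intro!: borel_measurable_integrable L2_integrable_cnj assms\<close>)

lemma l2norm_nonneg: "l2norm f \<ge> 0"
  by (simp add: l2norm_def)

lemma l2norm_sq: "(l2norm f)\<^sup>2 = (\<integral>x. (norm (f x))\<^sup>2 \<partial>I01)"
  by (simp add: l2norm_def)

lemma l2inner_self: "l2inner f f = of_real ((l2norm f)\<^sup>2)"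
  unfolding l2inner_def l2norm_sq integral_complex_of_real[symmetric]
  by (simp only: complex_norm_square)

lemma l2norm_cong_AE:
  assumes "f \<in> L2" "g \<in> L2" "AE x in I01. f x = g x"
  shows "l2norm f = l2norm g"
proof -
  note [measurable] = assms(1,2)[THEN L2_measurable]
  have "(\<integral>x. (norm (f x))\<^sup>2 \<partial>I01) = (\<integral>x. (norm (g x))\<^sup>2 \<partial>I01)"
    by (rule integral_cong_AE) (use assms(3) in auto)
  then show ?thesis by (simp add: l2norm_def)
qed

lemma l2norm_sq_diff:
  assumes "f \<in> L2" "g \<in> L2"
  shows "(l2norm (\<lambda>x. f x - g x))\<^sup>2 = (l2norm f)\<^sup>2 - 2 * Re (l2inner f g) + (l2norm g)\<^sup>2"
proof -
  have "of_real ((l2norm (\<lambda>x. f x - g x))\<^sup>2) =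
      l2inner f f - l2inner g f - l2inner f g + l2inner g g"
    unfolding l2inner_self[symmetric] using assms
    by (simp add: l2inner_diff_left l2inner_diff_right L2_diff)
  also have "Re \<dots> = (l2norm f)\<^sup>2 - 2 * Re (l2inner f g) + (l2norm g)\<^sup>2"
    unfolding l2inner_commute[of f g] l2inner_self by simp
  finally show ?thesis by simp
qed

text \<open>The squared norm of f - t <f,g> g is a nonnegative quadratic polynomial in the real
  parameter t; its minimum at t = 1 / (l2norm g)^2 gives the inequality.\<close>

lemma l2inner_Cauchy_Schwarz:
  assumes "f \<in> L2" "g \<in> L2"
  shows "norm (l2inner f g) \<le> l2norm f * l2norm g"
proof -
  have *: "0 \<le> (l2norm f)\<^sup>2 - 2 * t * (norm (l2inner f g))\<^sup>2 + t\<^sup>2 * (norm (l2inner f g))\<^sup>2 * (l2norm g)\<^sup>2" for t :: real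
  proof -
    define a where "a = of_real t * l2inner f g"
    have "0 \<le> (l2norm (\<lambda>x. f x - a * g x))\<^sup>2" by simp
    also have "\<dots> = (l2norm f)\<^sup>2 - 2 * Re (l2inner f (\<lambda>x. a * g x)) + (l2norm (\<lambda>x. a * g x))\<^sup>2"
      using assms by (intro l2norm_sq_diff L2_cmult)
    also have "l2inner f (\<lambda>x. a * g x) = of_real (t * (norm (l2inner f g))\<^sup>2)"
      unfolding l2inner_cmult_right a_def by (simp add: complex_norm_square[simplified] ac_simps)
    also have "(l2norm (\<lambda>x. a * g x))\<^sup>2 = t\<^sup>2 * (norm (l2inner f g))\<^sup>2 * (l2norm g)\<^sup>2"
      by (simp add: l2norm_sq norm_mult power_mult_distrib a_def)
    finally show ?thesis by simp
  qed
  let ?c = "norm (l2inner f g)"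
  have "?c\<^sup>2 \<le> (l2norm f * l2norm g)\<^sup>2"
  proof (cases "l2norm g = 0")
    case True
    \<comment> \<open>For a null function g the polynomial is affine in t, and the chosen t would
      make it equal to -1.\<close>
    have "?c = 0"
    proof (rule ccontr)
      assume "?c \<noteq> 0"
      then have "2 * (((l2norm f)\<^sup>2 + 1) / (2 * ?c\<^sup>2)) * ?c\<^sup>2 = (l2norm f)\<^sup>2 + 1" by simp
      with *[of "((l2norm f)\<^sup>2 + 1) / (2 * ?c\<^sup>2)"] True show False by simp
    qed
    then show ?thesis by simp
  next
    case False
    with *[of "1 / (l2norm g)\<^sup>2"] have "0 \<le> (l2norm f)\<^sup>2 - ?c\<^sup>2 / (l2norm g)\<^sup>2"
      by (simp add: power2_eq_square)
    with False show ?thesis by (simp add: field_simps power_mult_distrib)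
  qed
  then show ?thesis
    by (meson l2norm_nonneg mult_nonneg_nonneg power2_le_imp_le)
qed

lemma l2norm_diff_ge:
  assumes "f \<in> L2" "g \<in> L2"
  shows "\<bar>l2norm f - l2norm g\<bar> \<le> l2norm (\<lambda>x. f x - g x)"
proof (rule power2_le_imp_le)
  have "Re (l2inner f g) \<le> l2norm f * l2norm g"
    using l2inner_Cauchy_Schwarz[OF assms] complex_Re_le_cmod order_trans by blast
  then show "\<bar>l2norm f - l2norm g\<bar>\<^sup>2 \<le> (l2norm (\<lambda>x. f x - g x))\<^sup>2"
    by (simp add: l2norm_sq_diff[OF assms] power2_diff)
qed (rule l2norm_nonneg)

text \<open>Polarization: \<open>l2_measurable\<close> only provides distance functions, and the
  real part of the inner product is a combination of three squared distances. The imaginary part is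
  the real part after testing with \<open>\<i> * g\<close>.\<close>

lemma l2inner_measurable:
  assumes "l2_measurable N X" "g \<in> L2"
  shows "(\<lambda>\<omega>. l2inner (X \<omega>) g) \<in> borel_measurable N"
proof -
  have X: "X \<omega> \<in> L2" if "\<omega> \<in> space N" for \<omega> using assms(1) that by (simp add: l2_measurable_def)
  have [measurable]: "(\<lambda>\<omega>. l2norm (\<lambda>x. X \<omega> x - h x)) \<in> borel_measurable N" if "h \<in> L2" for h
    using assms(1) that by (simp add: l2_measurable_def)
  have Re: "(\<lambda>\<omega>. Re (l2inner (X \<omega>) h)) \<in> borel_measurable N" if h: "h \<in> L2" for h
  proof -
    have eq: "Re (l2inner (X \<omega>) h) =
        ((l2norm (\<lambda>x. X \<omega> x - 0))\<^sup>2 + (l2norm h)\<^sup>2 - (l2norm (\<lambda>x. X \<omega> x - h x))\<^sup>2) / 2" if "\<omega> \<in> space N" for \<omega>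
      using l2norm_sq_diff[OF X[OF that] h] by simp
    note [measurable] = h L2_zero
    show ?thesis by (subst measurable_cong[OF eq]) (assumption, measurable)
  qed
  have "Im (l2inner (X \<omega>) g) = Re (l2inner (X \<omega>) (\<lambda>x. \<i> * g x))" for \<omega>
    by (simp add: l2inner_cmult_right)
  then have "(\<lambda>\<omega>. Im (l2inner (X \<omega>) g)) \<in> borel_measurable N"
    using Re[OF L2_cmult[OF assms(2), of "\<i>"]] by simp
  with Re[OF assms(2)] show ?thesis by (simp add: borel_measurable_complex_iff)
qed

lemma l2norm_measurable:
  assumes "l2_measurable N X"
  shows "(\<lambda>\<omega>. l2norm (X \<omega>)) \<in> borel_measurable N"
  using assms L2_zero by (force simp: l2_measurable_def)

section \<open>Completeness of the sine basis\<close>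

lemma borel_measurable_I01_continuous: "continuous_on UNIV f \<Longrightarrow> f \<in> borel_measurable (interval_measure_on a b)"
  by (intro borel_measurable_interval_measure_on borel_measurable_continuous_onI)

lemma sine_basis_measurable [measurable]: "sine_basis k \<in> borel_measurable borel"
  unfolding sine_basis_def[abs_def] by measurable

lemma norm_sine_basis_le: "norm (sine_basis k x) \<le> sqrt 2"
  unfolding sine_basis_def norm_of_real abs_mult using abs_sin_le_one by (simp add: mult_left_le)

lemma sine_basis_L2: "sine_basis k \<in> L2"
  by (rule L2_bounded[OF borel_measurable_interval_measure_on norm_sine_basis_le]) measurable

lemma integral_cos_I01: "(\<integral>x. cos (real k * pi * x) \<partial>I01) = of_bool (k = 0)"
proof (cases "k = 0")
  case False
  have "(\<integral>x. cos (real k * pi * x) * indicator {0..1} x \<partial>lborel) =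
      sin (real k * pi * 1) / (real k * pi) - sin (real k * pi * 0) / (real k * pi)"
    using False
    by (intro integral_FTC_Icc_real) (auto intro!: derivative_eq_intros continuous_intros)
  with False show ?thesis
    by (simp add: integral_interval_measure_on set_lebesgue_integral_def mult.commute)
qed simp

lemma integrable_I01_continuous:
  fixes f :: "real \<Rightarrow> 'a :: {banach, second_countable_topology}"
  assumes "continuous_on UNIV f" shows "integrable (interval_measure_on a b) f"
  unfolding integrable_interval_measure_on_iff
  by (rule borel_integrable_atLeastAtMost') (use assms continuous_on_subset in blast)

text \<open>The product formula for sines leaves integrals of cosines, which vanish except at
  frequency 0. The difference of the two frequencies is a natural number only if the first one is
  the larger, hence the auxiliary claim for \<open>l \<le> k\<close> and conjugate symmetry for the
  rest.\<close>

lemma sine_basis_orthonormal: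
  assumes "k \<ge> 1" "l \<ge> 1"
  shows "l2inner (sine_basis k) (sine_basis l) = of_bool (k = l)"
proof -
  have *: "l2inner (sine_basis k) (sine_basis l) = of_bool (k = l)" if "1 \<le> l" "l \<le> k" for k l
  proof -
    have i: "integrable I01 (\<lambda>x. cos (real m * pi * x))" for m
      by (intro integrable_I01_continuous continuous_intros)
    have "sine_basis k x * cnj (sine_basis l x) =
        of_real (cos (real (k - l) * pi * x) - cos (real (k + l) * pi * x))" for x
    proof -
      have "sine_basis k x * cnj (sine_basis l x) =
          of_real (2 * (sin (real k * pi * x) * sin (real l * pi * x)))"
        by (simp add: sine_basis_def flip: of_real_mult)
      also have "2 * (sin (real k * pi * x) * sin (real l * pi * x)) =
          cos (real (k - l) * pi * x) - cos (real (k + l) * pi * x)"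
        using that by (simp add: sin_times_sin of_nat_diff algebra_simps diff_divide_distrib)
      finally show ?thesis .
    qed
    then have "l2inner (sine_basis k) (sine_basis l) =
        of_real (\<integral>x. cos (real (k - l) * pi * x) - cos (real (k + l) * pi * x) \<partial>I01)"
      unfolding l2inner_def integral_complex_of_real[symmetric] by simp
    also have "(\<integral>x. cos (real (k - l) * pi * x) - cos (real (k + l) * pi * x) \<partial>I01) = of_bool (k = l)"
      unfolding Bochner_Integration.integral_diff[OF i i] integral_cos_I01 using that by auto
    finally show ?thesis by simp
  qed
  show ?thesis
  proof (cases "l \<le> k")
    case False
    with *[of k l] show ?thesis using assms *[of k l] l2inner_commute[of "sine_basis k" "sine_basis l"]
      by simp
  qed (use * assms in auto)
qed

text \<open>Pythagoras, for arbitrary coefficients \<open>a\<close>. The Fourier coefficients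
  themselves give Bessel's inequality, dropping the nonnegative last sum gives their optimality for
  Parseval, and damped coefficients give the error of the Fejer means.\<close>

lemma l2norm_sine_sum_diff:
  assumes f: "f \<in> L2" and A: "finite A" "A \<subseteq> {1..}"
  shows "(l2norm (\<lambda>x. f x - (\<Sum>k\<in>A. a k * sine_basis k x)))\<^sup>2 =
    (l2norm f)\<^sup>2 - (\<Sum>k\<in>A. (norm (l2inner f (sine_basis k)))\<^sup>2)
      + (\<Sum>k\<in>A. (norm (l2inner f (sine_basis k) - a k))\<^sup>2)"
proof -
  let ?g = "\<lambda>x. \<Sum>k\<in>A. a k * sine_basis k x"
  have e: "(\<lambda>x. a k * sine_basis k x) \<in> L2" for k by (intro L2_cmult sine_basis_L2)
  have g: "?g \<in> L2" by (intro L2_sum e)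
  have inner: "l2inner h ?g = (\<Sum>k\<in>A. cnj (a k) * l2inner h (sine_basis k))" if "h \<in> L2" for h
  proof -
    have "l2inner h ?g = cnj (\<Sum>k\<in>A. l2inner (\<lambda>x. a k * sine_basis k x) h)"
      using that by (subst l2inner_commute) (simp add: l2inner_sum_left e)
    also have "\<dots> = (\<Sum>k\<in>A. cnj (a k) * cnj (l2inner (sine_basis k) h))"
      by (simp add: l2inner_cmult_left)
    also have "\<dots> = (\<Sum>k\<in>A. cnj (a k) * l2inner h (sine_basis k))"
      by (simp flip: l2inner_commute)
    finally show ?thesis .
  qed
  have ge: "l2inner ?g (sine_basis k) = a k" if "k \<in> A" for k
  proof -
    have "l2inner ?g (sine_basis k) = (\<Sum>j\<in>A. a j * of_bool (j = k))"
      unfolding l2inner_sum_left[OF e sine_basis_L2] l2inner_cmult_left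
      by (intro sum.cong refl arg_cong2[where f="(*)"] sine_basis_orthonormal) (use A that in auto)
    also have "\<dots> = a k" using A that by (simp add: of_bool_def if_distrib cong: if_cong)
    finally show ?thesis .
  qed
  have "of_real ((l2norm ?g)\<^sup>2) = (\<Sum>k\<in>A. cnj (a k) * a k)"
    unfolding l2inner_self[symmetric] inner[OF g] using ge by simp
  also have "\<dots> = of_real (\<Sum>k\<in>A. (norm (a k))\<^sup>2)"
    by (simp only: of_real_sum complex_norm_square mult.commute)
  finally have gg: "(l2norm ?g)\<^sup>2 = (\<Sum>k\<in>A. (norm (a k))\<^sup>2)"
    by (simp only: of_real_eq_iff)
  have "(norm (c - b))\<^sup>2 = (norm c)\<^sup>2 - 2 * Re (cnj b * c) + (norm b)\<^sup>2" for b c :: complex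
    unfolding cmod_power2 by (simp add: algebra_simps power2_eq_square)
  then show ?thesis
    unfolding l2norm_sq_diff[OF f g] inner[OF f] gg
    by (simp add: sum.distrib sum_subtractf sum_distrib_left)
qed

lemma Bessel_inequality:
  assumes "f \<in> L2" "finite A" "A \<subseteq> {1..}"
  shows "(\<Sum>k\<in>A. (norm (l2inner f (sine_basis k)))\<^sup>2) \<le> (l2norm f)\<^sup>2"
  using l2norm_sine_sum_diff[OF assms, of "\<lambda>k. l2inner f (sine_basis k)"]
    zero_le_power2[of "l2norm (\<lambda>x. f x - (\<Sum>k\<in>A. l2inner f (sine_basis k) * sine_basis k x))"]
  by simp

lemma norm_l2inner_sine_basis_le:
  assumes "f \<in> L2" "k \<ge> 1" shows "norm (l2inner f (sine_basis k)) \<le> l2norm f"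
  using Bessel_inequality[OF assms(1), of "{k}"] assms(2) l2norm_nonneg by (auto intro: power2_le_imp_le)

section \<open>Density of the sine polynomials in \<open>L2\<close>\<close>

definition sine_approximable :: "(real \<Rightarrow> complex) \<Rightarrow> bool" where
  "sine_approximable f \<longleftrightarrow> f \<in> L2 \<and>
     (\<forall>\<epsilon>>0. \<exists>n a. l2norm (\<lambda>x. f x - (\<Sum>k=1..n. a k * sine_basis k x)) < \<epsilon>)"

lemma l2norm_triangle:
  assumes "f \<in> L2" "g \<in> L2" shows "l2norm (\<lambda>x. f x + g x) \<le> l2norm f + l2norm g"
  using l2norm_diff_ge[OF L2_add[OF assms] assms(2)] by simp

lemma l2norm_cmult: "l2norm (\<lambda>x. c * f x) = norm c * l2norm f"
  by (rule power2_eq_imp_eq) (auto simp: power_mult_distrib l2norm_sq norm_mult l2norm_nonneg)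

lemma sine_approximable_add:
  assumes "sine_approximable f" "sine_approximable g" shows "sine_approximable (\<lambda>x. f x + g x)"
  unfolding sine_approximable_def
proof (intro conjI allI impI)
  show "(\<lambda>x. f x + g x) \<in> L2" using assms by (auto simp: sine_approximable_def intro: L2_add)
  fix \<epsilon> :: real assume "\<epsilon> > 0"
  then have e: "\<epsilon> / 2 > 0" by simp
  obtain n a where a: "l2norm (\<lambda>x. f x - (\<Sum>k=1..n. a k * sine_basis k x)) < \<epsilon> / 2"
    using assms(1) e unfolding sine_approximable_def by blast
  obtain m b where b: "l2norm (\<lambda>x. g x - (\<Sum>k=1..m. b k * sine_basis k x)) < \<epsilon> / 2"
    using assms(2) e unfolding sine_approximable_def by blast
  \<comment> \<open>Both coefficient sequences are padded with zeros, so that the two sums run up to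
    the same index.\<close>
  define c where "c k = of_bool (k \<le> n) * a k + of_bool (k \<le> m) * b k" for k
  have ext: "(\<Sum>k=1..max n m. (of_bool (k \<le> j) * d k) * sine_basis k x) = (\<Sum>k=1..j. d k * sine_basis k x)"
    if "j \<le> max n m" for j d x
  proof (rule sum.mono_neutral_cong_right)
    show "{1..j} \<subseteq> {1..max n m}" using that by simp
    show "\<forall>i\<in>{1..max n m} - {1..j}. of_bool (i \<le> j) * d i * sine_basis i x = 0" by simp
    show "of_bool (i \<le> j) * d i * sine_basis i x = d i * sine_basis i x" if "i \<in> {1..j}" for i
      using that by simp
  qed simp
  have eq: "f x + g x - (\<Sum>k=1..max n m. c k * sine_basis k x) =
      (f x - (\<Sum>k=1..n. a k * sine_basis k x)) + (g x - (\<Sum>k=1..m. b k * sine_basis k x))" for x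
    by (simp only: c_def distrib_right sum.distrib ext[of n] ext[of m] max.cobounded1 max.cobounded2)
       (simp add: algebra_simps)
  have "l2norm (\<lambda>x. f x + g x - (\<Sum>k=1..max n m. c k * sine_basis k x)) \<le>
      l2norm (\<lambda>x. f x - (\<Sum>k=1..n. a k * sine_basis k x)) + l2norm (\<lambda>x. g x - (\<Sum>k=1..m. b k * sine_basis k x))"
    unfolding eq using assms
    by (intro l2norm_triangle L2_diff L2_sum L2_cmult sine_basis_L2) (auto simp: sine_approximable_def)
  with a b show "\<exists>n a. l2norm (\<lambda>x. f x + g x - (\<Sum>k=1..n. a k * sine_basis k x)) < \<epsilon>"
    by (intro exI[of _ "max n m"] exI[of _ c]) simp
qed

lemma sine_approximable_cmult:
  assumes "sine_approximable f" shows "sine_approximable (\<lambda>x. c * f x)"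
  unfolding sine_approximable_def
proof (intro conjI allI impI)
  show "(\<lambda>x. c * f x) \<in> L2" using assms by (auto simp: sine_approximable_def intro: L2_cmult)
  fix \<epsilon> :: real assume e: "\<epsilon> > 0"
  \<comment> \<open>The summand 1 keeps the quotient meaningful for \<open>c = 0\<close>.\<close>
  have "\<epsilon> / (norm c + 1) > 0" using e by (intro divide_pos_pos) (auto simp: add_nonneg_pos)
  then obtain n a where a: "l2norm (\<lambda>x. f x - (\<Sum>k=1..n. a k * sine_basis k x)) < \<epsilon> / (norm c + 1)"
    using assms unfolding sine_approximable_def by blast
  have "l2norm (\<lambda>x. c * f x - (\<Sum>k=1..n. (c * a k) * sine_basis k x)) =
      l2norm (\<lambda>x. c * (f x - (\<Sum>k=1..n. a k * sine_basis k x)))"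
    by (simp add: right_diff_distrib sum_distrib_left mult.assoc)
  also have "\<dots> \<le> (norm c + 1) * l2norm (\<lambda>x. f x - (\<Sum>k=1..n. a k * sine_basis k x))"
    unfolding l2norm_cmult by (intro mult_right_mono l2norm_nonneg) simp
  also have "\<dots> < (norm c + 1) * (\<epsilon> / (norm c + 1))"
    using a by (intro mult_strict_left_mono) (auto simp: add_nonneg_pos)
  also have "\<dots> = \<epsilon>"
    by (simp add: add_nonneg_eq_0_iff)
  finally show "\<exists>n a. l2norm (\<lambda>x. c * f x - (\<Sum>k=1..n. a k * sine_basis k x)) < \<epsilon>"
    by (intro exI[of _ n] exI[of _ "\<lambda>k. c * a k"])
qed

lemma sine_approximable_zero: "sine_approximable (\<lambda>x. 0)"
  unfolding sine_approximable_def
  by (auto intro!: L2_zero exI[of _ 0] simp: l2norm_def)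

lemma sine_approximable_sum:
  "(\<And>i. i \<in> A \<Longrightarrow> sine_approximable (f i)) \<Longrightarrow> sine_approximable (\<lambda>x. \<Sum>i\<in>A. f i x)"
  by (induction A rule: infinite_finite_induct) (auto intro: sine_approximable_add sine_approximable_zero)

lemma l2norm_tendsto_zero:
  assumes "\<And>n. f n \<in> borel_measurable I01" "g \<in> borel_measurable I01"
    and "AE x in I01. (\<lambda>n. f n x) \<longlonglongrightarrow> g x"
    and "integrable I01 H" "\<And>n. AE x in I01. (norm (f n x - g x))\<^sup>2 \<le> H x"
  shows "(\<lambda>n. l2norm (\<lambda>x. f n x - g x)) \<longlonglongrightarrow> 0"
proof -
  note [measurable] = assms(1,2)
  have "(\<lambda>n. \<integral>x. (norm (f n x - g x))\<^sup>2 \<partial>I01) \<longlonglongrightarrow> (\<integral>x. 0 \<partial>I01)"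
  proof (rule integral_dominated_convergence[where w=H])
    show "AE x in I01. (\<lambda>n. (norm (f n x - g x))\<^sup>2) \<longlonglongrightarrow> 0"
      using assms(3)
    proof eventually_elim
      case (elim x)
      have "(\<lambda>n. (norm (f n x - g x))\<^sup>2) \<longlonglongrightarrow> (norm (g x - g x))\<^sup>2"
        using elim by (intro tendsto_intros)
      then show ?case by simp
    qed
  qed (use assms in auto)
  from tendsto_real_sqrt[OF this] show ?thesis by (simp add: l2norm_def)
qed

text \<open>The closed span is stable under almost everywhere limits with dominated squared error.
  By this the approximable class grows from trigonometric polynomials to continuous, then bounded,
  then square integrable functions.\<close>

lemma sine_approximable_limit:
  assumes f: "\<And>n. sine_approximable (f n)" and g: "g \<in> L2"
    and "AE x in I01. (\<lambda>n. f n x) \<longlonglongrightarrow> g x"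
    and "integrable I01 H" "\<And>n. AE x in I01. (norm (f n x - g x))\<^sup>2 \<le> H x"
  shows "sine_approximable g"
  unfolding sine_approximable_def
proof (intro conjI allI impI g)
  fix \<epsilon> :: real assume "\<epsilon> > 0"
  then have e: "\<epsilon> / 2 > 0" by simp
  have fL: "f n \<in> L2" for n using f by (simp add: sine_approximable_def)
  have "(\<lambda>n. l2norm (\<lambda>x. f n x - g x)) \<longlonglongrightarrow> 0"
    using assms(3-5) fL g by (intro l2norm_tendsto_zero L2_measurable)
  then have "eventually (\<lambda>n. l2norm (\<lambda>x. f n x - g x) < \<epsilon> / 2) sequentially"
    using e by (rule order_tendstoD(2))
  then obtain N where N: "l2norm (\<lambda>x. f N x - g x) < \<epsilon> / 2"
    using eventually_happens'[OF sequentially_bot] by blast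
  obtain n a where a: "l2norm (\<lambda>x. f N x - (\<Sum>k=1..n. a k * sine_basis k x)) < \<epsilon> / 2"
    using f[of N] e unfolding sine_approximable_def by blast
  have eq: "g x - (\<Sum>k=1..n. a k * sine_basis k x) =
      (-1) * (f N x - g x) + (f N x - (\<Sum>k=1..n. a k * sine_basis k x))" for x by simp
  have "l2norm (\<lambda>x. g x - (\<Sum>k=1..n. a k * sine_basis k x)) \<le>
      l2norm (\<lambda>x. (-1) * (f N x - g x)) + l2norm (\<lambda>x. f N x - (\<Sum>k=1..n. a k * sine_basis k x))"
    unfolding eq using fL g by (intro l2norm_triangle L2_diff L2_sum L2_cmult sine_basis_L2)
  with N a show "\<exists>n a. l2norm (\<lambda>x. g x - (\<Sum>k=1..n. a k * sine_basis k x)) < \<epsilon>"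
    unfolding l2norm_cmult by (intro exI[of _ n] exI[of _ a]) simp
qed

text \<open>Since sin(kz) cos z is half the sum of sin((k+1)z) and sin((k-1)z), each factor of the
  power of the cosine shifts the frequency by one. The induction therefore runs over
  \<open>j\<close> with \<open>k\<close> arbitrary; frequency 0 is the zero function and is split
  off because of the truncated \<open>k - 1\<close>.\<close>

lemma sine_approximable_sin_cos_power:
  "sine_approximable (\<lambda>x. of_real (sin (real k * pi * x) * cos (pi * x) ^ j))"
proof (induction j arbitrary: k)
  case 0
  have "sine_approximable (sine_basis k)" if "k \<ge> 1"
    unfolding sine_approximable_def
  proof (intro conjI allI impI sine_basis_L2)
    fix \<epsilon> :: real assume e: "\<epsilon> > 0"
    have "(\<Sum>i=1..k. of_bool (i = k) * sine_basis i x) = sine_basis k x" for x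
      using that by (simp add: of_bool_def if_distrib[where f="\<lambda>c. c * _"] cong: if_cong)
    with e show "\<exists>n a. l2norm (\<lambda>x. sine_basis k x - (\<Sum>i=1..n. a i * sine_basis i x)) < \<epsilon>"
      by (intro exI[of _ k] exI[of _ "\<lambda>i. of_bool (i = k)"]) (simp add: l2norm_def)
  qed
  then have "sine_approximable (\<lambda>x. of_real (1 / sqrt 2) * sine_basis k x)" if "k \<ge> 1"
    using that by (intro sine_approximable_cmult)
  moreover have "of_real (1 / sqrt 2) * sine_basis k x = of_real (sin (real k * pi * x))" for x
    unfolding sine_basis_def of_real_mult[symmetric] by simp
  ultimately show ?case
    using sine_approximable_zero by (cases "k \<ge> 1") (simp_all add: not_le)
next
  case (Suc j)
  show ?case
  proof (cases "k = 0")
    case True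
    then show ?thesis using sine_approximable_zero by simp
  next
    case False
    have "sin (real k * pi * x) * cos (pi * x) ^ Suc j =
        1/2 * (sin (real (Suc k) * pi * x) * cos (pi * x) ^ j) + 1/2 * (sin (real (k - 1) * pi * x) * cos (pi * x) ^ j)" for x
    proof -
      have k: "real (Suc k) * pi * x = real k * pi * x + pi * x" "real (k - 1) * pi * x = real k * pi * x - pi * x"
        using False by (auto simp: algebra_simps of_nat_diff)
      show ?thesis unfolding k sin_add sin_diff power_Suc by (simp add: algebra_simps)
    qed
    then have eq: "of_real (sin (real k * pi * x) * cos (pi * x) ^ Suc j) =
        (1/2 :: complex) * of_real (sin (real (Suc k) * pi * x) * cos (pi * x) ^ j)
          + 1/2 * of_real (sin (real (k - 1) * pi * x) * cos (pi * x) ^ j)" for x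
      by (simp only: of_real_add of_real_mult of_real_divide of_real_1 of_real_numeral)
    show ?thesis unfolding eq by (intro sine_approximable_add sine_approximable_cmult Suc.IH)
  qed
qed

text \<open>The map x to cos(pi x) is a homeomorphism of [0,1] onto [-1,1], so \<open>g\<close> is
  uniformly close to a polynomial in cos(pi x) by Weierstrass. The factor sin(pi x) turns such a
  polynomial into a sine polynomial; it also removes the mismatch between \<open>g\<close> and the
  boundary values 0.\<close>

lemma sine_approximable_sin_continuous:
  fixes g :: "real \<Rightarrow> real"
  assumes g: "continuous_on UNIV g"
  shows "sine_approximable (\<lambda>x. of_real (sin (pi * x) * g x))"
proof -
  have "continuous_on {-1..1} (\<lambda>u. g (arccos u / pi))"
    by (intro continuous_intros continuous_on_compose2[OF g]) auto
  then have "\<exists>p. real_polynomial_function p \<and> (\<forall>u\<in>{-1..1}. \<bar>g (arccos u / pi) - p u\<bar> < 1 / real (Suc n))" for n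
    by (rule Stone_Weierstrass_real_polynomial_function[OF compact_Icc, of _ _ _ "1 / real (Suc n)"]) auto
  then obtain p where p: "\<And>n. real_polynomial_function (p n)"
    and pg: "\<And>n u. u \<in> {-1..1} \<Longrightarrow> \<bar>g (arccos u / pi) - p n u\<bar> < 1 / real (Suc n)"
    by metis
  have pg': "\<bar>g x - p n (cos (pi * x))\<bar> \<le> 1 / real (Suc n)" if "x \<in> {0..1}" for x n
    using pg[of "cos (pi * x)" n] that by (simp add: arccos_cos mult_left_le)
  have L2: "(\<lambda>x. of_real (sin (pi * x) * g x)) \<in> L2"
  proof -
    have "compact (g ` {0..1})"
      by (intro compact_continuous_image) (use g continuous_on_subset in auto)
    then obtain B where B: "\<And>x. x \<in> {0..1} \<Longrightarrow> norm (g x) \<le> B"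
      by (metis bounded_iff compact_imp_bounded image_eqI)
    show ?thesis
    proof (rule L2_bounded)
      show "norm (complex_of_real (sin (pi * x) * g x)) \<le> 1 * B" if "x \<in> {0..1}" for x
        unfolding norm_of_real abs_mult using B[OF that] by (intro mult_mono) auto
    qed (intro borel_measurable_I01_continuous continuous_intros g)
  qed
  show ?thesis
  proof (rule sine_approximable_limit[where f="\<lambda>n x. of_real (sin (pi * x) * p n (cos (pi * x)))" and H="\<lambda>_. 1"])
    fix n
    obtain a m where "p n = (\<lambda>x. \<Sum>i\<le>m. a i * x ^ i)"
      using p[of n] unfolding real_polynomial_function_iff_sum by blast
    then have "(of_real (sin (pi * x) * p n (cos (pi * x))) :: complex) =
        (\<Sum>i\<le>m. of_real (a i) * of_real (sin (real 1 * pi * x) * cos (pi * x) ^ i))" for x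
      by (simp add: sum_distrib_left mult_ac)
    then show "sine_approximable (\<lambda>x. of_real (sin (pi * x) * p n (cos (pi * x))))"
      by (simp only:) (intro sine_approximable_sum sine_approximable_cmult sine_approximable_sin_cos_power)
  next
    fix n
    show "AE x in I01. (norm (complex_of_real (sin (pi * x) * p n (cos (pi * x))) - of_real (sin (pi * x) * g x)))\<^sup>2 \<le> 1"
    proof (rule AE_I2)
      fix x assume "x \<in> space I01"
      then have "\<bar>sin (pi * x)\<bar> * \<bar>g x - p n (cos (pi * x))\<bar> \<le> 1 * 1"
        using pg'[of x n] by (intro mult_mono abs_sin_le_one order_trans[OF pg']) auto
      then have "\<bar>sin (pi * x) * p n (cos (pi * x)) - sin (pi * x) * g x\<bar> \<le> 1"
        unfolding right_diff_distrib[symmetric] abs_mult by (simp add: abs_minus_commute)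
      then show "(norm (complex_of_real (sin (pi * x) * p n (cos (pi * x))) - of_real (sin (pi * x) * g x)))\<^sup>2 \<le> 1"
        unfolding of_real_diff[symmetric] norm_of_real by (simp add: abs_square_le_1)
    qed
  next
    show "AE x in I01. (\<lambda>n. complex_of_real (sin (pi * x) * p n (cos (pi * x)))) \<longlonglongrightarrow> of_real (sin (pi * x) * g x)"
    proof (rule AE_I2)
      fix x assume "x \<in> space I01"
      then have "(\<lambda>n. p n (cos (pi * x))) \<longlonglongrightarrow> g x"
      proof -
        assume x: "x \<in> space I01"
        have "(\<lambda>n. p n (cos (pi * x)) - g x) \<longlonglongrightarrow> 0"
          by (rule Lim_null_comparison[OF _ LIMSEQ_Suc[OF lim_inverse_n']])
             (use pg'[of x] x in \<open>auto simp: abs_minus_commute\<close>)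
        then show ?thesis by (simp add: LIM_zero_iff)
      qed
      then show "(\<lambda>n. complex_of_real (sin (pi * x) * p n (cos (pi * x)))) \<longlonglongrightarrow> of_real (sin (pi * x) * g x)"
        by (intro tendsto_intros)
    qed
  qed (rule L2, auto)
qed

lemma sine_approximable_sin_bounded:
  fixes h :: "real \<Rightarrow> real"
  assumes h[measurable]: "h \<in> borel_measurable borel" and R: "\<And>x. \<bar>h x\<bar> \<le> R"
  shows "sine_approximable (\<lambda>x. of_real (sin (pi * x) * h x))"
proof -
  have "R \<ge> 0" using R[of 0] by linarith
  \<comment> \<open>This notion of measurability supplies continuous functions converging to
    \<open>h\<close> outside a negligible set.\<close>
  have "h measurable_on UNIV"
    by (rule lebesgue_measurable_imp_measurable_on_real) (use h in \<open>auto intro: measurable_completion\<close>)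
  then obtain N g where N: "negligible N" and g: "\<And>n. continuous_on UNIV (g n)"
    and lim: "\<And>x. x \<notin> N \<Longrightarrow> (\<lambda>n. g n x) \<longlonglongrightarrow> h x"
    unfolding measurable_on_def by auto
  \<comment> \<open>Clipping at the bound of \<open>h\<close> preserves continuity and the limit and
    makes the approximants uniformly bounded.\<close>
  define c where "c n x = max (-R) (min R (g n x))" for n x
  have c: "continuous_on UNIV (c n)" for n unfolding c_def using g by (intro continuous_intros)
  have clim: "(\<lambda>n. c n x) \<longlonglongrightarrow> h x" if "x \<notin> N" for x
  proof -
    have "(\<lambda>n. c n x) \<longlonglongrightarrow> max (-R) (min R (h x))" unfolding c_def by (intro tendsto_intros lim that)
    then show ?thesis using R[of x] by (simp add: max_def min_def split: if_splits)
  qed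
  have cR: "\<bar>c n x\<bar> \<le> R" for n x using \<open>R \<ge> 0\<close> by (auto simp: c_def)
  show ?thesis
  proof (rule sine_approximable_limit[where f="\<lambda>n x. of_real (sin (pi * x) * c n x)" and H="\<lambda>_. (2 * R)\<^sup>2"])
    show "(\<lambda>x. complex_of_real (sin (pi * x) * h x)) \<in> L2"
    proof (rule L2_bounded)
      show "norm (complex_of_real (sin (pi * x) * h x)) \<le> 1 * R" for x
        unfolding norm_of_real abs_mult using R[of x] by (intro mult_mono) auto
    qed (intro borel_measurable_interval_measure_on, measurable)
    have "AE x in lborel. x \<notin> N"
      using N AE_not_in[of N lebesgue] by (simp add: negligible_iff_null_sets AE_completion_iff)
    then show "AE x in I01. (\<lambda>n. complex_of_real (sin (pi * x) * c n x)) \<longlonglongrightarrow> of_real (sin (pi * x) * h x)"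
      unfolding AE_interval_measure_on by eventually_elim (auto intro!: tendsto_intros clim)
    show "AE x in I01. (norm (complex_of_real (sin (pi * x) * c n x) - of_real (sin (pi * x) * h x)))\<^sup>2 \<le> (2 * R)\<^sup>2" for n
    proof (rule AE_I2)
      fix x
      have "\<bar>sin (pi * x)\<bar> * \<bar>c n x - h x\<bar> \<le> 1 * (2 * R)"
        using cR[of n x] R[of x] by (intro mult_mono abs_sin_le_one) auto
      then show "(norm (complex_of_real (sin (pi * x) * c n x) - of_real (sin (pi * x) * h x)))\<^sup>2 \<le> (2 * R)\<^sup>2"
        unfolding of_real_diff[symmetric] norm_of_real right_diff_distrib[symmetric] abs_mult
        by (intro power_mono) auto
    qed
    show "sine_approximable (\<lambda>x. complex_of_real (sin (pi * x) * c n x))" for n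
      by (rule sine_approximable_sin_continuous[OF c])
  qed auto
qed

text \<open>The factor sin(pi x) is divided out. It vanishes only at the two end points, so
  truncating \<open>f\<close> to the set where the quotient f / sin(pi x) is bounded by
  \<open>n\<close> loses nothing in the limit, and the error never exceeds \<open>f\<close>.\<close>

lemma sine_approximable_real:
  fixes f :: "real \<Rightarrow> real"
  assumes f: "(\<lambda>x. complex_of_real (f x)) \<in> L2"
  shows "sine_approximable (\<lambda>x. of_real (f x))"
proof -
  have "(\<lambda>x. Re (complex_of_real (f x))) \<in> borel_measurable I01"
    using borel_measurable_continuous_onI[OF continuous_on_Re[OF continuous_on_id]] L2_measurable[OF f]
    by (rule measurable_compose_rev)
  then have m: "(\<lambda>x. indicator {0..1} x * f x) \<in> borel_measurable borel"
    unfolding interval_measure_on_def by (subst (asm) borel_measurable_restrict_space_iff) auto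
  define S where "S n = {x. 0 < sin (pi * x) \<and> \<bar>indicator {0..1} x * f x\<bar> \<le> real n * sin (pi * x)}" for n
  have S: "S n \<in> sets borel" for n
    unfolding S_def using m by measurable
  define h where "h n x = indicator (S n) x * (indicator {0..1} x * f x) / sin (pi * x)" for n x
  have hm: "h n \<in> borel_measurable borel" for n
    unfolding h_def using m S by measurable
  have hR: "\<bar>h n x\<bar> \<le> real n" for n x
    by (auto simp: h_def S_def indicator_def field_simps)
  have hf: "sin (pi * x) * h n x = indicator (S n) x * f x" if "x \<in> {0..1}" for x n
    using that by (auto simp: h_def S_def indicator_def)
  show ?thesis
  proof (rule sine_approximable_limit[where f="\<lambda>n x. of_real (sin (pi * x) * h n x)" and H="\<lambda>x. (norm (complex_of_real (f x)))\<^sup>2"])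
    show "sine_approximable (\<lambda>x. complex_of_real (sin (pi * x) * h n x))" for n
      by (rule sine_approximable_sin_bounded[OF hm hR])
    show "AE x in I01. (norm (complex_of_real (sin (pi * x) * h n x) - of_real (f x)))\<^sup>2 \<le> (norm (complex_of_real (f x)))\<^sup>2" for n
      by (rule AE_I2) (auto simp: hf indicator_def)
    have "AE x in lborel. x \<notin> {0, 1::real}" by (intro AE_not_in finite_imp_null_set_lborel) auto
    then show "AE x in I01. (\<lambda>n. complex_of_real (sin (pi * x) * h n x)) \<longlonglongrightarrow> of_real (f x)"
      unfolding AE_interval_measure_on
    proof eventually_elim
      case (elim x)
      show ?case
      proof
        assume x: "x \<in> {0..1}"
        with elim have s: "sin (pi * x) > 0" by (intro sin_gt_zero) auto
        have "eventually (\<lambda>n. x \<in> S n) sequentially"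
        proof -
          obtain N where N: "\<bar>f x\<bar> / sin (pi * x) \<le> real N" using real_arch_simple by blast
          have "x \<in> S n" if "n \<ge> N" for n
          proof -
            have "\<bar>f x\<bar> / sin (pi * x) \<le> real n" using N that by linarith
            then show ?thesis using s x by (simp add: S_def field_simps)
          qed
          then show ?thesis by (auto simp: eventually_sequentially)
        qed
        then have "eventually (\<lambda>n. complex_of_real (sin (pi * x) * h n x) = of_real (f x)) sequentially"
          by eventually_elim (use x in \<open>simp only: hf, simp\<close>)
        then show "(\<lambda>n. complex_of_real (sin (pi * x) * h n x)) \<longlonglongrightarrow> of_real (f x)"
          by (rule tendsto_eventually)
      qed
    qed
  qed (use f in \<open>auto intro: L2_integrable simp del: norm_of_real\<close>)
qed

lemma sine_approximable_L2:
  assumes f: "f \<in> L2" shows "sine_approximable f"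
proof -
  note [measurable] = L2_measurable[OF f]
  have part: "(\<lambda>x. complex_of_real (g x)) \<in> L2" if [measurable]: "g \<in> borel_measurable I01" and g: "\<And>x. \<bar>g x\<bar> \<le> norm (f x)" for g
    unfolding L2_iff
    by (intro conjI Bochner_Integration.integrable_bound[OF L2_integrable[OF f]])
       (use power_mono[OF g, where n=2] in auto)
  have "sine_approximable (\<lambda>x. of_real (Re (f x)) + \<i> * of_real (Im (f x)))"
    by (intro sine_approximable_add sine_approximable_cmult sine_approximable_real part abs_Re_le_cmod abs_Im_le_cmod) measurable
  then show ?thesis by (simp flip: complex_eq)
qed

text \<open>The partial sums increase and stay below the squared norm by Bessel. Any approximating
  sine polynomial is at least as far from \<open>f\<close> as the Fourier partial sum of the same
  length, which bounds them from below.\<close>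

theorem Parseval_sine_basis:
  assumes f: "f \<in> L2"
  shows "(\<lambda>k. (norm (l2inner f (sine_basis (Suc k))))\<^sup>2) sums (l2norm f)\<^sup>2"
proof -
  let ?c = "\<lambda>k. (norm (l2inner f (sine_basis k)))\<^sup>2"
  have shift: "(\<Sum>k<n. ?c (Suc k)) = (\<Sum>k=1..n. ?c k)" for n
    by (simp add: sum.atLeast1_atMost_eq)
  have up: "(\<Sum>k=1..n. ?c k) \<le> (l2norm f)\<^sup>2" for n
    by (rule Bessel_inequality[OF f]) auto
  have "\<exists>N. \<forall>n\<ge>N. \<bar>(\<Sum>k=1..n. ?c k) - (l2norm f)\<^sup>2\<bar> < e" if "e > 0" for e :: real
  proof -
    obtain N a where a: "l2norm (\<lambda>x. f x - (\<Sum>k=1..N. a k * sine_basis k x)) < sqrt e"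
      using sine_approximable_L2[OF f] \<open>e > 0\<close> unfolding sine_approximable_def
      by (meson real_sqrt_gt_zero)
    have "(l2norm f)\<^sup>2 - (\<Sum>k=1..N. ?c k) \<le> (l2norm (\<lambda>x. f x - (\<Sum>k=1..N. a k * sine_basis k x)))\<^sup>2"
      by (subst l2norm_sine_sum_diff[OF f]) (auto intro: sum_nonneg)
    also have "\<dots> < (sqrt e)\<^sup>2" using a by (intro power_strict_mono l2norm_nonneg) auto
    finally have *: "(l2norm f)\<^sup>2 - (\<Sum>k=1..N. ?c k) < e" using \<open>e > 0\<close> by simp
    have "\<bar>(\<Sum>k=1..n. ?c k) - (l2norm f)\<^sup>2\<bar> < e" if "n \<ge> N" for n
    proof -
      have "(\<Sum>k=1..N. ?c k) \<le> (\<Sum>k=1..n. ?c k)" using that by (intro sum_mono2) auto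
      with * up[of n] show ?thesis by linarith
    qed
    then show ?thesis by blast
  qed
  then show ?thesis
    unfolding sums_def shift LIMSEQ_iff by (simp add: dist_real_def)
qed

section \<open>Fejer means\<close>

text \<open>The Cesaro weights: averaging the partial sums with 0, ..., N modes gives mode k this
  weight. It would vanish at k = N + 1.\<close>

definition fejer :: "nat \<Rightarrow> nat \<Rightarrow> real" where
  "fejer N k = 1 - real k / real (Suc N)"

lemma fejer_nonneg: "k \<le> N \<Longrightarrow> 0 \<le> fejer N k"
  by (simp add: fejer_def field_simps)

lemma fejer_le_one: "fejer N k \<le> 1"
  by (simp add: fejer_def)

text \<open>For every fixed mode the weights tend to 1, and they never exceed 1, so the series
  itself is a majorant and Tannery's theorem applies.\<close>

lemma fejer_sum_tendsto:
  fixes a :: "nat \<Rightarrow> real"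
  assumes "\<And>k. k \<ge> 1 \<Longrightarrow> a k \<ge> 0" and a: "(\<lambda>k. a (Suc k)) sums A"
  shows "(\<lambda>N. \<Sum>k=1..N. fejer N k * a k) \<longlonglongrightarrow> A"
proof -
  define b where "b k N = (if k < N then fejer N (Suc k) * a (Suc k) else 0)" for k N
  have "(\<lambda>N. suminf (\<lambda>k. b k N)) \<longlonglongrightarrow> suminf (\<lambda>k. a (Suc k))"
  proof (rule tannerys_theorem[THEN conjunct2, THEN conjunct2])
    show "(\<lambda>N. b k N) \<longlonglongrightarrow> a (Suc k)" for k
    proof (rule Lim_transform_eventually)
      have "(\<lambda>N. (1 - real (Suc k) * (1 / real (Suc N))) * a (Suc k)) \<longlonglongrightarrow> (1 - real (Suc k) * 0) * a (Suc k)"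
        by (intro tendsto_intros LIMSEQ_Suc lim_1_over_n)
      then show "(\<lambda>N. (1 - real (Suc k) * (1 / real (Suc N))) * a (Suc k)) \<longlonglongrightarrow> a (Suc k)" by simp
      show "\<forall>\<^sub>F N in sequentially. (1 - real (Suc k) * (1 / real (Suc N))) * a (Suc k) = b k N"
        using eventually_gt_at_top[of k] by eventually_elim (simp add: b_def fejer_def)
    qed
    have "norm (b k N) \<le> a (Suc k)" for k N
      using assms(1)[of "Suc k"] fejer_nonneg[of "Suc k" N] fejer_le_one[of N "Suc k"]
      by (auto simp: b_def abs_mult mult_left_le_one_le)
    then show "\<forall>\<^sub>F (k, N) in sequentially \<times>\<^sub>F sequentially. norm (b k N) \<le> a (Suc k)"
      by (intro always_eventually) auto
  qed (use a sums_summable in auto)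
  moreover have "suminf (\<lambda>k. b k N) = (\<Sum>k=1..N. fejer N k * a k)" for N
  proof -
    have "suminf (\<lambda>k. b k N) = (\<Sum>k<N. b k N)"
      by (intro suminf_finite) (auto simp: b_def)
    also have "\<dots> = (\<Sum>k=1..N. fejer N k * a k)"
      unfolding b_def One_nat_def sum.atLeast1_atMost_eq by (rule sum.cong) auto
    finally show ?thesis .
  qed
  ultimately show ?thesis using sums_unique[OF a] by simp
qed

text \<open>The left side is the squared modulus of the sum of exp(i j z) over j = 0, ..., N.
  Multiplied out, a difference of indices equal to k or -k occurs N + 1 - k times each; the right
  side is N + 1 times the Fejer kernel.\<close>

lemma fejer_square_identity:
  "(\<Sum>j\<le>N. cos (real j * z))\<^sup>2 + (\<Sum>j\<le>N. sin (real j * z))\<^sup>2 =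
    real (Suc N) + 2 * (\<Sum>k=1..N. (real (Suc N) - real k) * cos (real k * z))"
proof (induction N)
  case (Suc N)
  let ?C = "\<Sum>j\<le>N. cos (real j * z)" and ?S = "\<Sum>j\<le>N. sin (real j * z)"
  let ?c = "cos (real (Suc N) * z)" and ?s = "sin (real (Suc N) * z)"
  have "(\<Sum>j\<le>Suc N. cos (real j * z))\<^sup>2 + (\<Sum>j\<le>Suc N. sin (real j * z))\<^sup>2 =
      (?C\<^sup>2 + ?S\<^sup>2) + (?c\<^sup>2 + ?s\<^sup>2) + 2 * (\<Sum>j\<le>N. cos (real j * z) * ?c + sin (real j * z) * ?s)"
  proof -
    have "(C + c)\<^sup>2 + (S + s)\<^sup>2 = (C\<^sup>2 + S\<^sup>2) + (c\<^sup>2 + s\<^sup>2) + 2 * (C * c + S * s)" for C c S s :: real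
      by (simp add: power2_eq_square algebra_simps)
    then show ?thesis unfolding sum.atMost_Suc sum.distrib sum_distrib_right[symmetric] .
  qed
  also have "(\<Sum>j\<le>N. cos (real j * z) * ?c + sin (real j * z) * ?s) = (\<Sum>j\<le>N. cos (real (Suc N - j) * z))"
  proof (intro sum.cong refl)
    fix j assume "j \<in> {..N}"
    then have j: "real (Suc N - j) * z = real (Suc N) * z - real j * z"
      by (subst of_nat_diff) (auto simp: left_diff_distrib)
    show "cos (real j * z) * ?c + sin (real j * z) * ?s = cos (real (Suc N - j) * z)"
      unfolding j cos_diff by (simp only: mult.commute)
  qed
  \<comment> \<open>The new index N + 1 meets each old index j at the distance k = N + 1 - j, so
    every frequency from 1 to N + 1 gains one occurrence.\<close>
  also have "\<dots> = (\<Sum>k=1..Suc N. cos (real k * z))"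
    by (rule sum.reindex_bij_witness[where i="\<lambda>k. Suc N - k" and j="\<lambda>j. Suc N - j"]) auto
  also have "?C\<^sup>2 + ?S\<^sup>2 = real (Suc N) + 2 * (\<Sum>k=1..N. (real (Suc N) - real k) * cos (real k * z))"
    by (rule Suc.IH)
  also have "?c\<^sup>2 + ?s\<^sup>2 = 1" by simp
  also have "(\<Sum>k=1..N. (real (Suc N) - real k) * cos (real k * z)) =
      (\<Sum>k=1..Suc N. (real (Suc N) - real k) * cos (real k * z))" by simp
  also have "real (Suc N) + 2 * (\<Sum>k=1..Suc N. (real (Suc N) - real k) * cos (real k * z)) + 1
        + 2 * (\<Sum>k=1..Suc N. cos (real k * z)) =
      real (Suc (Suc N)) + 2 * (\<Sum>k=1..Suc N. (real (Suc (Suc N)) - real k) * cos (real k * z))"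
  proof -
    have "(\<Sum>k=1..Suc N. (real (Suc (Suc N)) - real k) * cos (real k * z)) =
        (\<Sum>k=1..Suc N. (real (Suc N) - real k) * cos (real k * z) + cos (real k * z))"
      by (intro sum.cong refl) (simp add: algebra_simps)
    then show ?thesis by (simp only: sum.distrib) simp
  qed
  finally show ?case .
qed simp

lemma fejer_kernel_nonneg: "0 \<le> 1 + 2 * (\<Sum>k=1..N. fejer N k * cos (real k * z))"
proof -
  have "0 \<le> (real (Suc N) + 2 * (\<Sum>k=1..N. (real (Suc N) - real k) * cos (real k * z))) / real (Suc N)"
    unfolding fejer_square_identity[symmetric] by (intro divide_nonneg_pos) auto
  also have "\<dots> = 1 + 2 * (\<Sum>k=1..N. (real (Suc N) - real k) * cos (real k * z) / real (Suc N))"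
    unfolding add_divide_distrib times_divide_eq_right[symmetric] sum_divide_distrib
    by (simp only: times_divide_eq_right) simp
  also have "(\<Sum>k=1..N. (real (Suc N) - real k) * cos (real k * z) / real (Suc N)) =
      (\<Sum>k=1..N. fejer N k * cos (real k * z))"
    by (intro sum.cong refl) (simp add: fejer_def field_simps)
  finally show ?thesis .
qed

lemma cos_diff_minus_cos_add: "cos (a - b) - cos (a + b) = 2 * sin a * sin (b :: real)"
  and cos_diff_plus_cos_add: "cos (a - b) + cos (a + b) = 2 * cos a * cos (b :: real)"
  by (simp_all add: cos_add cos_diff)

text \<open>With K the Fejer kernel, the sine kernel is half the difference and the cosine kernel
  half the sum of K at pi(x - y) and at pi(x + y). Both values are nonnegative, so the half sum
  dominates. Unlike the sine kernel, the cosine kernel contains the constant 1, which gives it mass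
  1.\<close>

lemma abs_fejer_sin_kernel_le:
  "\<bar>\<Sum>k=1..N. fejer N k * (2 * sin (real k * pi * x) * sin (real k * pi * y))\<bar> \<le>
    1 + 2 * (\<Sum>k=1..N. fejer N k * cos (real k * pi * x) * cos (real k * pi * y))"
proof -
  let ?K = "\<lambda>z. 1 + 2 * (\<Sum>k=1..N. fejer N k * cos (real k * z))"
  have 1: "(\<Sum>k=1..N. fejer N k * (2 * sin (real k * pi * x) * sin (real k * pi * y))) =
      (?K (pi * x - pi * y) - ?K (pi * x + pi * y)) / 2"
  proof -
    have "fejer N k * (2 * sin (real k * pi * x) * sin (real k * pi * y)) =
        fejer N k * cos (real k * (pi * x - pi * y)) - fejer N k * cos (real k * (pi * x + pi * y))" for k
    proof -
      have k: "real k * (pi * x - pi * y) = real k * pi * x - real k * pi * y"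
        "real k * (pi * x + pi * y) = real k * pi * x + real k * pi * y"
        by (simp_all add: algebra_simps)
      show ?thesis
        unfolding k cos_diff_minus_cos_add[symmetric] by (rule right_diff_distrib)
    qed
    then show ?thesis by (simp add: sum_subtractf)
  qed
  have 2: "1 + 2 * (\<Sum>k=1..N. fejer N k * cos (real k * pi * x) * cos (real k * pi * y)) =
      (?K (pi * x - pi * y) + ?K (pi * x + pi * y)) / 2"
  proof -
    have "(\<Sum>k=1..N. fejer N k * cos (real k * (pi * x - pi * y))) + (\<Sum>k=1..N. fejer N k * cos (real k * (pi * x + pi * y)))
       = (\<Sum>k=1..N. 2 * (fejer N k * cos (real k * pi * x) * cos (real k * pi * y)))"
      unfolding sum.distrib[symmetric]
    proof (intro sum.cong refl)
      fix k
      have k: "real k * (pi * x - pi * y) = real k * pi * x - real k * pi * y"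
        "real k * (pi * x + pi * y) = real k * pi * x + real k * pi * y"
        by (simp_all add: algebra_simps)
      show "fejer N k * cos (real k * (pi * x - pi * y)) + fejer N k * cos (real k * (pi * x + pi * y)) =
          2 * (fejer N k * cos (real k * pi * x) * cos (real k * pi * y))"
        unfolding k using arg_cong[OF cos_diff_plus_cos_add, of "(*) (fejer N k)" "real k * pi * x" "real k * pi * y"]
        by (simp only: distrib_left mult_ac)
    qed
    then show ?thesis unfolding sum_distrib_left[symmetric] by simp
  qed
  have "\<bar>(u - v) / 2\<bar> \<le> (u + v) / 2" if "0 \<le> u" "0 \<le> v" for u v :: real
    using that by auto
  from this[OF fejer_kernel_nonneg fejer_kernel_nonneg] show ?thesis unfolding 1 2 .
qed

section \<open>Fejer means as bilinear forms\<close>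

lemma integrable_times_bounded_continuous:
  fixes f :: "real \<Rightarrow> 'a :: {real_normed_field, banach, second_countable_topology}" and g :: "real \<Rightarrow> 'a"
  assumes f: "integrable (interval_measure_on a b) f" and g: "continuous_on UNIV g" "\<And>x. norm (g x) \<le> C"
  shows "integrable (interval_measure_on a b) (\<lambda>x. f x * g x)"
proof (rule Bochner_Integration.integrable_bound)
  show "integrable (interval_measure_on a b) (\<lambda>x. C * norm (f x))" using f by simp
  show "(\<lambda>x. f x * g x) \<in> borel_measurable (interval_measure_on a b)"
    using f borel_measurable_I01_continuous[OF g(1)] by measurable
  have "norm (f x * g x) \<le> norm (C * norm (f x))" for x
    using mult_right_mono[OF g(2)[of x], of "norm (f x)"]
    by (simp add: norm_mult mult.commute)
  then show "AE x in interval_measure_on a b. norm (f x * g x) \<le> norm (C * norm (f x))" by simp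
qed

lemma cnj_sine_basis [simp]: "cnj (sine_basis k x) = sine_basis k x"
  by (simp add: sine_basis_def)

lemma continuous_sine_basis: "continuous_on A (sine_basis k)"
  unfolding sine_basis_def[abs_def] by (intro continuous_intros)

text \<open>The kernel of the Fejer means is dominated by a symmetric Markov kernel, which turns a
  pointwise bound of Young type into a bound for the bilinear form.\<close>

lemma fejer_form_bound:
  assumes h: "integrable I01 h" and f: "integrable I01 f"
    and A: "integrable I01 A" and B: "integrable I01 B"
    and young: "\<And>x y. norm (h x) * norm (f y) \<le> A x + B y"
  shows "norm (\<Sum>k=1..N. of_real (fejer N k) * l2inner h (sine_basis k) * cnj (l2inner f (sine_basis k)))
    \<le> (\<integral>x. A x \<partial>I01) + (\<integral>x. B x \<partial>I01)"
proof -
  let ?e = "sine_basis"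
  define w where "w k = complex_of_real (fejer N k)" for k
  \<comment> \<open>\<open>D\<close> is the kernel of the bilinear form, \<open>G\<close> the
    nonnegative symmetric kernel of total mass 1 in each variable that dominates it.\<close>
  define D where "D x y = (\<Sum>k=1..N. w k * ?e k x * ?e k y)" for x y
  define G where "G x y = 1 + 2 * (\<Sum>k=1..N. fejer N k * cos (real k * pi * x) * cos (real k * pi * y))" for x y
  have f': "integrable I01 (\<lambda>x. cnj (f x))" using f by simp
  have he: "integrable I01 (\<lambda>x. h x * ?e k x)" for k
    by (rule integrable_times_bounded_continuous[OF h continuous_sine_basis norm_sine_basis_le])
  have fe: "integrable I01 (\<lambda>x. cnj (f x) * ?e k x)" for k
    by (rule integrable_times_bounded_continuous[OF f' continuous_sine_basis norm_sine_basis_le])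
  have cos_int: "integrable I01 (\<lambda>y. u y * cos (real k * pi * y))" if "integrable I01 u" for u k
    by (rule integrable_times_bounded_continuous[OF that, where C=1]) (auto intro!: continuous_intros)
  have DG: "norm (D x y) \<le> G x y" for x y
  proof -
    have "D x y = of_real (\<Sum>k=1..N. fejer N k * (2 * sin (real k * pi * x) * sin (real k * pi * y)))"
      unfolding D_def w_def sine_basis_def of_real_sum
      by (intro sum.cong refl) (simp add: mult_ac flip: of_real_mult)
    then show ?thesis unfolding G_def by (simp only: norm_of_real abs_fejer_sin_kernel_le)
  qed
  have inner_h: "l2inner h (?e k) = (\<integral>x. h x * ?e k x \<partial>I01)" for k by (simp add: l2inner_def)
  have inner_f: "cnj (l2inner f (?e k)) = (\<integral>y. cnj (f y) * ?e k y \<partial>I01)" for k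
    unfolding l2inner_def Bochner_Integration.integral_cnj[symmetric] by simp
  have fD: "integrable I01 (\<lambda>y. cnj (f y) * D x y)"
    "(\<integral>y. cnj (f y) * D x y \<partial>I01) = (\<Sum>k=1..N. w k * ?e k x * (\<integral>y. cnj (f y) * ?e k y \<partial>I01))" for x
  proof -
    have eq: "cnj (f y) * D x y = (\<Sum>k=1..N. (w k * ?e k x) * (cnj (f y) * ?e k y))" for y
      unfolding D_def sum_distrib_left by (intro sum.cong refl) simp
    show "integrable I01 (\<lambda>y. cnj (f y) * D x y)"
      unfolding eq by (intro Bochner_Integration.integrable_sum integrable_mult_right fe)
    show "(\<integral>y. cnj (f y) * D x y \<partial>I01) = (\<Sum>k=1..N. w k * ?e k x * (\<integral>y. cnj (f y) * ?e k y \<partial>I01))"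
      unfolding eq by (subst Bochner_Integration.integral_sum) (auto intro!: integrable_mult_right fe)
  qed
  have uG: "integrable I01 (\<lambda>y. u y * G x y)"
    "(\<integral>y. u y * G x y \<partial>I01) = (\<integral>y. u y \<partial>I01) + 2 * (\<Sum>k=1..N. fejer N k * cos (real k * pi * x) * (\<integral>y. u y * cos (real k * pi * y) \<partial>I01))"
    if u: "integrable I01 u" for u x
  proof -
    have eq: "u y * G x y = u y + 2 * (\<Sum>k=1..N. (fejer N k * cos (real k * pi * x)) * (u y * cos (real k * pi * y)))" for y
      unfolding G_def sum_distrib_left distrib_left by (simp add: mult_ac)
    have i: "integrable I01 (\<lambda>y. \<Sum>k=1..N. (fejer N k * cos (real k * pi * x)) * (u y * cos (real k * pi * y)))"
      by (intro Bochner_Integration.integrable_sum integrable_mult_right cos_int u)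
    show "integrable I01 (\<lambda>y. u y * G x y)"
      unfolding eq by (intro Bochner_Integration.integrable_add integrable_mult_right u i)
    show "(\<integral>y. u y * G x y \<partial>I01) = (\<integral>y. u y \<partial>I01) + 2 * (\<Sum>k=1..N. fejer N k * cos (real k * pi * x) * (\<integral>y. u y * cos (real k * pi * y) \<partial>I01))"
      unfolding eq Bochner_Integration.integral_add[OF u integrable_mult_right[OF i]] integral_mult_right_zero
      by (subst Bochner_Integration.integral_sum) (auto intro!: integrable_mult_right cos_int u)
  qed
  have G1: "(\<integral>y. G x y \<partial>I01) = 1" for x
  proof -
    have "(\<Sum>k=1..N. fejer N k * cos (real k * pi * x) * (\<integral>y. 1 * cos (real k * pi * y) \<partial>I01)) = 0"
      by (intro sum.neutral ballI) (simp only: mult_1_left integral_cos_I01, simp)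
    with uG(2)[of "\<lambda>_. 1" x] show ?thesis by simp
  qed
  \<comment> \<open>This is the integral over y of (A x + B y) G x y: mass 1 in y leaves
    \<open>A x\<close> unchanged. Integrating in x as well, mass 1 in the other variable leaves the
    integral of \<open>B\<close>.\<close>
  define \<Phi> where "\<Phi> x = A x + (\<integral>y. B y * G x y \<partial>I01)" for x
  have \<Phi>: "integrable I01 \<Phi>" "(\<integral>x. \<Phi> x \<partial>I01) = (\<integral>x. A x \<partial>I01) + (\<integral>x. B x \<partial>I01)"
  proof -
    define b where "b k = (\<integral>y. B y * cos (real k * pi * y) \<partial>I01)" for k
    have eq: "\<Phi> x = A x + ((\<integral>y. B y \<partial>I01) + 2 * (\<Sum>k=1..N. (fejer N k * b k) * cos (real k * pi * x)))" for x
      unfolding \<Phi>_def uG(2)[OF B] b_def by (simp add: mult_ac)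
    have i: "integrable I01 (\<lambda>x. cos (real k * pi * x))" for k
      by (intro integrable_I01_continuous continuous_intros)
    have i': "integrable I01 (\<lambda>x. \<Sum>k=1..N. (fejer N k * b k) * cos (real k * pi * x))"
      by (intro Bochner_Integration.integrable_sum integrable_mult_right i)
    have 0: "(\<integral>x. (\<Sum>k=1..N. (fejer N k * b k) * cos (real k * pi * x)) \<partial>I01) = 0"
    proof -
      have "(\<integral>x. (\<Sum>k=1..N. (fejer N k * b k) * cos (real k * pi * x)) \<partial>I01) =
          (\<Sum>k=1..N. (fejer N k * b k) * (\<integral>x. cos (real k * pi * x) \<partial>I01))"
        by (subst Bochner_Integration.integral_sum) (auto intro!: integrable_mult_right i)
      also have "\<dots> = 0" unfolding integral_cos_I01 by (intro sum.neutral) auto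
      finally show ?thesis .
    qed
    show "integrable I01 \<Phi>"
      unfolding eq by (intro Bochner_Integration.integrable_add integrable_mult_right A i' integrable_const_I01)
    show "(\<integral>x. \<Phi> x \<partial>I01) = (\<integral>x. A x \<partial>I01) + (\<integral>x. B x \<partial>I01)"
      unfolding eq
      by (subst Bochner_Integration.integral_add[OF A], intro Bochner_Integration.integrable_add integrable_mult_right i' integrable_const_I01,
          subst Bochner_Integration.integral_add[OF integrable_const_I01 integrable_mult_right[OF i']])
         (simp only: integral_mult_right_zero 0 integral_const_I01 mult_zero_right add_0_right)
  qed
  define F where "F x = h x * (\<integral>y. cnj (f y) * D x y \<partial>I01)" for x
  have Feq: "F x = (\<Sum>k=1..N. (w k * cnj (l2inner f (?e k))) * (h x * ?e k x))" for x
    unfolding F_def fD inner_f sum_distrib_left by (simp add: mult_ac)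
  have "(\<Sum>k=1..N. w k * l2inner h (?e k) * cnj (l2inner f (?e k))) = (\<integral>x. F x \<partial>I01)"
    unfolding Feq inner_h
    by (subst Bochner_Integration.integral_sum, intro integrable_mult_right he)
       (unfold integral_mult_right_zero, simp only: mult_ac)
  also have "norm \<dots> \<le> (\<integral>x. norm (F x) \<partial>I01)" by (rule integral_norm_bound)
  also have "\<dots> \<le> (\<integral>x. \<Phi> x \<partial>I01)"
  proof (rule integral_mono)
    show "integrable I01 (\<lambda>x. norm (F x))"
      unfolding Feq by (intro integrable_norm Bochner_Integration.integrable_sum integrable_mult_right he)
    show "norm (F x) \<le> \<Phi> x" for x
    proof -
      have "norm (F x) \<le> norm (h x) * (\<integral>y. norm (cnj (f y) * D x y) \<partial>I01)"
        unfolding F_def norm_mult by (intro mult_left_mono order_trans[OF integral_norm_bound]) (auto simp: norm_mult)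
      also have "\<dots> = (\<integral>y. norm (h x) * norm (cnj (f y) * D x y) \<partial>I01)" by simp
      also have "\<dots> \<le> (\<integral>y. (A x + B y) * G x y \<partial>I01)"
      proof (rule integral_mono)
        show "integrable I01 (\<lambda>y. norm (h x) * norm (cnj (f y) * D x y))"
          by (intro integrable_mult_right integrable_norm fD)
        show "integrable I01 (\<lambda>y. (A x + B y) * G x y)"
          by (rule uG) (intro Bochner_Integration.integrable_add B integrable_const_I01)
        show "norm (h x) * norm (cnj (f y) * D x y) \<le> (A x + B y) * G x y" for y
          using mult_mono[OF young[of x y] DG[of x y]] order_trans[OF norm_ge_zero DG[of x y]]
            order_trans[OF mult_nonneg_nonneg[OF norm_ge_zero norm_ge_zero] young[of x y]]
          by (simp add: norm_mult mult.assoc)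
      qed
      also have "\<dots> = \<Phi> x"
      proof -
        have "(\<integral>y. A x * G x y + B y * G x y \<partial>I01) = (\<integral>y. A x * G x y \<partial>I01) + (\<integral>y. B y * G x y \<partial>I01)"
          by (intro Bochner_Integration.integral_add uG B integrable_const_I01)
        then show ?thesis unfolding \<Phi>_def distrib_right by (simp add: G1)
      qed
      finally show ?thesis .
    qed
  qed (rule \<Phi>)
  finally show ?thesis unfolding \<Phi>(2) w_def .
qed

text \<open>Moving the weights to the second argument turns the form into the inner product of
  \<open>g\<close> with the Fejer mean of \<open>f\<close>. These means converge to \<open>f\<close>
  in \<open>L2\<close>, by Parseval applied to the weighted energies.\<close>

lemma fejer_form_tendsto:
  assumes g: "g \<in> L2" and f: "f \<in> L2"
  shows "(\<lambda>N. \<Sum>k=1..N. of_real (fejer N k) * l2inner g (sine_basis k) * cnj (l2inner f (sine_basis k)))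
    \<longlonglongrightarrow> l2inner g f"
proof -
  let ?c = "\<lambda>k. l2inner f (sine_basis k)"
  define s where "s N x = (\<Sum>k=1..N. (of_real (fejer N k) * ?c k) * sine_basis k x)" for N x
  have sL: "s N \<in> L2" for N unfolding s_def[abs_def] by (intro L2_sum L2_cmult sine_basis_L2)
  have form: "(\<Sum>k=1..N. of_real (fejer N k) * l2inner g (sine_basis k) * cnj (?c k)) = l2inner g (s N)" for N
  proof -
    have "l2inner (s N) g = (\<Sum>k=1..N. of_real (fejer N k) * ?c k * l2inner (sine_basis k) g)"
      unfolding s_def[abs_def] by (subst l2inner_sum_left) (auto intro: L2_cmult sine_basis_L2 g simp: l2inner_cmult_left)
    then have "cnj (l2inner (s N) g) = (\<Sum>k=1..N. of_real (fejer N k) * cnj (?c k) * cnj (l2inner (sine_basis k) g))"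
      by simp
    then show ?thesis unfolding l2inner_commute[symmetric] by (simp add: mult_ac)
  qed
  have bound: "(l2norm (\<lambda>x. f x - s N x))\<^sup>2 \<le> (l2norm f)\<^sup>2 - (\<Sum>k=1..N. fejer N k * (norm (?c k))\<^sup>2)" for N
  proof -
    have "(l2norm (\<lambda>x. f x - s N x))\<^sup>2 = (l2norm f)\<^sup>2 - (\<Sum>k=1..N. (norm (?c k))\<^sup>2)
        + (\<Sum>k=1..N. (norm (?c k - of_real (fejer N k) * ?c k))\<^sup>2)"
      unfolding s_def by (rule l2norm_sine_sum_diff[OF f]) auto
    \<comment> \<open>The damping error carries the factor (1 - w)^2, which is at most 1 - w for a
      weight w between 0 and 1. That makes the error comparable with the loss of weighted
      energy.\<close>
    also have "(\<Sum>k=1..N. (norm (?c k - of_real (fejer N k) * ?c k))\<^sup>2) \<le> (\<Sum>k=1..N. (1 - fejer N k) * (norm (?c k))\<^sup>2)"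
    proof (rule sum_mono)
      fix k assume "k \<in> {1..N}"
      then have w: "0 \<le> 1 - fejer N k" "1 - fejer N k \<le> 1" using fejer_nonneg[of k N] fejer_le_one[of N k] by auto
      have "?c k - of_real (fejer N k) * ?c k = of_real (1 - fejer N k) * ?c k" by (simp add: algebra_simps)
      then have "(norm (?c k - of_real (fejer N k) * ?c k))\<^sup>2 = (1 - fejer N k) * (1 - fejer N k) * (norm (?c k))\<^sup>2"
        by (simp only: norm_mult norm_of_real power_mult_distrib power2_abs) (simp add: power2_eq_square)
      also have "\<dots> \<le> (1 - fejer N k) * (norm (?c k))\<^sup>2"
        using w by (intro mult_right_mono mult_left_le) auto
      finally show "(norm (?c k - of_real (fejer N k) * ?c k))\<^sup>2 \<le> (1 - fejer N k) * (norm (?c k))\<^sup>2" .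
    qed
    finally show ?thesis by (simp add: left_diff_distrib sum_subtractf)
  qed
  have "(\<lambda>N. (l2norm f)\<^sup>2 - (\<Sum>k=1..N. fejer N k * (norm (?c k))\<^sup>2)) \<longlonglongrightarrow> (l2norm f)\<^sup>2 - (l2norm f)\<^sup>2"
    by (intro tendsto_diff tendsto_const fejer_sum_tendsto Parseval_sine_basis f) auto
  then have up: "(\<lambda>N. (l2norm f)\<^sup>2 - (\<Sum>k=1..N. fejer N k * (norm (?c k))\<^sup>2)) \<longlonglongrightarrow> 0" by simp
  have "(\<lambda>N. (l2norm (\<lambda>x. f x - s N x))\<^sup>2) \<longlonglongrightarrow> 0"
    by (rule tendsto_sandwich[OF always_eventually always_eventually tendsto_const up]) (simp_all only: bound zero_le_power2 simp_thms)
  from tendsto_real_sqrt[OF this] have "(\<lambda>N. l2norm g * l2norm (\<lambda>x. f x - s N x)) \<longlonglongrightarrow> l2norm g * 0"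
    by (intro tendsto_mult tendsto_const) (simp add: l2norm_nonneg)
  then have lim0: "(\<lambda>N. l2norm g * l2norm (\<lambda>x. f x - s N x)) \<longlonglongrightarrow> 0" by simp
  have "(\<lambda>N. l2inner g f - l2inner g (s N)) \<longlonglongrightarrow> 0"
  proof (rule Lim_null_comparison[OF always_eventually lim0], rule allI)
    show "norm (l2inner g f - l2inner g (s N)) \<le> l2norm g * l2norm (\<lambda>x. f x - s N x)" for N
      using l2inner_Cauchy_Schwarz[OF g L2_diff[OF f sL]] by (simp add: l2inner_diff_right f g sL)
  qed
  from tendsto_diff[OF tendsto_const this, of "l2inner g f"] show ?thesis unfolding form by simp
qed

section \<open>The nonlinear term\<close>

lemma Lp4_integrable:
  assumes f: "f \<in> Lp 4 I01" and "p \<le> 4"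
  shows "integrable I01 (\<lambda>x. norm (f x) ^ p)"
proof (rule Bochner_Integration.integrable_bound[where f="\<lambda>x. 1 + norm (f x) ^ 4"])
  show "integrable I01 (\<lambda>x. 1 + norm (f x) ^ 4)"
    using f by (intro Bochner_Integration.integrable_add integrable_const_I01) (auto simp: Lp_def)
  show "(\<lambda>x. norm (f x) ^ p) \<in> borel_measurable I01" using f by (auto simp: Lp_def)
  have "a ^ p \<le> 1 + a ^ 4" if "a \<ge> 0" for a :: real
  proof (cases "a \<le> 1")
    case True
    with that have "a ^ p \<le> 1" by (simp add: power_le_one)
    with that show ?thesis by (meson add_increasing2 zero_le_power)
  next
    case False
    then have "a ^ p \<le> a ^ 4" using \<open>p \<le> 4\<close> by (intro power_increasing) auto
    then show ?thesis by simp
  qed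
  then show "AE x in I01. norm (norm (f x) ^ p) \<le> norm (1 + norm (f x) ^ 4)"
    by (intro AE_I2) simp
qed

lemma Lp4_L2: "f \<in> Lp 4 I01 \<Longrightarrow> f \<in> L2"
  using Lp4_integrable[of f 2] by (auto simp: Lp_def)

text \<open>A Young inequality with a free parameter: small \<kappa> makes the part with
  \<open>b\<close> small at the expense of the part with \<open>a\<close>. Comparing
  \<open>\<kappa> * b\<close> with \<open>a\<close> proves it with constants that are not sharp but
  suffice.\<close>

lemma young_cubic:
  fixes a b \<kappa> :: real
  assumes "a \<ge> 0" "b \<ge> 0" "\<kappa> > 0"
  shows "a ^ 3 * b \<le> a ^ 4 / \<kappa> + \<kappa> ^ 3 * b ^ 4"
proof -
  have nonneg: "0 \<le> a ^ 4 / \<kappa>" "0 \<le> \<kappa> ^ 3 * b ^ 4" using assms by simp_all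
  show ?thesis
  proof (cases "\<kappa> * b \<le> a")
    case True
    then have "a ^ 3 * b \<le> a ^ 3 * (a / \<kappa>)"
      using assms by (intro mult_left_mono) (simp_all add: pos_le_divide_eq mult.commute)
    also have "\<dots> = a ^ 4 / \<kappa>" by (simp add: eval_nat_numeral)
    finally show ?thesis using nonneg by linarith
  next
    case False
    then have "a ^ 3 * b \<le> (\<kappa> * b) ^ 3 * b" using assms by (intro mult_right_mono power_mono) auto
    also have "\<dots> = \<kappa> ^ 3 * b ^ 4" by (simp add: eval_nat_numeral)
    finally show ?thesis using nonneg by linarith
  qed
qed

definition cubic :: "(real \<Rightarrow> complex) \<Rightarrow> real \<Rightarrow> complex" where
  "cubic f x = of_real ((norm (f x))\<^sup>2) * f x"

lemma norm_cubic: "norm (cubic f x) = norm (f x) ^ 3"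
  by (simp add: cubic_def norm_mult norm_power power2_eq_square power3_eq_cube)

lemma cubic_measurable: "f \<in> borel_measurable N \<Longrightarrow> cubic f \<in> borel_measurable N"
  unfolding cubic_def[abs_def] by measurable

lemma cubic_integrable:
  assumes "f \<in> Lp 4 I01" shows "integrable I01 (cubic f)"
  by (rule Bochner_Integration.integrable_bound[OF Lp4_integrable[OF assms, of 3]])
     (use assms in \<open>auto simp: Lp_def norm_cubic intro!: cubic_measurable\<close>)

text \<open>The Fejer mean of the pairing of \<open>cubic f\<close> with \<open>f\<close>, formally
  approximating the integral of |f|^4. Its imaginary part is the contribution of the cubic term to
  the weighted energy.\<close>

definition fejer_nonlinearity :: "nat \<Rightarrow> (real \<Rightarrow> complex) \<Rightarrow> complex" where
  "fejer_nonlinearity N f =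
    (\<Sum>k=1..N. of_real (fejer N k) * l2inner (cubic f) (sine_basis k) * cnj (l2inner f (sine_basis k)))"

lemma Lp4_norm_integrable: "f \<in> Lp 4 I01 \<Longrightarrow> integrable I01 f"
  using Lp4_integrable[of f 1] by (auto simp: Lp_def integrable_norm_iff)

lemma norm_fejer_nonlinearity_le:
  assumes f: "f \<in> Lp 4 I01"
  shows "norm (fejer_nonlinearity N f) \<le> 2 * (\<integral>x. norm (f x) ^ 4 \<partial>I01)"
proof -
  have "norm (fejer_nonlinearity N f) \<le> (\<integral>x. norm (f x) ^ 4 \<partial>I01) + (\<integral>x. norm (f x) ^ 4 \<partial>I01)"
    unfolding fejer_nonlinearity_def
    by (rule fejer_form_bound[OF cubic_integrable[OF f] Lp4_norm_integrable[OF f] Lp4_integrable[OF f] Lp4_integrable[OF f]])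
       (use young_cubic[of _ _ 1] in \<open>auto simp: norm_cubic\<close>)
  then show ?thesis by simp
qed

text \<open>\<open>cubic f\<close> is only integrable to the power 4/3, so the convergence in
  \<open>L2\<close> does not apply to it. It is split at the level |f| = R: the part with small
  values is bounded and its form converges to a real number, while the part with large values is
  controlled by the Young bound.\<close>

lemma fejer_nonlinearity_Im_tendsto:
  assumes f: "f \<in> Lp 4 I01"
  shows "(\<lambda>N. Im (fejer_nonlinearity N f)) \<longlonglongrightarrow> 0"
proof -
  have fm[measurable]: "f \<in> borel_measurable I01" and f4: "integrable I01 (\<lambda>x. norm (f x) ^ 4)"
    using f by (auto simp: Lp_def)
  note [measurable] = cubic_measurable[OF fm]
  define J where "J = (\<integral>x. norm (f x) ^ 4 \<partial>I01)"
  define T where "T R = (\<integral>x. indicator {x. norm (f x) > real R} x * norm (f x) ^ 4 \<partial>I01)" for R :: nat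
  have "T \<longlonglongrightarrow> (\<integral>x. 0 \<partial>I01)"
    unfolding T_def
  proof (rule integral_dominated_convergence[OF _ _ f4])
    show "AE x in I01. (\<lambda>R. indicator {x. norm (f x) > real R} x * norm (f x) ^ 4) \<longlonglongrightarrow> 0"
    proof (rule AE_I2)
      fix x
      obtain R0 :: nat where "norm (f x) \<le> real R0" using real_arch_simple by blast
      then have "\<forall>\<^sub>F R in sequentially. indicator {x. norm (f x) > real R} x * norm (f x) ^ 4 = 0"
        by (intro eventually_mono[OF eventually_ge_at_top[of R0]]) (auto simp: indicator_def)
      then show "(\<lambda>R. indicator {x. norm (f x) > real R} x * norm (f x) ^ 4) \<longlonglongrightarrow> 0" by (rule tendsto_eventually)
    qed
  qed (auto simp: indicator_def)
  then have T0: "T \<longlonglongrightarrow> 0" by simp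
  have key: "\<forall>\<^sub>F N in sequentially. \<bar>Im (fejer_nonlinearity N f)\<bar> < e + T R / \<kappa> + \<kappa> ^ 3 * J"
    if "e > 0" "\<kappa> > 0" for e \<kappa> :: real and R
  proof -
    define h1 h2 where "h1 x = indicator {x. norm (f x) \<le> real R} x * cubic f x"
      and "h2 x = indicator {x. norm (f x) > real R} x * cubic f x" for x
    have h12: "cubic f x = h1 x + h2 x" for x by (simp add: h1_def h2_def indicator_def)
    have m: "h1 \<in> borel_measurable I01" "h2 \<in> borel_measurable I01"
      unfolding h1_def[abs_def] h2_def[abs_def] by measurable
    have h1L: "h1 \<in> L2"
      by (rule L2_bounded[OF m(1), of "real R ^ 3"])
         (auto simp: h1_def indicator_def norm_cubic intro!: power_mono)
    have i: "integrable I01 h1" "integrable I01 h2"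
      by (rule Bochner_Integration.integrable_bound[OF cubic_integrable[OF f]]; use m in \<open>auto simp: h1_def h2_def indicator_def\<close>)+
    have ie: "integrable I01 (\<lambda>x. h x * cnj (sine_basis k x))" if "integrable I01 h" for h k
      unfolding cnj_sine_basis by (rule integrable_times_bounded_continuous[OF that continuous_sine_basis norm_sine_basis_le])
    let ?F = "\<lambda>h N. \<Sum>k=1..N. of_real (fejer N k) * l2inner h (sine_basis k) * cnj (l2inner f (sine_basis k))"
    have split: "fejer_nonlinearity N f = ?F h1 N + ?F h2 N" for N
    proof -
      have "l2inner (cubic f) (sine_basis k) = l2inner h1 (sine_basis k) + l2inner h2 (sine_basis k)" for k
        unfolding l2inner_def h12 distrib_right by (intro Bochner_Integration.integral_add ie i)
      then show ?thesis unfolding fejer_nonlinearity_def by (simp add: sum.distrib algebra_simps)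
    qed
    \<comment> \<open>The truncation is a real factor, so the integrand remains |f|^4 times a real
      number.\<close>
    have "Im (l2inner h1 f) = 0"
    proof -
      have "h1 x * cnj (f x) = of_real (indicator {x. norm (f x) \<le> real R} x * (norm (f x))\<^sup>2 * (norm (f x))\<^sup>2)" for x
      proof -
        have "h1 x * cnj (f x) = of_real (indicator {x. norm (f x) \<le> real R} x * (norm (f x))\<^sup>2) * (f x * cnj (f x))"
          by (simp add: h1_def cubic_def indicator_def)
        then show ?thesis by (simp only: complex_norm_square[symmetric] of_real_mult)
      qed
      then show ?thesis unfolding l2inner_def by (simp only: integral_complex_of_real Im_complex_of_real)
    qed
    moreover have "(\<lambda>N. Im (?F h1 N)) \<longlonglongrightarrow> Im (l2inner h1 f)"
      by (intro tendsto_Im fejer_form_tendsto h1L Lp4_L2 f)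
    ultimately have "(\<lambda>N. Im (?F h1 N)) \<longlonglongrightarrow> 0" by simp
    then have ev: "\<forall>\<^sub>F N in sequentially. \<bar>Im (?F h1 N)\<bar> < e"
      using tendstoD[OF _ \<open>e > 0\<close>] by (fastforce simp: dist_real_def)
    have F2: "norm (?F h2 N) \<le> T R / \<kappa> + \<kappa> ^ 3 * J" for N
    proof -
      have "norm (?F h2 N) \<le> (\<integral>x. (indicator {x. norm (f x) > real R} x * norm (f x) ^ 4) / \<kappa> \<partial>I01) + (\<integral>x. \<kappa> ^ 3 * norm (f x) ^ 4 \<partial>I01)"
      proof (rule fejer_form_bound[OF i(2) Lp4_norm_integrable[OF f]])
        show "integrable I01 (\<lambda>x. (indicator {x. norm (f x) > real R} x * norm (f x) ^ 4) / \<kappa>)"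
          by (intro integrable_divide Bochner_Integration.integrable_bound[OF f4]) (measurable, auto simp: indicator_def)
        show "norm (h2 x) * norm (f y) \<le> (indicator {x. norm (f x) > real R} x * norm (f x) ^ 4) / \<kappa> + \<kappa> ^ 3 * norm (f y) ^ 4" for x y
          using young_cubic[of "norm (f x)" "norm (f y)" \<kappa>] \<open>\<kappa> > 0\<close> by (auto simp: h2_def indicator_def norm_cubic)
      qed (use f4 in auto)
      then show ?thesis by (simp add: T_def J_def)
    qed
    show ?thesis using ev
    proof eventually_elim
      case (elim N)
      have "\<bar>Im (fejer_nonlinearity N f)\<bar> \<le> \<bar>Im (?F h1 N)\<bar> + \<bar>Im (?F h2 N)\<bar>" unfolding split by simp
      also have "\<bar>Im (?F h2 N)\<bar> \<le> T R / \<kappa> + \<kappa> ^ 3 * J" using abs_Im_le_cmod F2 order_trans by blast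
      finally show ?case using elim by linarith
    qed
  qed
  show ?thesis
    unfolding tendsto_iff dist_real_def
  proof (intro allI impI)
    fix e :: real assume e: "e > 0"
    have "J \<ge> 0" unfolding J_def by simp
    \<comment> \<open>The bound by 1 gives \<kappa>^3 \<le> \<kappa>, and the second entry makes
      \<kappa> J at most e/3; J + 1 avoids a division by zero.\<close>
    define \<kappa> where "\<kappa> = min 1 (e / (3 * (J + 1)))"
    have \<kappa>: "\<kappa> > 0" unfolding \<kappa>_def using e \<open>J \<ge> 0\<close> by simp
    have "\<kappa> ^ 3 \<le> \<kappa>" using \<kappa> power_decreasing[of 1 3 \<kappa>] by (simp add: \<kappa>_def)
    then have "\<kappa> ^ 3 * J \<le> e / (3 * (J + 1)) * J"
      using \<open>J \<ge> 0\<close> by (intro mult_right_mono) (auto simp: \<kappa>_def)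
    also have "\<dots> \<le> e / 3" using e \<open>J \<ge> 0\<close> by (simp add: field_simps)
    finally have 1: "\<kappa> ^ 3 * J \<le> e / 3" .
    \<comment> \<open>The level R is chosen after \<kappa>, since the tail integral is divided by
      \<kappa>.\<close>
    have "\<forall>\<^sub>F R in sequentially. T R < e * \<kappa> / 3" using T0 by (rule order_tendstoD) (use e \<kappa> in simp)
    then obtain R where "T R < e * \<kappa> / 3" using eventually_happens'[OF sequentially_bot] by blast
    then have 2: "T R / \<kappa> < e / 3" using \<kappa> by (simp add: field_simps)
    show "\<forall>\<^sub>F N in sequentially. \<bar>Im (fejer_nonlinearity N f) - 0\<bar> < e"
      using key[of "e / 3" \<kappa> R] e \<kappa>
      by simp (erule eventually_mono, use 1 2 in linarith)
  qed
qed

section \<open>The pathwise energy identity\<close>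

text \<open>On a grid the condition of not having stopped holds on an initial segment of indices.
  Its length is the index at which the telescoping sum of the energy ends.\<close>

lemma down_closed_nat_initial:
  fixes P :: "nat \<Rightarrow> bool"
  assumes "\<And>i j. i < j \<Longrightarrow> j < n \<Longrightarrow> P j \<Longrightarrow> P i"
  obtains J where "J \<le> n" "\<And>j. j < n \<Longrightarrow> P j \<longleftrightarrow> j < J"
proof
  define J where "J = (LEAST j. j \<ge> n \<or> \<not> P j)"
  have J: "J \<ge> n \<or> \<not> P J" unfolding J_def by (rule LeastI[of _ n]) simp
  show "J \<le> n" unfolding J_def by (rule Least_le) simp
  show "P j \<longleftrightarrow> j < J" if "j < n" for j
  proof
    assume "P j"
    show "j < J"
    proof (rule ccontr)
      assume "\<not> j < J"
      with J that \<open>P j\<close> have "\<not> P J" "J < j" by (auto simp: not_less le_less)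
      with assms[of J j] that \<open>P j\<close> show False by simp
    qed
  next
    assume "j < J"
    with not_less_Least[of j "\<lambda>j. j \<ge> n \<or> \<not> P j"] show "P j" by (simp add: J_def)
  qed
qed

section \<open>Integrals over grid cells\<close>

lemma set_integral_split_Ioc:
  fixes f :: "real \<Rightarrow> real"
  assumes f: "set_integrable lborel {a..c} f" and "a \<le> b" "b \<le> c"
  shows "(LINT s:{b<..c}|lborel. f s) = (LINT s:{a..c}|lborel. f s) - (LINT s:{a..b}|lborel. f s)"
proof -
  have "(LINT s:{a..b} \<union> {b<..c}|lborel. f s) = (LINT s:{a..b}|lborel. f s) + (LINT s:{b<..c}|lborel. f s)"
    by (rule set_integral_Un) (use assms in \<open>auto intro: set_integrable_subset\<close>)
  moreover have "{a..b} \<union> {b<..c} = {a..c}" using assms by auto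
  ultimately show ?thesis by simp
qed

lemma continuous_on_Icc_bounded:
  fixes f :: "real \<Rightarrow> real"
  assumes "continuous_on {a..b} f" shows "\<exists>C. \<forall>s\<in>{a..b}. \<bar>f s\<bar> \<le> C"
  using compact_imp_bounded[OF compact_continuous_image[OF assms compact_Icc]] by (auto simp: bounded_iff)

lemma set_integral_affine:
  fixes f g :: "real \<Rightarrow> real"
  assumes f: "set_integrable M A f" and g: "set_integrable M A g" and c: "set_integrable M A (\<lambda>s. c)"
  shows "(LINT s:A|M. u * f s + v * g s + c) = u * (LINT s:A|M. f s) + v * (LINT s:A|M. g s) + (LINT s:A|M. c)"
proof -
  have "set_integrable M A (\<lambda>s. u * f s)" "set_integrable M A (\<lambda>s. v * g s)"
    using f g by (auto intro: set_integrable_mult_right)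
  then show ?thesis using c by (simp add: set_integral_add)
qed

lemma set_integral_exp:
  fixes a u :: real
  assumes "u \<ge> 0"
  shows "(LINT s:{0..u}|lborel. a * exp (a * s)) = exp (a * u) - 1"
proof -
  have "(\<integral>s. (a * exp (a * s)) * indicator {0..u} s \<partial>lborel) = exp (a * u) - exp (a * 0)"
    using assms by (intro integral_FTC_Icc_real) (auto intro!: derivative_eq_intros continuous_intros)
  then show ?thesis
    unfolding set_lebesgue_integral_def real_scaleR_def by (simp only: mult.commute[of "indicator {0..u} _"]) simp
qed

definition grid :: "real \<Rightarrow> nat \<Rightarrow> nat \<Rightarrow> real" where
  "grid t n j = t * real j / real n"

text \<open>Everything except the increment of \<beta> is evaluated at the left end of the cell,
  including the stopping condition \<theta> and the exponential weight. The subtraction of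
  \<open>t / real n\<close>, the variance of the increment, centers the square.\<close>

definition martingale_term ::
  "real \<Rightarrow> real \<Rightarrow> (real \<Rightarrow> bool) \<Rightarrow> (real \<Rightarrow> real) \<Rightarrow> (real \<Rightarrow> real) \<Rightarrow> real \<Rightarrow> nat \<Rightarrow> nat \<Rightarrow> real" where
  "martingale_term \<alpha> \<sigma> \<theta> x \<beta> t n j = of_bool (\<theta> (grid t n j)) * exp (2 * \<alpha> * grid t n j) *
     (2 * \<sigma> * x (grid t n j) * (\<beta> (grid t n (Suc j)) - \<beta> (grid t n j)) +
      \<sigma>\<^sup>2 * ((\<beta> (grid t n (Suc j)) - \<beta> (grid t n j))\<^sup>2 - t / real n))"

lemma grid_Suc: "grid t n (Suc j) = grid t n j + t / real n"
  by (simp add: grid_def add_divide_distrib distrib_left)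

lemma grid_bounds:
  assumes "t > 0" "n > 0" "j \<le> n"
  shows "grid t n j \<in> {0..t}"
proof -
  have "t * real j \<le> t * real n" using assms by (intro mult_left_mono) auto
  then show ?thesis using assms by (auto simp: grid_def divide_le_eq)
qed

lemma grid_less: "t > 0 \<Longrightarrow> n > 0 \<Longrightarrow> i < j \<Longrightarrow> grid t n i < grid t n j"
  by (simp add: grid_def divide_strict_right_mono)

text \<open>With \<open>\<Delta>x = B + \<sigma> \<Delta>\<beta>\<close>, where \<open>B\<close> is the drift over one step, one has
  \<open>\<Delta>(x\<^sup>2) = B (x + x' + \<sigma> \<Delta>\<beta>) + 2 \<sigma> x \<Delta>\<beta> + \<sigma>\<^sup>2 (\<Delta>\<beta>)\<^sup>2\<close>; only the first summand has to converge pathwise,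
  the other two are kept as the martingale term.\<close>

lemma pathwise_energy:
  fixes x b \<beta> :: "real \<Rightarrow> real" and \<theta> :: "real \<Rightarrow> bool" and \<alpha> \<sigma> t S :: real
  assumes t: "t > 0" and x: "continuous_on {0..t} x" and \<beta>: "continuous_on {0..t} \<beta>"
    and b: "set_integrable lborel {0..t} b"
    and eq: "\<And>n j. 0 < n \<Longrightarrow> j \<le> n \<Longrightarrow>
      x (grid t n j) = x0 + (LINT s:{0..grid t n j}|lborel. b s) + \<sigma> * \<beta> (grid t n j)"
    and S: "0 \<le> S" "S \<le> t"
    and \<theta>1: "\<And>s. 0 \<le> s \<Longrightarrow> s < S \<Longrightarrow> \<theta> s" and \<theta>2: "\<And>s. S < s \<Longrightarrow> s \<le> t \<Longrightarrow> \<not> \<theta> s"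
  shows "(\<lambda>n. \<Sum>j<n. martingale_term \<alpha> \<sigma> \<theta> x \<beta> t n j) \<longlonglongrightarrow>
    exp (2 * \<alpha> * S) * (x S)\<^sup>2 - (x 0)\<^sup>2 -
    (LINT s:{0..S}|lborel. exp (2 * \<alpha> * s) * (2 * x s * b s + 2 * \<alpha> * (x s)\<^sup>2 + \<sigma>\<^sup>2))"
proof -
  define p where "p s = exp (2 * \<alpha> * s)" for s
  \<comment> \<open>Integrated over one cell, the three summands are the drift part of the increment
    of x^2, the growth of the weight times the new value of x^2, and the compensator of the squared
    noise increment.\<close>
  define F where "F n j s = p (grid t n j) * (x (grid t n j) + x (grid t n (Suc j))
      + \<sigma> * (\<beta> (grid t n (Suc j)) - \<beta> (grid t n j))) * b s
      + (x (grid t n (Suc j)))\<^sup>2 * (2 * \<alpha> * p s) + \<sigma>\<^sup>2 * p (grid t n j)" for n j s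
  \<comment> \<open>The cells are disjoint, so the sum over the grid becomes the integral of a
    single function of s, to which dominated convergence applies as \<open>n\<close> grows.\<close>
  define H where "H n s = (\<Sum>j<n. of_bool (\<theta> (grid t n j)) * (indicator {grid t n j<..grid t n (Suc j)} s * F n j s))" for n s
  define L where "L s = p s * (2 * x s * b s + 2 * \<alpha> * (x s)\<^sup>2 + \<sigma>\<^sup>2)" for s
  have sub: "{grid t n j<..grid t n (Suc j)} \<subseteq> {0..t}" if "j < n" for n j
    using grid_bounds[of t n j] grid_bounds[of t n "Suc j"] that t by auto
  have p_int: "set_integrable lborel A (\<lambda>s. 2 * \<alpha> * p s)" if "A \<subseteq> {0..t}" "A \<in> sets borel" for A
    by (rule set_integrable_subset[of _ "{0..t}"], rule borel_integrable_atLeastAtMost')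
       (use that in \<open>auto simp: p_def intro!: continuous_intros\<close>)
  have p_Ioc: "(LINT s:{grid t n j<..grid t n (Suc j)}|lborel. 2 * \<alpha> * p s) = p (grid t n (Suc j)) - p (grid t n j)"
    if "j < n" for n j
  proof -
    have "(LINT s:{grid t n j<..grid t n (Suc j)}|lborel. 2 * \<alpha> * p s) =
        (LINT s:{0..grid t n (Suc j)}|lborel. 2 * \<alpha> * p s) - (LINT s:{0..grid t n j}|lborel. 2 * \<alpha> * p s)"
      using grid_bounds[of t n j] grid_bounds[of t n "Suc j"] grid_less[of t n j "Suc j"] that t
      by (intro set_integral_split_Ioc p_int) auto
    then show ?thesis
      using grid_bounds[of t n j] grid_bounds[of t n "Suc j"] that t
      unfolding p_def by (simp only: set_integral_exp atLeastAtMost_iff Suc_leI less_imp_le)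
  qed
  have b_Ioc: "(LINT s:{grid t n j<..grid t n (Suc j)}|lborel. b s) =
      x (grid t n (Suc j)) - x (grid t n j) - \<sigma> * (\<beta> (grid t n (Suc j)) - \<beta> (grid t n j))" if "j < n" for n j
  proof -
    have "(LINT s:{grid t n j<..grid t n (Suc j)}|lborel. b s) =
        (LINT s:{0..grid t n (Suc j)}|lborel. b s) - (LINT s:{0..grid t n j}|lborel. b s)"
      using grid_bounds[of t n j] grid_bounds[of t n "Suc j"] grid_less[of t n j "Suc j"] that t
      by (intro set_integral_split_Ioc set_integrable_subset[OF b]) auto
    then show ?thesis
      using eq[of n j] eq[of n "Suc j"] that by (simp add: algebra_simps)
  qed
  have b_sub: "set_integrable lborel {grid t n j<..grid t n (Suc j)} b" if "j < n" for n j
    by (rule set_integrable_subset[OF b _ sub[OF that]]) simp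
  have const_int: "set_integrable lborel {0..t} (\<lambda>s. c)" for c :: real
    by (rule borel_integrable_atLeastAtMost') (rule continuous_on_const)
  have c_sub: "set_integrable lborel {grid t n j<..grid t n (Suc j)} (\<lambda>s. c)" if "j < n" for n j and c :: real
    by (rule set_integrable_subset[OF const_int _ sub[OF that]]) simp
  have F_int: "set_integrable lborel {grid t n j<..grid t n (Suc j)} (F n j)" if "j < n" for n j
    unfolding F_def by (intro set_integral_add set_integrable_mult_right impI b_sub c_sub p_int sub that) auto
  \<comment> \<open>Discrete product rule: the increment of p x^2 is the old weight times the
    increment of x^2 plus the new x^2 times the increment of p. No remainder arises, so the identity
    is exact for every mesh.\<close>
  have F_val: "(LINT s:{grid t n j<..grid t n (Suc j)}|lborel. F n j s) =
      (p (grid t n (Suc j)) * (x (grid t n (Suc j)))\<^sup>2 - p (grid t n j) * (x (grid t n j))\<^sup>2)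
      - p (grid t n j) * (2 * \<sigma> * x (grid t n j) * (\<beta> (grid t n (Suc j)) - \<beta> (grid t n j)) +
      \<sigma>\<^sup>2 * ((\<beta> (grid t n (Suc j)) - \<beta> (grid t n j))\<^sup>2 - t / real n))" if "j < n" for n j
  proof -
    let ?I = "{grid t n j<..grid t n (Suc j)}"
    have c: "(LINT s:?I|lborel. c) = c * (t / real n)" for c :: real
      using t that grid_less[of t n j "Suc j"] by (simp add: set_lebesgue_integral_def grid_Suc)
    have "(LINT s:?I|lborel. F n j s) =
      p (grid t n j) * (x (grid t n j) + x (grid t n (Suc j)) + \<sigma> * (\<beta> (grid t n (Suc j)) - \<beta> (grid t n j))) * (LINT s:?I|lborel. b s)
      + (x (grid t n (Suc j)))\<^sup>2 * (LINT s:?I|lborel. 2 * \<alpha> * p s) + \<sigma>\<^sup>2 * p (grid t n j) * (t / real n)"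
      unfolding F_def
      by (subst set_integral_affine[OF b_sub[OF that] p_int[OF sub[OF that] greaterThanAtMost_borel] c_sub[OF that]])
         (simp only: c)
    also have "\<dots> = (p (grid t n (Suc j)) * (x (grid t n (Suc j)))\<^sup>2 - p (grid t n j) * (x (grid t n j))\<^sup>2)
      - p (grid t n j) * (2 * \<sigma> * x (grid t n j) * (\<beta> (grid t n (Suc j)) - \<beta> (grid t n j)) +
      \<sigma>\<^sup>2 * ((\<beta> (grid t n (Suc j)) - \<beta> (grid t n j))\<^sup>2 - t / real n))"
      unfolding b_Ioc[OF that] p_Ioc[OF that] by (simp add: power2_eq_square algebra_simps)
    finally show ?thesis .
  qed
  have H_int: "(\<integral>s. H n s \<partial>lborel) = (\<Sum>j<n. of_bool (\<theta> (grid t n j)) * (LINT s:{grid t n j<..grid t n (Suc j)}|lborel. F n j s))" for n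
    unfolding H_def set_lebesgue_integral_def
    using F_int by (subst Bochner_Integration.integral_sum) (auto simp: set_integrable_def)
  have sum_eq: "(\<Sum>j<n. martingale_term \<alpha> \<sigma> \<theta> x \<beta> t n j) =
      (\<Sum>j<n. of_bool (\<theta> (grid t n j)) * (p (grid t n (Suc j)) * (x (grid t n (Suc j)))\<^sup>2 - p (grid t n j) * (x (grid t n j))\<^sup>2))
      - (\<integral>s. H n s \<partial>lborel)" for n
    unfolding H_int sum_subtractf[symmetric]
    by (intro sum.cong refl) (simp add: F_val martingale_term_def p_def algebra_simps)
  have Hm: "H n \<in> borel_measurable lborel" for n
    unfolding H_def
  proof (intro borel_measurable_sum borel_measurable_times[OF borel_measurable_const])
    show "(\<lambda>s. indicator {grid t n j<..grid t n (Suc j)} s * F n j s) \<in> borel_measurable lborel" if "j \<in> {..<n}" for j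
      using borel_measurable_integrable[OF F_int[of j n, unfolded set_integrable_def]] that by simp
  qed
  obtain Cx where Cx: "\<And>s. s \<in> {0..t} \<Longrightarrow> \<bar>x s\<bar> \<le> Cx"
    using continuous_on_Icc_bounded[OF x] by blast
  obtain C\<beta> where C\<beta>: "\<And>s. s \<in> {0..t} \<Longrightarrow> \<bar>\<beta> s\<bar> \<le> C\<beta>"
    using continuous_on_Icc_bounded[OF \<beta>] by blast
  have p_cont: "continuous_on {0..t} p" unfolding p_def by (intro continuous_intros)
  obtain Cp where Cp: "\<And>s. s \<in> {0..t} \<Longrightarrow> \<bar>p s\<bar> \<le> Cp"
    using continuous_on_Icc_bounded[OF p_cont] by blast
  have C0: "Cx \<ge> 0" "C\<beta> \<ge> 0" "Cp \<ge> 0" using Cx[of 0] C\<beta>[of 0] Cp[of 0] t by auto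
  \<comment> \<open>The drift is only integrable, so the majorant keeps |b| and bounds all the
    continuous quantities by their maxima.\<close>
  define w where "w s = indicator {0..t} s * (Cp * (Cx + Cx + \<bar>\<sigma>\<bar> * (C\<beta> + C\<beta>)) * \<bar>b s\<bar> + (Cx\<^sup>2 * (2 * \<bar>\<alpha>\<bar> * Cp) + \<sigma>\<^sup>2 * Cp))" for s
  have w_int: "integrable lborel w"
  proof -
    have "set_integrable lborel {0..t} (\<lambda>s. Cp * (Cx + Cx + \<bar>\<sigma>\<bar> * (C\<beta> + C\<beta>)) * \<bar>b s\<bar> + (Cx\<^sup>2 * (2 * \<bar>\<alpha>\<bar> * Cp) + \<sigma>\<^sup>2 * Cp))"
      by (intro set_integral_add set_integrable_mult_right impI set_integrable_abs b const_int)
    then show ?thesis by (simp add: w_def[abs_def] set_integrable_def)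
  qed
  have F_bound: "\<bar>F n j s\<bar> \<le> Cp * (Cx + Cx + \<bar>\<sigma>\<bar> * (C\<beta> + C\<beta>)) * \<bar>b s\<bar> + (Cx\<^sup>2 * (2 * \<bar>\<alpha>\<bar> * Cp) + \<sigma>\<^sup>2 * Cp)"
    if "j < n" "s \<in> {0..t}" for n j s
  proof -
    have g: "grid t n j \<in> {0..t}" "grid t n (Suc j) \<in> {0..t}" using grid_bounds[OF t] that by auto
    have "\<bar>p (grid t n j) * (x (grid t n j) + x (grid t n (Suc j)) + \<sigma> * (\<beta> (grid t n (Suc j)) - \<beta> (grid t n j))) * b s\<bar>
        \<le> Cp * (Cx + Cx + \<bar>\<sigma>\<bar> * (C\<beta> + C\<beta>)) * \<bar>b s\<bar>"
      unfolding abs_mult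
    proof (intro mult_right_mono mult_mono Cp g abs_ge_zero)
      have "\<bar>\<sigma> * (\<beta> (grid t n (Suc j)) - \<beta> (grid t n j))\<bar> \<le> \<bar>\<sigma>\<bar> * (C\<beta> + C\<beta>)"
        unfolding abs_mult using C\<beta>[OF g(1)] C\<beta>[OF g(2)] by (intro mult_left_mono) auto
      then show "\<bar>x (grid t n j) + x (grid t n (Suc j)) + \<sigma> * (\<beta> (grid t n (Suc j)) - \<beta> (grid t n j))\<bar> \<le> Cx + Cx + \<bar>\<sigma>\<bar> * (C\<beta> + C\<beta>)"
        using Cx[OF g(1)] Cx[OF g(2)] by linarith
    qed (use C0 in auto)
    moreover have "\<bar>(x (grid t n (Suc j)))\<^sup>2 * (2 * \<alpha> * p s)\<bar> \<le> Cx\<^sup>2 * (2 * \<bar>\<alpha>\<bar> * Cp)"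
      unfolding abs_mult using Cx[OF g(2)] Cp[OF that(2)] C0
      by (intro mult_mono) (auto simp: power2_le_iff_abs_le mult_left_mono)
    moreover have "\<bar>\<sigma>\<^sup>2 * p (grid t n j)\<bar> \<le> \<sigma>\<^sup>2 * Cp"
      unfolding abs_mult using Cp[OF g(1)] by (intro mult_mono) auto
    ultimately show ?thesis unfolding F_def by linarith
  qed
  have locate: "\<exists>j<n. s \<in> {grid t n j<..grid t n (Suc j)}" if "0 < s" "s \<le> t" "n > 0" for s n
  proof -
    \<comment> \<open>The cells are open on the left, so the index is the ceiling minus one rather
      than the floor.\<close>
    define j where "j = nat (\<lceil>real n * s / t\<rceil> - 1)"
    have pos: "0 < real n * s / t" using that t by simp
    then have j1: "real j = of_int \<lceil>real n * s / t\<rceil> - 1" by (simp add: j_def of_nat_nat)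
    have u: "real j < real n * s / t" "real n * s / t \<le> real j + 1" unfolding j1 by linarith+
    have "real n * s / t \<le> real n" using that t by (simp add: divide_le_eq mult_left_mono)
    with u have "j < n" by linarith
    moreover have "grid t n j < s" "s \<le> grid t n (Suc j)"
      using u t that by (simp_all add: grid_def field_simps)
    ultimately show ?thesis by auto
  qed
  have only: "H n s = of_bool (\<theta> (grid t n j)) * F n j s" if "j < n" "s \<in> {grid t n j<..grid t n (Suc j)}" for n j s
  proof -
    have "indicator {grid t n i<..grid t n (Suc i)} s = (0 :: real)" if "i < n" "i \<noteq> j" for i
    proof (cases "i < j")
      case True
      then have "grid t n (Suc i) \<le> grid t n j"
        using grid_less[OF t, of n "Suc i" j] \<open>j < n\<close> by (cases "Suc i = j") auto
      with \<open>s \<in> _\<close> show ?thesis by (auto simp: indicator_def)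
    next
      case False
      with that have "j < i" by simp
      then have "grid t n (Suc j) \<le> grid t n i"
        using grid_less[OF t, of n "Suc j" i] \<open>j < n\<close> by (cases "Suc j = i") auto
      with \<open>s \<in> _\<close> show ?thesis by (auto simp: indicator_def)
    qed
    then have "H n s = (\<Sum>i<n. if i = j then of_bool (\<theta> (grid t n j)) * F n j s else 0)"
      unfolding H_def by (intro sum.cong refl) (use that in auto)
    then show ?thesis using that by simp
  qed
  have H_out: "H n s = 0" if "s \<notin> {0<..t}" for n s
    unfolding H_def
  proof (intro sum.neutral ballI)
    fix j assume "j \<in> {..<n}"
    then have "0 \<le> grid t n j" "grid t n (Suc j) \<le> t"
      using grid_bounds[OF t, of n j] grid_bounds[OF t, of n "Suc j"] by auto
    with that have "s \<notin> {grid t n j<..grid t n (Suc j)}" by auto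
    then show "of_bool (\<theta> (grid t n j)) * (indicator {grid t n j<..grid t n (Suc j)} s * F n j s) = 0" by simp
  qed
  have H_bound: "norm (H n s) \<le> w s" for n s
  proof (cases "s \<in> {0<..t} \<and> n > 0")
    case True
    then obtain j where j: "j < n" "s \<in> {grid t n j<..grid t n (Suc j)}" using locate[of s n] by auto
    have "\<bar>H n s\<bar> \<le> \<bar>F n j s\<bar>" unfolding only[OF j] by (simp add: abs_mult)
    also have "\<dots> \<le> w s" using F_bound[OF j(1), of s] True by (simp add: w_def)
    finally show ?thesis by simp
  next
    case False
    then have "H n s = 0" using H_out by (auto simp: H_def)
    then show ?thesis using C0 by (simp add: w_def)
  qed
  \<comment> \<open>Nothing is known about \<theta> at S itself, and 0 lies in no cell; both points
    form a null set.\<close>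
  have H_lim: "(\<lambda>n. H n s) \<longlonglongrightarrow> indicator {0..S} s * L s" if s: "s \<notin> {0, S}" for s
  proof (cases "s \<in> {0<..t}")
    case False
    then have "indicator {0..S} s * L s = 0" using S s by (auto simp: indicator_def)
    with H_out[OF False] show ?thesis by (simp only:) simp
  next
    case True
    obtain j where j: "\<And>n. n > 0 \<Longrightarrow> j n < n \<and> s \<in> {grid t n (j n)<..grid t n (Suc (j n))}"
      using True locate[of s] by (metis greaterThanAtMost_iff)
    define a where "a n = grid t n (j n)" for n
    define a' where "a' n = grid t n (Suc (j n))" for n
    have aa: "s - t / real n \<le> a n" "a n \<le> s" "s \<le> a' n" "a' n \<le> s + t / real n"
      "a n \<in> {0..t}" "a' n \<in> {0..t}" if "n > 0" for n
      using j[OF that] grid_bounds[OF t that, of "j n"] grid_bounds[OF t that, of "Suc (j n)"] unfolding a_def a'_def by (auto simp: grid_Suc)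
    have tn: "(\<lambda>n. t / real n) \<longlonglongrightarrow> 0" by (rule lim_const_over_n)
    have a: "a \<longlonglongrightarrow> s"
      by (rule tendsto_sandwich[of "\<lambda>n. s - t / real n" _ _ "\<lambda>n. s"])
         (use aa tendsto_diff[OF tendsto_const tn, of s] in \<open>auto intro: eventually_mono[OF eventually_gt_at_top[of 0]]\<close>)
    have a': "a' \<longlonglongrightarrow> s"
      by (rule tendsto_sandwich[of "\<lambda>n. s" _ _ "\<lambda>n. s + t / real n"])
         (use aa tendsto_add[OF tendsto_const tn, of s] in \<open>auto intro: eventually_mono[OF eventually_gt_at_top[of 0]]\<close>)
    have comp: "(\<lambda>n. f (u n)) \<longlonglongrightarrow> f s" if "continuous_on {0..t} f" "u \<longlonglongrightarrow> s" "\<And>n. n > 0 \<Longrightarrow> u n \<in> {0..t}"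
      for f :: "real \<Rightarrow> real" and u
      by (rule continuous_on_tendsto_compose[OF that(1,2)])
         (use True that(3) in \<open>auto intro: eventually_mono[OF eventually_gt_at_top[of 0]]\<close>)
    have "(\<lambda>n. p (a n) * (x (a n) + x (a' n) + \<sigma> * (\<beta> (a' n) - \<beta> (a n))) * b s + (x (a' n))\<^sup>2 * (2 * \<alpha> * p s) + \<sigma>\<^sup>2 * p (a n))
      \<longlonglongrightarrow> p s * (x s + x s + \<sigma> * (\<beta> s - \<beta> s)) * b s + (x s)\<^sup>2 * (2 * \<alpha> * p s) + \<sigma>\<^sup>2 * p s"
      by (intro tendsto_intros comp[OF x] comp[OF \<beta>] comp[OF p_cont] a a' aa)
    also have "p s * (x s + x s + \<sigma> * (\<beta> s - \<beta> s)) * b s + (x s)\<^sup>2 * (2 * \<alpha> * p s) + \<sigma>\<^sup>2 * p s = L s"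
      by (simp add: L_def algebra_simps)
    finally have F_lim: "(\<lambda>n. F n (j n) s) \<longlonglongrightarrow> L s" unfolding F_def a_def a'_def .
    \<comment> \<open>For s < S the left end of the cell also lies before S. For s > S it does so
      only while the mesh is coarse, since it converges to s.\<close>
    have ind: "eventually (\<lambda>n. of_bool (\<theta> (grid t n (j n))) = (indicator {0..S} s :: real)) sequentially"
    proof (cases "s < S")
      case True
      show ?thesis
        using eventually_gt_at_top[of 0]
      proof eventually_elim
        case (elim n)
        have "\<theta> (a n)" using aa[OF elim] True by (intro \<theta>1) auto
        then show ?case using True \<open>s \<in> {0<..t}\<close> by (simp add: a_def)
      qed
    next
      case False
      then have "S < s" using s by auto
      then have "eventually (\<lambda>n. S < a n) sequentially" using order_tendstoD(1)[OF a] by blast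
      then show ?thesis
        using eventually_gt_at_top[of 0]
      proof eventually_elim
        case (elim n)
        have "\<not> \<theta> (a n)" using aa[OF elim(2)] elim(1) by (intro \<theta>2) auto
        then show ?case using \<open>S < s\<close> by (simp add: a_def)
      qed
    qed
    have "(\<lambda>n. indicator {0..S} s * F n (j n) s) \<longlonglongrightarrow> indicator {0..S} s * L s"
      by (intro tendsto_mult tendsto_const F_lim)
    then show ?thesis
    proof (rule Lim_transform_eventually)
      show "\<forall>\<^sub>F n in sequentially. indicator {0..S} s * F n (j n) s = H n s"
        using ind eventually_gt_at_top[of 0]
      proof eventually_elim
        case (elim n)
        then show ?case using only[of "j n" n s] j[OF elim(2)] by simp
      qed
    qed
  qed
  have "AE s in lborel. s \<notin> {0, S}" by (intro AE_not_in finite_imp_null_set_lborel) auto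
  then have H_AE: "AE s in lborel. (\<lambda>n. H n s) \<longlonglongrightarrow> indicator {0..S} s * L s"
    by eventually_elim (rule H_lim)
  have "set_integrable lborel {0..t} L"
  proof -
    have "set_integrable lborel {0..t} (\<lambda>s. b s * (2 * p s * x s) + (2 * \<alpha> * p s * (x s)\<^sup>2 + p s * \<sigma>\<^sup>2))"
    proof (intro set_integral_add)
      obtain C where C: "\<And>s. s \<in> {0..t} \<Longrightarrow> \<bar>2 * p s * x s\<bar> \<le> C"
        using continuous_on_Icc_bounded[OF continuous_on_mult[OF continuous_on_mult[OF continuous_on_const p_cont] x, of 2]] by blast
      have m: "set_integrable lborel {0..t} (\<lambda>s. 2 * p s * x s)"
        by (intro borel_integrable_atLeastAtMost' continuous_intros p_cont x)
      show "set_integrable lborel {0..t} (\<lambda>s. b s * (2 * p s * x s))"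
        unfolding set_integrable_def
      proof (rule Bochner_Integration.integrable_bound)
        show "integrable lborel (\<lambda>s. C * norm (indicator {0..t} s *\<^sub>R b s))"
          using b by (auto simp: set_integrable_def)
        have "(\<lambda>s. (indicator {0..t} s *\<^sub>R b s) * (indicator {0..t} s *\<^sub>R (2 * p s * x s))) \<in> borel_measurable lborel"
          using b m unfolding set_integrable_def by (intro borel_measurable_times borel_measurable_integrable)
        also have "(\<lambda>s. (indicator {0..t} s *\<^sub>R b s) * (indicator {0..t} s *\<^sub>R (2 * p s * x s))) = (\<lambda>s. indicator {0..t} s *\<^sub>R (b s * (2 * p s * x s)))"
          by (auto simp: indicator_def)
        finally show "(\<lambda>s. indicator {0..t} s *\<^sub>R (b s * (2 * p s * x s))) \<in> borel_measurable lborel" .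
        have "\<bar>b s * (2 * p s * x s)\<bar> \<le> \<bar>C * \<bar>b s\<bar>\<bar>" if "s \<in> {0..t}" for s
          using order_trans[OF mult_right_mono[OF C[OF that], of "\<bar>b s\<bar>"] mult_right_mono[OF abs_ge_self[of C], of "\<bar>b s\<bar>"]]
          by (simp add: abs_mult mult_ac)
        then show "AE s in lborel. norm (indicator {0..t} s *\<^sub>R (b s * (2 * p s * x s))) \<le> norm (C * norm (indicator {0..t} s *\<^sub>R b s))"
          by (intro AE_I2) (auto simp: indicator_def)
      qed
      show "set_integrable lborel {0..t} (\<lambda>s. 2 * \<alpha> * p s * (x s)\<^sup>2)" "set_integrable lborel {0..t} (\<lambda>s. p s * \<sigma>\<^sup>2)"
        by (intro borel_integrable_atLeastAtMost' continuous_intros p_cont x)+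
    qed
    then show ?thesis unfolding L_def by (simp add: algebra_simps)
  qed
  then have "set_integrable lborel {0..S} L"
    by (rule set_integrable_subset) (use S in auto)
  then have Lm: "(\<lambda>s. indicator {0..S} s * L s) \<in> borel_measurable lborel"
    unfolding set_integrable_def real_scaleR_def by (rule borel_measurable_integrable)
  have int_lim: "(\<lambda>n. \<integral>s. H n s \<partial>lborel) \<longlonglongrightarrow> (\<integral>s. indicator {0..S} s * L s \<partial>lborel)"
    by (rule integral_dominated_convergence[OF Lm Hm w_int H_AE]) (use H_bound in auto)
  \<comment> \<open>The active cells form an initial segment, so the sum telescopes. It ends at the
    first grid point that is not active, or at t if there is none, and that point is within one mesh
    width after S.\<close>
  have tele_lim: "(\<lambda>n. \<Sum>j<n. of_bool (\<theta> (grid t n j)) * (p (grid t n (Suc j)) * (x (grid t n (Suc j)))\<^sup>2 - p (grid t n j) * (x (grid t n j))\<^sup>2))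
      \<longlonglongrightarrow> p S * (x S)\<^sup>2 - (x 0)\<^sup>2"
  proof -
    have "\<exists>J\<le>n. \<forall>j<n. \<theta> (grid t n j) \<longleftrightarrow> j < J" for n
    proof (rule down_closed_nat_initial[of n "\<lambda>j. \<theta> (grid t n j)"])
      fix i j assume ij: "i < j" "j < n" "\<theta> (grid t n j)"
      then have "\<not> S < grid t n j" using \<theta>2[of "grid t n j"] grid_bounds[OF t, of n j] by auto
      then show "\<theta> (grid t n i)"
        using grid_less[OF t, of n i j] grid_bounds[OF t, of n i] ij by (intro \<theta>1) auto
    qed blast
    then obtain J where J: "\<And>n. J n \<le> n" "\<And>n j. j < n \<Longrightarrow> \<theta> (grid t n j) \<longleftrightarrow> j < J n" by metis
    define q where "q s = p s * (x s)\<^sup>2" for s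
    have tele: "(\<Sum>j<n. of_bool (\<theta> (grid t n j)) * (q (grid t n (Suc j)) - q (grid t n j))) = q (grid t n (J n)) - q 0" for n
    proof -
      have "(\<Sum>j<n. of_bool (\<theta> (grid t n j)) * (q (grid t n (Suc j)) - q (grid t n j))) =
          (\<Sum>j<J n. q (grid t n (Suc j)) - q (grid t n j))"
        by (rule sum.mono_neutral_cong_right) (use J(1)[of n] J(2)[of _ n] in auto)
      also have "\<dots> = q (grid t n (J n)) - q (grid t n 0)" by (rule sum_lessThan_telescope)
      finally show ?thesis by (simp add: grid_def)
    qed
    have gJ: "S \<le> grid t n (J n)" "grid t n (J n) \<le> S + t / real n" "grid t n (J n) \<in> {0..t}" if "n > 0" for n
    proof -
      show "S \<le> grid t n (J n)"
      proof (cases "J n = n")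
        case True
        then show ?thesis using that S t by (simp add: grid_def)
      next
        case False
        then have "\<not> \<theta> (grid t n (J n))" using J(1)[of n] J(2)[of "J n" n] by simp
        moreover have "0 \<le> grid t n (J n)" using grid_bounds[OF t that J(1)] by simp
        ultimately show ?thesis using \<theta>1[of "grid t n (J n)"] by linarith
      qed
      show "grid t n (J n) \<le> S + t / real n"
      proof (cases "J n")
        case 0
        then show ?thesis using S t by (simp add: grid_def)
      next
        case (Suc i)
        then have "\<theta> (grid t n i)" "i < n" using J(1)[of n] J(2)[of i n] by auto
        moreover have "grid t n i \<le> t" using grid_bounds[OF t that less_imp_le[OF \<open>i < n\<close>]] by simp
        ultimately have "grid t n i \<le> S" using \<theta>2[of "grid t n i"] by linarith
        then show ?thesis unfolding Suc grid_Suc by simp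
      qed
      show "grid t n (J n) \<in> {0..t}" by (rule grid_bounds[OF t that J(1)])
    qed
    have ev: "\<forall>\<^sub>F n in sequentially. n > 0"
      by (rule eventually_gt_at_top)
    have up: "(\<lambda>n. S + t / real n) \<longlonglongrightarrow> S"
      using tendsto_add[OF tendsto_const lim_const_over_n[of t], of S] by simp
    have "(\<lambda>n. grid t n (J n)) \<longlonglongrightarrow> S"
      by (rule tendsto_sandwich[OF eventually_mono[OF ev] eventually_mono[OF ev] tendsto_const up]) (rule gJ, assumption)+
    moreover have "continuous_on {0..t} q" unfolding q_def by (intro continuous_intros p_cont x)
    ultimately have "(\<lambda>n. q (grid t n (J n))) \<longlonglongrightarrow> q S"
      using S by (intro continuous_on_tendsto_compose[where f=q and g="\<lambda>n. grid t n (J n)" and s="{0..t}"]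
          eventually_mono[OF ev gJ(3)]) auto
    then have "(\<lambda>n. q (grid t n (J n)) - q 0) \<longlonglongrightarrow> q S - q 0" by (rule tendsto_diff[OF _ tendsto_const])
    then show ?thesis unfolding tele[symmetric] unfolding q_def p_def by simp
  qed
  have "(\<lambda>n. \<Sum>j<n. martingale_term \<alpha> \<sigma> \<theta> x \<beta> t n j) \<longlonglongrightarrow>
      (p S * (x S)\<^sup>2 - (x 0)\<^sup>2) - (\<integral>s. indicator {0..S} s * L s \<partial>lborel)"
    unfolding sum_eq by (intro tendsto_diff tele_lim int_lim)
  then show ?thesis by (simp add: p_def L_def set_lebesgue_integral_def)
qed

section \<open>Square integrable random variables\<close>

definition square_integrable :: "'w measure \<Rightarrow> ('w \<Rightarrow> real) \<Rightarrow> bool" where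
  "square_integrable M f \<longleftrightarrow> f \<in> borel_measurable M \<and> integrable M (\<lambda>\<omega>. (f \<omega>)\<^sup>2)"

lemma square_integrable_mult:
  assumes "square_integrable M f" "square_integrable M g"
  shows "integrable M (\<lambda>\<omega>. f \<omega> * g \<omega>)"
proof (rule Bochner_Integration.integrable_bound[where f="\<lambda>\<omega>. (f \<omega>)\<^sup>2 + (g \<omega>)\<^sup>2"])
  show "integrable M (\<lambda>\<omega>. (f \<omega>)\<^sup>2 + (g \<omega>)\<^sup>2)" "(\<lambda>\<omega>. f \<omega> * g \<omega>) \<in> borel_measurable M"
    using assms by (auto simp: square_integrable_def)
  have "\<bar>a * b\<bar> \<le> \<bar>a\<^sup>2 + b\<^sup>2\<bar>" for a b :: real
    using sum_squares_bound[of "\<bar>a\<bar>" "\<bar>b\<bar>"] mult_nonneg_nonneg[OF abs_ge_zero[of a] abs_ge_zero[of b]]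
    unfolding abs_mult by (simp del: mult_nonneg_nonneg)
  then show "AE \<omega> in M. norm (f \<omega> * g \<omega>) \<le> norm ((f \<omega>)\<^sup>2 + (g \<omega>)\<^sup>2)" by simp
qed

lemma square_integrable_add:
  assumes "square_integrable M f" "square_integrable M g"
  shows "square_integrable M (\<lambda>\<omega>. f \<omega> + g \<omega>)"
  unfolding square_integrable_def power2_sum
  using assms square_integrable_mult[OF assms]
  by (auto simp: square_integrable_def mult.assoc)

lemma square_integrable_cmult:
  "square_integrable M f \<Longrightarrow> square_integrable M (\<lambda>\<omega>. c * f \<omega>)"
  by (auto simp: square_integrable_def power_mult_distrib)

lemma square_integrable_diff:
  assumes "square_integrable M f" "square_integrable M g"
  shows "square_integrable M (\<lambda>\<omega>. f \<omega> - g \<omega>)"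
  using square_integrable_add[OF assms(1) square_integrable_cmult[OF assms(2), of "-1"]] by simp

lemma square_integrable_sum:
  "(\<And>i. i \<in> I \<Longrightarrow> square_integrable M (f i)) \<Longrightarrow> square_integrable M (\<lambda>\<omega>. \<Sum>i\<in>I. f i \<omega>)"
  by (induction I rule: infinite_finite_induct)
     (auto intro: square_integrable_add simp: square_integrable_def[of _ "\<lambda>_. 0"])

lemma (in prob_space) square_integrable_one: "square_integrable M (\<lambda>\<omega>. 1)"
  by (simp add: square_integrable_def)

lemma (in prob_space) square_integrable_integrable: "square_integrable M f \<Longrightarrow> integrable M f"
  using square_integrable_mult[OF _ square_integrable_one, of f] by simp

lemma (in prob_space) integral_sq_diff_le:
  assumes "square_integrable M f" "square_integrable M g"
  shows "(\<integral>\<omega>. (f \<omega> - g \<omega>)\<^sup>2 \<partial>M) \<le> 2 * (\<integral>\<omega>. (f \<omega>)\<^sup>2 \<partial>M) + 2 * (\<integral>\<omega>. (g \<omega>)\<^sup>2 \<partial>M)"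
proof -
  have i: "integrable M (\<lambda>\<omega>. (f \<omega>)\<^sup>2)" "integrable M (\<lambda>\<omega>. (g \<omega>)\<^sup>2)"
    using assms by (auto simp: square_integrable_def)
  have "(\<integral>\<omega>. (f \<omega> - g \<omega>)\<^sup>2 \<partial>M) \<le> (\<integral>\<omega>. 2 * (f \<omega>)\<^sup>2 + 2 * (g \<omega>)\<^sup>2 \<partial>M)"
  proof (rule integral_mono)
    show "integrable M (\<lambda>\<omega>. (f \<omega> - g \<omega>)\<^sup>2)"
      using square_integrable_diff[OF assms] by (simp add: square_integrable_def)
    show "integrable M (\<lambda>\<omega>. 2 * (f \<omega>)\<^sup>2 + 2 * (g \<omega>)\<^sup>2)" using i by simp
    show "(f \<omega> - g \<omega>)\<^sup>2 \<le> 2 * (f \<omega>)\<^sup>2 + 2 * (g \<omega>)\<^sup>2" for \<omega>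
      using zero_le_power2[of "f \<omega> + g \<omega>"] by (simp add: power2_sum power2_diff)
  qed
  with i show ?thesis by simp
qed

text \<open>Boundedness in \<open>L\<^sup>2\<close> gives uniform integrability, so that means pass to the limit. Since \<open>M\<close> need
  not be complete, the limit is only measurable after modification on a null set.\<close>

lemma (in prob_space) L2_bounded_centered_limit:
  fixes Z :: "nat \<Rightarrow> 'a \<Rightarrow> real"
  assumes Z: "\<And>n. square_integrable M (Z n)" and mean: "\<And>n. (\<integral>\<omega>. Z n \<omega> \<partial>M) = 0"
    and K: "\<And>n. (\<integral>\<omega>. (Z n \<omega>)\<^sup>2 \<partial>M) \<le> K" and lim: "AE \<omega> in M. (\<lambda>n. Z n \<omega>) \<longlonglongrightarrow> Z0 \<omega>"
  obtains Z' where "square_integrable M Z'" "(\<integral>\<omega>. Z' \<omega> \<partial>M) = 0" "(\<integral>\<omega>. (Z' \<omega>)\<^sup>2 \<partial>M) \<le> K"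
    "AE \<omega> in M. Z' \<omega> = Z0 \<omega>"
proof -
  have [measurable]: "Z n \<in> borel_measurable M" for n using Z by (simp add: square_integrable_def)
  have Zi: "integrable M (\<lambda>\<omega>. (Z n \<omega>)\<^sup>2)" for n using Z by (simp add: square_integrable_def)
  define Z' where "Z' \<omega> = lim (\<lambda>n. Z n \<omega>)" for \<omega>
  have Z'm[measurable]: "Z' \<in> borel_measurable M" unfolding Z'_def by (rule borel_measurable_lim_metric) simp
  have eq: "AE \<omega> in M. Z' \<omega> = Z0 \<omega>"
    using lim by eventually_elim (simp add: Z'_def limI)
  have lim': "AE \<omega> in M. (\<lambda>n. Z n \<omega>) \<longlonglongrightarrow> Z' \<omega>"
    using lim eq by eventually_elim simp
  have "0 \<le> (\<integral>\<omega>. (Z 0 \<omega>)\<^sup>2 \<partial>M)" by simp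
  then have K0: "K \<ge> 0" using K[of 0] by linarith
  have "(\<integral>\<^sup>+\<omega>. ennreal ((Z' \<omega>)\<^sup>2) \<partial>M) = (\<integral>\<^sup>+\<omega>. liminf (\<lambda>n. ennreal ((Z n \<omega>)\<^sup>2)) \<partial>M)"
  proof (rule nn_integral_cong_AE)
    show "AE \<omega> in M. ennreal ((Z' \<omega>)\<^sup>2) = liminf (\<lambda>n. ennreal ((Z n \<omega>)\<^sup>2))"
      using lim'
    proof eventually_elim
      case (elim \<omega>)
      then have "(\<lambda>n. ennreal ((Z n \<omega>)\<^sup>2)) \<longlonglongrightarrow> ennreal ((Z' \<omega>)\<^sup>2)" by (intro tendsto_ennrealI tendsto_power)
      from lim_imp_Liminf[OF sequentially_bot this] show ?case ..
    qed
  qed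
  also have "\<dots> \<le> liminf (\<lambda>n. \<integral>\<^sup>+\<omega>. ennreal ((Z n \<omega>)\<^sup>2) \<partial>M)" by (rule nn_integral_liminf) measurable
  also have "\<dots> \<le> ennreal K"
  proof (rule Liminf_le)
    show "\<forall>\<^sub>F n in sequentially. (\<integral>\<^sup>+\<omega>. ennreal ((Z n \<omega>)\<^sup>2) \<partial>M) \<le> ennreal K"
      using K by (intro always_eventually allI) (simp add: nn_integral_eq_integral Zi ennreal_leI)
  qed simp
  finally have nn: "(\<integral>\<^sup>+\<omega>. ennreal ((Z' \<omega>)\<^sup>2) \<partial>M) \<le> ennreal K" .
  have Z'i: "integrable M (\<lambda>\<omega>. (Z' \<omega>)\<^sup>2)"
    using nn by (intro integrableI_nonneg) (auto intro: le_less_trans)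
  have Z': "square_integrable M Z'" using Z'i by (simp add: square_integrable_def)
  have Z'K: "(\<integral>\<omega>. (Z' \<omega>)\<^sup>2 \<partial>M) \<le> K"
    using nn K0 by (simp add: nn_integral_eq_integral Z'i)
  \<comment> \<open>The difference to the limit is split at height k. The truncated part vanishes by
    bounded convergence; the excess is at most its square divided by k, hence of mean at most 4K/k
    uniformly in n. Finally k grows.\<close>
  have bound: "\<bar>\<integral>\<omega>. Z' \<omega> \<partial>M\<bar> \<le> 4 * K / k" if k: "k > 0" for k :: real
  proof -
    define m where "m n = (\<integral>\<omega>. min \<bar>Z n \<omega> - Z' \<omega>\<bar> k \<partial>M)" for n
    have "m \<longlonglongrightarrow> (\<integral>\<omega>. 0 \<partial>M)"
      unfolding m_def
    proof (rule integral_dominated_convergence[where w="\<lambda>_. k"])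
      show "AE \<omega> in M. (\<lambda>n. min \<bar>Z n \<omega> - Z' \<omega>\<bar> k) \<longlonglongrightarrow> 0"
        using lim'
      proof eventually_elim
        case (elim \<omega>)
        have "(\<lambda>n. min \<bar>Z n \<omega> - Z' \<omega>\<bar> k) \<longlonglongrightarrow> min \<bar>Z' \<omega> - Z' \<omega>\<bar> k"
          using elim by (intro tendsto_min tendsto_rabs tendsto_diff tendsto_const)
        then show ?case using k by simp
      qed
    qed (use k in auto)
    then have m0: "(\<lambda>n. m n + 4 * K / k) \<longlonglongrightarrow> 0 + 4 * K / k" by (intro tendsto_intros) simp
    have "\<bar>\<integral>\<omega>. Z' \<omega> \<partial>M\<bar> \<le> m n + 4 * K / k" for n
    proof -
      let ?d = "\<lambda>\<omega>. Z n \<omega> - Z' \<omega>"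
      have d: "square_integrable M ?d" by (rule square_integrable_diff[OF Z Z'])
      then have di: "integrable M (\<lambda>\<omega>. (?d \<omega>)\<^sup>2)" by (simp add: square_integrable_def)
      have mi: "integrable M (\<lambda>\<omega>. min \<bar>?d \<omega>\<bar> k)"
        by (rule Bochner_Integration.integrable_bound[where f="\<lambda>_. k"]) (use k in auto)
      have "(\<integral>\<omega>. ?d \<omega> \<partial>M) = - (\<integral>\<omega>. Z' \<omega> \<partial>M)"
        using Z Z' by (simp add: square_integrable_integrable mean)
      then have "\<bar>\<integral>\<omega>. Z' \<omega> \<partial>M\<bar> = \<bar>\<integral>\<omega>. ?d \<omega> \<partial>M\<bar>" by simp
      also have "\<dots> \<le> (\<integral>\<omega>. \<bar>?d \<omega>\<bar> \<partial>M)" by (rule integral_abs_bound)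
      also have "\<dots> \<le> (\<integral>\<omega>. min \<bar>?d \<omega>\<bar> k + (?d \<omega>)\<^sup>2 / k \<partial>M)"
      proof (rule integral_mono)
        show "integrable M (\<lambda>\<omega>. \<bar>?d \<omega>\<bar>)" using square_integrable_integrable[OF d] by simp
        show "integrable M (\<lambda>\<omega>. min \<bar>?d \<omega>\<bar> k + (?d \<omega>)\<^sup>2 / k)" using mi di by simp
        have "\<bar>y\<bar> \<le> min \<bar>y\<bar> k + y\<^sup>2 / k" for y
        proof (cases "\<bar>y\<bar> \<le> k")
          case False
          then have "k * \<bar>y\<bar> \<le> \<bar>y\<bar> * \<bar>y\<bar>" by (intro mult_right_mono) auto
          then have "\<bar>y\<bar> \<le> y\<^sup>2 / k" using k by (simp add: pos_le_divide_eq power2_eq_square mult.commute)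
          with False k show ?thesis by simp
        qed (use k in simp)
        then show "\<bar>?d \<omega>\<bar> \<le> min \<bar>?d \<omega>\<bar> k + (?d \<omega>)\<^sup>2 / k" for \<omega> .
      qed
      also have "\<dots> = m n + (\<integral>\<omega>. (?d \<omega>)\<^sup>2 \<partial>M) / k" using mi di by (simp add: m_def)
      also have "(\<integral>\<omega>. (?d \<omega>)\<^sup>2 \<partial>M) \<le> 4 * K"
        using integral_sq_diff_le[OF Z[of n] Z'] K[of n] Z'K by linarith
      finally show ?thesis using k by (simp add: divide_right_mono)
    qed
    then have "\<bar>\<integral>\<omega>. Z' \<omega> \<partial>M\<bar> \<le> 0 + 4 * K / k" by (intro LIMSEQ_le_const[OF m0]) auto
    then show ?thesis by simp
  qed
  have "(\<lambda>k. 4 * K / real k) \<longlonglongrightarrow> 0" by (rule lim_const_over_n)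
  then have "\<bar>\<integral>\<omega>. Z' \<omega> \<partial>M\<bar> \<le> 0"
    by (rule LIMSEQ_le_const) (use bound in \<open>auto intro!: exI[of _ 1]\<close>)
  then have "(\<integral>\<omega>. Z' \<omega> \<partial>M) = 0" by simp
  with Z' Z'K eq show thesis by (intro that)
qed

section \<open>Brownian increments\<close>

context filtered_prob_space
begin

lemma measurable_F_M: "0 \<le> s \<Longrightarrow> f \<in> measurable (F s) N \<Longrightarrow> f \<in> measurable M N"
  using measurable_from_subalg[OF F_subalgebra] .

lemma space_F: "0 \<le> s \<Longrightarrow> space (F s) = space M"
  using F_subalgebra[of s] by (simp add: subalgebra_def)

lemma measurable_F_mono: "0 \<le> s \<Longrightarrow> s \<le> t \<Longrightarrow> f \<in> measurable (F s) N \<Longrightarrow> f \<in> measurable (F t) N"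
  by (rule measurable_from_subalg[of "F t" "F s"]) (simp_all add: subalgebra_def space_F F_mono)

context
  fixes B :: "real \<Rightarrow> 'w \<Rightarrow> real" and s t :: real
  assumes B: "brownian_motion M F B" and st: "0 \<le> s" "s < t"
begin

lemma increment_measurable_F: "(\<lambda>\<omega>. B t \<omega> - B s \<omega>) \<in> borel_measurable (F t)"
proof -
  have "B t \<in> borel_measurable (F t)" "B s \<in> borel_measurable (F s)"
    using B st by (auto simp: brownian_motion_def)
  moreover from this(2) have "B s \<in> borel_measurable (F t)"
    by (rule measurable_F_mono[rotated 2]) (use st in auto)
  ultimately show ?thesis by (intro borel_measurable_diff)
qed

lemma increment_measurable: "(\<lambda>\<omega>. B t \<omega> - B s \<omega>) \<in> borel_measurable M"
  using increment_measurable_F measurable_F_M[of t] st by auto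

lemma increment_distributed: "distributed M lborel (\<lambda>\<omega>. B t \<omega> - B s \<omega>) (\<lambda>x. ennreal (normal_density 0 (sqrt (t - s)) x))"
  using B st by (auto simp: brownian_motion_def)

lemma increment_moment:
  "integrable M (\<lambda>\<omega>. (B t \<omega> - B s \<omega>) ^ k)"
  "(\<integral>\<omega>. (B t \<omega> - B s \<omega>) ^ k \<partial>M) = (\<integral>x. normal_density 0 (sqrt (t - s)) x * x ^ k \<partial>lborel)"
proof -
  have pos: "sqrt (t - s) > 0" using st by simp
  show "integrable M (\<lambda>\<omega>. (B t \<omega> - B s \<omega>) ^ k)"
    using distributed_integrable[OF increment_distributed, of "\<lambda>x. x ^ k"] integrable_normal_moment[OF pos, of 0 k] by simp
  show "(\<integral>\<omega>. (B t \<omega> - B s \<omega>) ^ k \<partial>M) = (\<integral>x. normal_density 0 (sqrt (t - s)) x * x ^ k \<partial>lborel)"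
    by (rule distributed_integral[OF increment_distributed, symmetric]) auto
qed

lemma increment_mean: "(\<integral>\<omega>. B t \<omega> - B s \<omega> \<partial>M) = 0"
  using increment_moment(2)[of 1] integral_normal_moment_odd[of "sqrt (t - s)" 0 0] st by simp

lemma increment_integrable: "integrable M (\<lambda>\<omega>. B t \<omega> - B s \<omega>)"
  using increment_moment(1)[of 1] by simp

lemma increment_variance: "(\<integral>\<omega>. (B t \<omega> - B s \<omega>)\<^sup>2 \<partial>M) = t - s"
  using increment_moment(2)[of 2] integral_normal_moment_even[of "sqrt (t - s)" 0 1] st by simp

lemma increment_fourth_moment: "(\<integral>\<omega>. (B t \<omega> - B s \<omega>) ^ 4 \<partial>M) = 3 * (t - s)\<^sup>2"
  using increment_moment(2)[of 4] integral_normal_moment_even[of "sqrt (t - s)" 0 2] st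
  by (simp add: fact_numeral power_divide)

lemma centered_square_integrable: "square_integrable M (\<lambda>\<omega>. (B t \<omega> - B s \<omega>)\<^sup>2 - (t - s))"
  and centered_square_mean: "(\<integral>\<omega>. (B t \<omega> - B s \<omega>)\<^sup>2 - (t - s) \<partial>M) = 0"
  and centered_square_variance: "(\<integral>\<omega>. ((B t \<omega> - B s \<omega>)\<^sup>2 - (t - s))\<^sup>2 \<partial>M) = 2 * (t - s)\<^sup>2"
proof -
  define \<xi> where "\<xi> \<omega> = B t \<omega> - B s \<omega>" for \<omega>
  define h where "h = t - s"
  have m: "integrable M (\<lambda>\<omega>. (\<xi> \<omega>)\<^sup>2)" "integrable M (\<lambda>\<omega>. \<xi> \<omega> ^ 4)" "(\<integral>\<omega>. (\<xi> \<omega>)\<^sup>2 \<partial>M) = h" "(\<integral>\<omega>. \<xi> \<omega> ^ 4 \<partial>M) = 3 * h\<^sup>2"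
    and meas: "\<xi> \<in> borel_measurable M"
    using increment_moment(1)[of 2] increment_moment(1)[of 4] increment_variance increment_fourth_moment increment_measurable
    by (simp_all add: \<xi>_def[abs_def] h_def)
  have eq: "((\<xi> \<omega>)\<^sup>2 - h)\<^sup>2 = \<xi> \<omega> ^ 4 - 2 * h * (\<xi> \<omega>)\<^sup>2 + h\<^sup>2" for \<omega>
    by (simp add: power2_diff mult_ac)
  have "square_integrable M (\<lambda>\<omega>. (\<xi> \<omega>)\<^sup>2 - h)"
    unfolding square_integrable_def eq using m(1,2) meas by simp
  moreover have "(\<integral>\<omega>. (\<xi> \<omega>)\<^sup>2 - h \<partial>M) = 0"
    using m(1,3) by (simp add: prob_space)
  \<comment> \<open>The Gaussian fourth moment gives 3h^2 - 2h^2 + h^2 = 2h^2.\<close>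
  moreover have "(\<integral>\<omega>. ((\<xi> \<omega>)\<^sup>2 - h)\<^sup>2 \<partial>M) = 2 * h\<^sup>2"
  proof -
    have "(\<integral>\<omega>. ((\<xi> \<omega>)\<^sup>2 - h)\<^sup>2 \<partial>M) = (\<integral>\<omega>. \<xi> \<omega> ^ 4 \<partial>M) - 2 * h * (\<integral>\<omega>. (\<xi> \<omega>)\<^sup>2 \<partial>M) + h\<^sup>2"
      unfolding eq using m(1,2) by (simp add: prob_space)
    then show ?thesis unfolding m(3,4) by (simp add: power2_eq_square)
  qed
  ultimately show "square_integrable M (\<lambda>\<omega>. (B t \<omega> - B s \<omega>)\<^sup>2 - (t - s))"
    "(\<integral>\<omega>. (B t \<omega> - B s \<omega>)\<^sup>2 - (t - s) \<partial>M) = 0"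
    "(\<integral>\<omega>. ((B t \<omega> - B s \<omega>)\<^sup>2 - (t - s))\<^sup>2 \<partial>M) = 2 * (t - s)\<^sup>2"
    unfolding \<xi>_def h_def by simp_all
qed

text \<open>The definition of a Brownian motion speaks of events of \<open>F s\<close> and preimages
  under the increment. Both families are intersection-stable, so independence passes to the
  generated sigma-algebras and from there to random variables; \<open>g\<close> covers the increment
  and its centered square.\<close>

lemma increment_indep:
  assumes U: "U \<in> borel_measurable (F s)" and g: "g \<in> borel_measurable borel"
  shows "indep_var borel U borel (\<lambda>\<omega>. g (B t \<omega> - B s \<omega>) :: real)"
proof -
  let ?\<xi> = "\<lambda>\<omega>. B t \<omega> - B s \<omega>"
  let ?A = "{?\<xi> -` A \<inter> space M | A. A \<in> sets borel}"
  have indep: "indep_set (sets (F s)) ?A" using B st by (auto simp: brownian_motion_def)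
  have "Int_stable (sets (F s))" by (rule sets.Int_stable)
  moreover have "Int_stable ?A"
  proof (rule Int_stableI)
    fix a b assume "a \<in> ?A" "b \<in> ?A"
    then obtain C D where "a = ?\<xi> -` C \<inter> space M" "b = ?\<xi> -` D \<inter> space M" "C \<in> sets borel" "D \<in> sets borel" by blast
    then show "a \<inter> b \<in> ?A" by (intro CollectI exI[of _ "C \<inter> D"]) auto
  qed
  ultimately have "indep_set (sigma_sets (space M) (sets (F s))) (sigma_sets (space M) ?A)"
    by (rule indep_set_sigma_sets[OF indep])
  then have *: "indep_set (sigma_sets (space M) {U -` A \<inter> space M | A. A \<in> sets borel}) (sigma_sets (space M) ?A)"
    unfolding indep_set_def
  proof (rule indep_sets_mono_sets)
    have "{U -` A \<inter> space M | A. A \<in> sets borel} \<subseteq> sets (F s)"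
      using measurable_sets[OF U] space_F[OF st(1)] by auto
    then show "(case i of True \<Rightarrow> sigma_sets (space M) {U -` A \<inter> space M | A. A \<in> sets borel} | False \<Rightarrow> sigma_sets (space M) ?A)
        \<subseteq> (case i of True \<Rightarrow> sigma_sets (space M) (sets (F s)) | False \<Rightarrow> sigma_sets (space M) ?A)" for i
      by (cases i) (auto intro!: sigma_sets_mono')
  qed
  have "indep_var borel U borel ?\<xi>"
    unfolding indep_var_eq using * measurable_F_M[OF st(1) U] increment_measurable by auto
  from indep_var_compose[OF this measurable_ident g] show ?thesis by (simp add: comp_def)
qed

text \<open>Factorization of the expectation stands in for conditioning on
  \<open>F s\<close>.\<close>

lemma increment_product:
  assumes U: "U \<in> borel_measurable (F s)" "integrable M U" and g: "g \<in> borel_measurable borel" "integrable M (\<lambda>\<omega>. g (B t \<omega> - B s \<omega>))"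
  shows "integrable M (\<lambda>\<omega>. U \<omega> * (g (B t \<omega> - B s \<omega>) :: real))"
    and "(\<integral>\<omega>. U \<omega> * g (B t \<omega> - B s \<omega>) \<partial>M) = (\<integral>\<omega>. U \<omega> \<partial>M) * (\<integral>\<omega>. g (B t \<omega> - B s \<omega>) \<partial>M)"
  using indep_var_integrable[OF increment_indep[OF U(1) g(1)] U(2) g(2)]
    indep_var_lebesgue_integral[OF increment_indep[OF U(1) g(1)] U(2) g(2)] by auto

end

section \<open>Discrete martingales\<close>

text \<open>Conditional centering is expressed by orthogonality to all square integrable variables
  known at the left end of the step. The preceding partial sum is such a variable, so the mixed
  terms vanish and the second moments add up.\<close>

lemma martingale_differences:
  fixes D :: "nat \<Rightarrow> 'w \<Rightarrow> real" and \<tau> :: "nat \<Rightarrow> real"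
  assumes \<tau>: "\<And>j. 0 \<le> \<tau> j" "\<And>i j. i \<le> j \<Longrightarrow> \<tau> i \<le> \<tau> j"
    and D: "\<And>j. j < n \<Longrightarrow> D j \<in> borel_measurable (F (\<tau> (Suc j)))" "\<And>j. j < n \<Longrightarrow> square_integrable M (D j)"
    and orth: "\<And>j U. j < n \<Longrightarrow> U \<in> borel_measurable (F (\<tau> j)) \<Longrightarrow> square_integrable M U \<Longrightarrow> (\<integral>\<omega>. U \<omega> * D j \<omega> \<partial>M) = 0"
  shows "square_integrable M (\<lambda>\<omega>. \<Sum>j<n. D j \<omega>)" "(\<integral>\<omega>. (\<Sum>j<n. D j \<omega>) \<partial>M) = 0"
    "(\<integral>\<omega>. (\<Sum>j<n. D j \<omega>)\<^sup>2 \<partial>M) = (\<Sum>j<n. \<integral>\<omega>. (D j \<omega>)\<^sup>2 \<partial>M)"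
proof -
  have sq: "square_integrable M (\<lambda>\<omega>. \<Sum>j<m. D j \<omega>)" if "m \<le> n" for m
    by (rule square_integrable_sum) (use D that in auto)
  then show "square_integrable M (\<lambda>\<omega>. \<Sum>j<n. D j \<omega>)" by simp
  have "(\<integral>\<omega>. D j \<omega> \<partial>M) = 0" if "j < n" for j
    using orth[OF that, of "\<lambda>_. 1"] square_integrable_one by simp
  then show "(\<integral>\<omega>. (\<Sum>j<n. D j \<omega>) \<partial>M) = 0"
    using D(2) by (subst Bochner_Integration.integral_sum) (auto intro: square_integrable_integrable)
  have "(\<integral>\<omega>. (\<Sum>j<m. D j \<omega>)\<^sup>2 \<partial>M) = (\<Sum>j<m. \<integral>\<omega>. (D j \<omega>)\<^sup>2 \<partial>M)" if "m \<le> n" for m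
    using that
  proof (induction m)
    case (Suc m)
    let ?S = "\<lambda>\<omega>. \<Sum>j<m. D j \<omega>"
    have m: "?S \<in> borel_measurable (F (\<tau> m))"
    proof (intro borel_measurable_sum)
      fix j assume "j \<in> {..<m}"
      then show "D j \<in> borel_measurable (F (\<tau> m))"
        using D(1)[of j] \<tau>(1)[of "Suc j"] \<tau>(2)[of "Suc j" m] Suc.prems by (intro measurable_F_mono[of "\<tau> (Suc j)" "\<tau> m"]) auto
    qed
    have "(\<integral>\<omega>. ?S \<omega> * D m \<omega> \<partial>M) = 0" using orth[OF _ m sq] Suc.prems by simp
    moreover have "(\<integral>\<omega>. (?S \<omega>)\<^sup>2 + (D m \<omega>)\<^sup>2 + 2 * (?S \<omega> * D m \<omega>) \<partial>M) =
        (\<integral>\<omega>. (?S \<omega>)\<^sup>2 \<partial>M) + (\<integral>\<omega>. (D m \<omega>)\<^sup>2 \<partial>M) + 2 * (\<integral>\<omega>. ?S \<omega> * D m \<omega> \<partial>M)"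
      using sq[of m] D(2)[of m] square_integrable_mult[OF sq[of m] D(2)[of m]] Suc.prems
      by (simp add: square_integrable_def)
    ultimately show ?case using Suc by (simp add: power2_sum mult.assoc)
  qed simp
  then show "(\<integral>\<omega>. (\<Sum>j<n. D j \<omega>)\<^sup>2 \<partial>M) = (\<Sum>j<n. \<integral>\<omega>. (D j \<omega>)\<^sup>2 \<partial>M)" by simp
qed

text \<open>One time step of the weighted sum over all modes. \<open>Y m\<close> stands for the
  stopped component and \<open>c\<close> for the stopping indicator; both are known at the start of
  the step, so the factors 2 Y \<Delta>B and c ((\<Delta>B)^2 - h) are centered against every U from
  \<open>F s\<close>. In the bound, 8h is twice the square of the factor 2 times the variance h, and
  4h^2 is twice the variance 2h^2.\<close>

lemma martingale_step:
  fixes I :: "'m set" and B :: "'m \<Rightarrow> real \<Rightarrow> 'w \<Rightarrow> real" and Y :: "'m \<Rightarrow> 'w \<Rightarrow> real" and c :: "'w \<Rightarrow> real"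
    and w \<sigma> :: "'m \<Rightarrow> real"
  assumes I: "finite I" and B: "\<And>m. m \<in> I \<Longrightarrow> brownian_motion M F (B m)" and s: "0 \<le> s" and h: "0 < h"
    and Y: "\<And>m. m \<in> I \<Longrightarrow> Y m \<in> borel_measurable (F s)" "\<And>m. m \<in> I \<Longrightarrow> square_integrable M (Y m)"
    and c: "c \<in> borel_measurable (F s)" "\<And>\<omega>. \<bar>c \<omega>\<bar> \<le> 1"
  defines "D \<equiv> \<lambda>\<omega>. \<Sum>m\<in>I. w m * (\<sigma> m * (2 * Y m \<omega> * (B m (s + h) \<omega> - B m s \<omega>)
      + \<sigma> m * c \<omega> * ((B m (s + h) \<omega> - B m s \<omega>)\<^sup>2 - h)))"
  shows "D \<in> borel_measurable (F (s + h))" "square_integrable M D"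
    "\<And>U. U \<in> borel_measurable (F s) \<Longrightarrow> square_integrable M U \<Longrightarrow> (\<integral>\<omega>. U \<omega> * D \<omega> \<partial>M) = 0"
    "(\<And>m. m \<in> I \<Longrightarrow> \<bar>w m\<bar> \<le> 1) \<Longrightarrow> (\<integral>\<omega>. (D \<omega>)\<^sup>2 \<partial>M) \<le>
      (\<Sum>m\<in>I. (\<sigma> m)\<^sup>2) * (8 * h * (\<Sum>m\<in>I. \<integral>\<omega>. (Y m \<omega>)\<^sup>2 \<partial>M) + 4 * h\<^sup>2 * (\<Sum>m\<in>I. (\<sigma> m)\<^sup>2))"
proof -
  define \<xi> where "\<xi> m \<omega> = B m (s + h) \<omega> - B m s \<omega>" for m \<omega>
  define q where "q m \<omega> = (\<xi> m \<omega>)\<^sup>2 - h" for m \<omega>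
  define E where "E m \<omega> = 2 * (Y m \<omega> * \<xi> m \<omega>) + \<sigma> m * (c \<omega> * q m \<omega>)" for m \<omega>
  have D: "D = (\<lambda>\<omega>. \<Sum>m\<in>I. w m * (\<sigma> m * E m \<omega>))"
    unfolding D_def E_def q_def \<xi>_def by (simp add: mult_ac)
  have sh: "s < s + h" using h by simp
  have Fs: "f \<in> borel_measurable (F (s + h))" if "f \<in> borel_measurable (F s)" for f :: "'w \<Rightarrow> real"
    by (rule measurable_F_mono[OF s _ that]) (use h in simp)
  have \<xi>F: "\<xi> m \<in> borel_measurable (F (s + h))" if "m \<in> I" for m
    unfolding \<xi>_def[abs_def] by (rule increment_measurable_F[OF B[OF that] s sh])
  show "D \<in> borel_measurable (F (s + h))"
    unfolding D E_def q_def using Y(1) c(1)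
    by (intro borel_measurable_sum borel_measurable_times borel_measurable_const borel_measurable_add
        borel_measurable_diff borel_measurable_power \<xi>F Fs)
  have qs: "square_integrable M (q m)" "(\<integral>\<omega>. q m \<omega> \<partial>M) = 0" "(\<integral>\<omega>. (q m \<omega>)\<^sup>2 \<partial>M) = 2 * h\<^sup>2" if "m \<in> I" for m
    using centered_square_integrable[OF B[OF that] s sh] centered_square_mean[OF B[OF that] s sh]
      centered_square_variance[OF B[OF that] s sh] by (simp_all add: q_def[abs_def] \<xi>_def)
  have cM: "c \<in> borel_measurable M" by (rule measurable_F_M[OF s c(1)])
  have cq: "square_integrable M (\<lambda>\<omega>. c \<omega> * q m \<omega>)" "(\<integral>\<omega>. (c \<omega> * q m \<omega>)\<^sup>2 \<partial>M) \<le> 2 * h\<^sup>2" if "m \<in> I" for m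
  proof -
    have le: "(c \<omega> * q m \<omega>)\<^sup>2 \<le> (q m \<omega>)\<^sup>2" for \<omega>
      using mult_right_mono[of "(c \<omega>)\<^sup>2" 1 "(q m \<omega>)\<^sup>2"] c(2)[of \<omega>] by (simp add: power_mult_distrib abs_square_le_1)
    have qi: "integrable M (\<lambda>\<omega>. (q m \<omega>)\<^sup>2)" and qm: "q m \<in> borel_measurable M"
      using qs(1)[OF that] by (auto simp: square_integrable_def)
    have i: "integrable M (\<lambda>\<omega>. (c \<omega> * q m \<omega>)\<^sup>2)"
      by (rule Bochner_Integration.integrable_bound[OF qi]) (use cM qm le in auto)
    show "square_integrable M (\<lambda>\<omega>. c \<omega> * q m \<omega>)"
      using i cM qm by (simp add: square_integrable_def)
    have "(\<integral>\<omega>. (c \<omega> * q m \<omega>)\<^sup>2 \<partial>M) \<le> (\<integral>\<omega>. (q m \<omega>)\<^sup>2 \<partial>M)"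
      by (rule integral_mono[OF i qi le])
    then show "(\<integral>\<omega>. (c \<omega> * q m \<omega>)\<^sup>2 \<partial>M) \<le> 2 * h\<^sup>2" using qs(3)[OF that] by simp
  qed
  have Y\<xi>: "square_integrable M (\<lambda>\<omega>. Y m \<omega> * \<xi> m \<omega>)" "(\<integral>\<omega>. (Y m \<omega> * \<xi> m \<omega>)\<^sup>2 \<partial>M) = h * (\<integral>\<omega>. (Y m \<omega>)\<^sup>2 \<partial>M)"
    if "m \<in> I" for m
  proof -
    have Y2: "(\<lambda>\<omega>. (Y m \<omega>)\<^sup>2) \<in> borel_measurable (F s)" "integrable M (\<lambda>\<omega>. (Y m \<omega>)\<^sup>2)"
      using Y[OF that] by (auto simp: square_integrable_def)
    note p = increment_product[OF B[OF that] s sh Y2, of "\<lambda>y. y\<^sup>2", OF _ increment_moment(1)[OF B[OF that] s sh]]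
    have "integrable M (\<lambda>\<omega>. (Y m \<omega> * \<xi> m \<omega>)\<^sup>2)"
      unfolding power_mult_distrib \<xi>_def by (rule p(1)) simp
    then show "square_integrable M (\<lambda>\<omega>. Y m \<omega> * \<xi> m \<omega>)"
      using Y(2)[OF that] measurable_F_M[OF _ \<xi>F[OF that]] s h by (auto simp: square_integrable_def)
    show "(\<integral>\<omega>. (Y m \<omega> * \<xi> m \<omega>)\<^sup>2 \<partial>M) = h * (\<integral>\<omega>. (Y m \<omega>)\<^sup>2 \<partial>M)"
      unfolding power_mult_distrib \<xi>_def using p(2) increment_variance[OF B[OF that] s sh] by simp
  qed
  have E: "square_integrable M (E m)" if "m \<in> I" for m
    unfolding E_def[abs_def] by (intro square_integrable_add square_integrable_cmult Y\<xi> cq that)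
  show "square_integrable M D"
    unfolding D by (intro square_integrable_sum square_integrable_cmult E)
  show "(\<integral>\<omega>. U \<omega> * D \<omega> \<partial>M) = 0" if U: "U \<in> borel_measurable (F s)" "square_integrable M U" for U
  proof -
    have "(\<integral>\<omega>. U \<omega> * E m \<omega> \<partial>M) = 0" if m: "m \<in> I" for m
    proof -
      have UY: "(\<lambda>\<omega>. U \<omega> * Y m \<omega>) \<in> borel_measurable (F s)" "integrable M (\<lambda>\<omega>. U \<omega> * Y m \<omega>)"
        using U Y[OF m] square_integrable_mult by auto
      have Uc: "(\<lambda>\<omega>. U \<omega> * c \<omega>) \<in> borel_measurable (F s)" "integrable M (\<lambda>\<omega>. U \<omega> * c \<omega>)"
      proof -
        show "(\<lambda>\<omega>. U \<omega> * c \<omega>) \<in> borel_measurable (F s)" using U(1) c(1) by simp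
        show "integrable M (\<lambda>\<omega>. U \<omega> * c \<omega>)"
          by (rule Bochner_Integration.integrable_bound[OF square_integrable_integrable[OF U(2)]])
             (use cM U(2) mult_left_mono[OF c(2) abs_ge_zero] in \<open>auto simp: square_integrable_def abs_mult\<close>)
      qed
      have 1: "integrable M (\<lambda>\<omega>. (U \<omega> * Y m \<omega>) * \<xi> m \<omega>)" "(\<integral>\<omega>. (U \<omega> * Y m \<omega>) * \<xi> m \<omega> \<partial>M) = 0"
        using increment_product[OF B[OF m] s sh UY, of "\<lambda>y. y"] increment_integrable[OF B[OF m] s sh] increment_mean[OF B[OF m] s sh]
        by (simp_all add: \<xi>_def)
      have 2: "integrable M (\<lambda>\<omega>. (U \<omega> * c \<omega>) * q m \<omega>)" "(\<integral>\<omega>. (U \<omega> * c \<omega>) * q m \<omega> \<partial>M) = 0"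
        using increment_product[OF B[OF m] s sh Uc, of "\<lambda>y. y\<^sup>2 - h"] square_integrable_integrable[OF qs(1)[OF m]] qs(2)[OF m]
        by (simp_all add: \<xi>_def q_def[abs_def])
      have "(\<integral>\<omega>. U \<omega> * E m \<omega> \<partial>M) = (\<integral>\<omega>. 2 * ((U \<omega> * Y m \<omega>) * \<xi> m \<omega>) + \<sigma> m * ((U \<omega> * c \<omega>) * q m \<omega>) \<partial>M)"
        unfolding E_def by (simp add: algebra_simps)
      then show ?thesis using 1 2 by simp
    qed
    moreover have "integrable M (\<lambda>\<omega>. U \<omega> * E m \<omega>)" if "m \<in> I" for m
      by (rule square_integrable_mult[OF U(2) E[OF that]])
    moreover have "U \<omega> * D \<omega> = (\<Sum>m\<in>I. w m * \<sigma> m * (U \<omega> * E m \<omega>))" for \<omega>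
      unfolding D sum_distrib_left by (simp add: mult_ac)
    ultimately show ?thesis by (simp add: Bochner_Integration.integral_sum)
  qed
  assume w: "\<And>m. m \<in> I \<Longrightarrow> \<bar>w m\<bar> \<le> 1"
  let ?V = "\<Sum>m\<in>I. (\<sigma> m)\<^sup>2"
  have Ei: "integrable M (\<lambda>\<omega>. (E m \<omega>)\<^sup>2)" if "m \<in> I" for m using E[OF that] by (simp add: square_integrable_def)
  have EE: "(\<integral>\<omega>. (E m \<omega>)\<^sup>2 \<partial>M) \<le> 8 * h * (\<integral>\<omega>. (Y m \<omega>)\<^sup>2 \<partial>M) + 4 * h\<^sup>2 * (\<sigma> m)\<^sup>2" if "m \<in> I" for m
  proof -
    have "(\<integral>\<omega>. (E m \<omega>)\<^sup>2 \<partial>M) = (\<integral>\<omega>. (2 * (Y m \<omega> * \<xi> m \<omega>) - (- \<sigma> m) * (c \<omega> * q m \<omega>))\<^sup>2 \<partial>M)"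
      by (simp add: E_def)
    also have "\<dots> \<le> 2 * (\<integral>\<omega>. (2 * (Y m \<omega> * \<xi> m \<omega>))\<^sup>2 \<partial>M) + 2 * (\<integral>\<omega>. ((- \<sigma> m) * (c \<omega> * q m \<omega>))\<^sup>2 \<partial>M)"
      by (intro integral_sq_diff_le square_integrable_cmult Y\<xi> cq that)
    also have "\<dots> = 8 * (\<integral>\<omega>. (Y m \<omega> * \<xi> m \<omega>)\<^sup>2 \<partial>M) + 2 * (\<sigma> m)\<^sup>2 * (\<integral>\<omega>. (c \<omega> * q m \<omega>)\<^sup>2 \<partial>M)"
      unfolding power_mult_distrib[of "2::real"] power_mult_distrib[of "- \<sigma> m"] by simp
    also have "\<dots> \<le> 8 * (h * (\<integral>\<omega>. (Y m \<omega>)\<^sup>2 \<partial>M)) + 2 * (\<sigma> m)\<^sup>2 * (2 * h\<^sup>2)"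
      unfolding Y\<xi>(2)[OF that] by (intro add_left_mono mult_left_mono cq that) auto
    finally show ?thesis by (simp only: mult.assoc mult.commute[of "(\<sigma> m)\<^sup>2"] mult.left_commute[of "(\<sigma> m)\<^sup>2"])
  qed
  \<comment> \<open>Cauchy-Schwarz over the modes, with the noise strengths on one side, gives a
    factor bounded by the summable noise strengths and not by the number of modes.\<close>
  have "(D \<omega>)\<^sup>2 \<le> ?V * (\<Sum>m\<in>I. (E m \<omega>)\<^sup>2)" for \<omega>
  proof -
    have "(D \<omega>)\<^sup>2 = (\<Sum>m\<in>I. (w m * \<sigma> m) * E m \<omega>)\<^sup>2" unfolding D by (simp add: mult.assoc)
    also have "\<dots> \<le> (\<Sum>m\<in>I. (w m * \<sigma> m)\<^sup>2) * (\<Sum>m\<in>I. (E m \<omega>)\<^sup>2)" by (rule Cauchy_Schwarz_ineq_sum)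
    also have "\<dots> \<le> ?V * (\<Sum>m\<in>I. (E m \<omega>)\<^sup>2)"
    proof (intro mult_right_mono sum_mono sum_nonneg zero_le_power2)
      fix m assume "m \<in> I"
      then have "(w m)\<^sup>2 \<le> 1" using w by (simp add: abs_square_le_1)
      then show "(w m * \<sigma> m)\<^sup>2 \<le> (\<sigma> m)\<^sup>2" using mult_right_mono[of "(w m)\<^sup>2" 1 "(\<sigma> m)\<^sup>2"] by (simp add: power_mult_distrib)
    qed
    finally show ?thesis .
  qed
  then have "(\<integral>\<omega>. (D \<omega>)\<^sup>2 \<partial>M) \<le> (\<integral>\<omega>. ?V * (\<Sum>m\<in>I. (E m \<omega>)\<^sup>2) \<partial>M)"
    using \<open>square_integrable M D\<close> Ei by (intro integral_mono) (auto simp: square_integrable_def)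
  also have "\<dots> = ?V * (\<Sum>m\<in>I. \<integral>\<omega>. (E m \<omega>)\<^sup>2 \<partial>M)"
    using Ei by (simp add: Bochner_Integration.integral_sum)
  also have "\<dots> \<le> ?V * (\<Sum>m\<in>I. 8 * h * (\<integral>\<omega>. (Y m \<omega>)\<^sup>2 \<partial>M) + 4 * h\<^sup>2 * (\<sigma> m)\<^sup>2)"
    by (intro mult_left_mono sum_mono EE sum_nonneg) auto
  finally show "(\<integral>\<omega>. (D \<omega>)\<^sup>2 \<partial>M) \<le> ?V * (8 * h * (\<Sum>m\<in>I. \<integral>\<omega>. (Y m \<omega>)\<^sup>2 \<partial>M) + 4 * h\<^sup>2 * ?V)"
    by (simp add: sum.distrib sum_distrib_left)
qed

text \<open>Every step has second moment of the order of the mesh width, so by orthogonality the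
  whole sum is bounded independently of the number \<open>n\<close> of steps. The number of modes
  enters only through \<open>C\<close> and \<open>V\<close>.\<close>

lemma martingale_sum:
  fixes I :: "'m set" and B :: "'m \<Rightarrow> real \<Rightarrow> 'w \<Rightarrow> real" and x :: "'m \<Rightarrow> real \<Rightarrow> 'w \<Rightarrow> real" and \<theta> :: "real \<Rightarrow> 'w \<Rightarrow> bool"
    and w \<sigma> :: "'m \<Rightarrow> real" and \<alpha> :: real
  assumes I: "finite I" and B: "\<And>m. m \<in> I \<Longrightarrow> brownian_motion M F (B m)" and t: "0 < t" and n: "0 < n"
    and \<theta>: "\<And>s. 0 \<le> s \<Longrightarrow> s \<le> t \<Longrightarrow> Measurable.pred (F s) (\<theta> s)"
    and x: "\<And>s m. 0 \<le> s \<Longrightarrow> s \<le> t \<Longrightarrow> m \<in> I \<Longrightarrow> x m s \<in> borel_measurable (F s)"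
    and sq: "\<And>s m. 0 \<le> s \<Longrightarrow> s \<le> t \<Longrightarrow> m \<in> I \<Longrightarrow> integrable M (\<lambda>\<omega>. of_bool (\<theta> s \<omega>) * (x m s \<omega>)\<^sup>2)"
    and C: "\<And>s. 0 \<le> s \<Longrightarrow> s \<le> t \<Longrightarrow> (\<Sum>m\<in>I. \<integral>\<omega>. of_bool (\<theta> s \<omega>) * (x m s \<omega>)\<^sup>2 \<partial>M) \<le> C"
    and V: "(\<Sum>m\<in>I. (\<sigma> m)\<^sup>2) \<le> V" and w: "\<And>m. m \<in> I \<Longrightarrow> \<bar>w m\<bar> \<le> 1"
  defines "Z \<equiv> \<lambda>\<omega>. \<Sum>j<n. \<Sum>m\<in>I. w m * martingale_term \<alpha> (\<sigma> m) (\<lambda>s. \<theta> s \<omega>) (\<lambda>s. x m s \<omega>) (\<lambda>s. B m s \<omega>) t n j"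
  shows "square_integrable M Z" "(\<integral>\<omega>. Z \<omega> \<partial>M) = 0"
    "(\<integral>\<omega>. (Z \<omega>)\<^sup>2 \<partial>M) \<le> (exp (2 * \<bar>\<alpha>\<bar> * t))\<^sup>2 * (V * (8 * t * C + 4 * t\<^sup>2 * V))"
proof -
  define h where "h = t / real n"
  define p where "p j = exp (2 * \<alpha> * grid t n j)" for j
  define Y where "Y j m \<omega> = of_bool (\<theta> (grid t n j) \<omega>) * x m (grid t n j) \<omega>" for j m \<omega>
  define D where "D j \<omega> = (\<Sum>m\<in>I. w m * (\<sigma> m * (2 * Y j m \<omega> * (B m (grid t n j + h) \<omega> - B m (grid t n j) \<omega>)
      + \<sigma> m * of_bool (\<theta> (grid t n j) \<omega>) * ((B m (grid t n j + h) \<omega> - B m (grid t n j) \<omega>)\<^sup>2 - h))))" for j \<omega>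
  have Z: "Z = (\<lambda>\<omega>. \<Sum>j<n. p j * D j \<omega>)"
    unfolding Z_def D_def p_def Y_def martingale_term_def grid_Suc h_def sum_distrib_left
    by (intro ext sum.cong refl) (simp add: algebra_simps power2_eq_square)
  have h: "h > 0" using t n by (simp add: h_def)
  have g: "0 \<le> grid t n j" "grid t n j \<le> t" if "j < n" for j
    using grid_bounds[OF t n, of j] that by auto
  have \<theta>m: "(\<lambda>\<omega>. of_bool (\<theta> (grid t n j) \<omega>) :: real) \<in> borel_measurable (F (grid t n j))" if "j < n" for j
    using \<theta>[OF g[OF that]] by measurable
  have Ym: "Y j m \<in> borel_measurable (F (grid t n j))" if "j < n" "m \<in> I" for j m
    unfolding Y_def[abs_def] by (intro borel_measurable_times \<theta>m x g that)
  have Y2: "(\<lambda>\<omega>. (Y j m \<omega>)\<^sup>2) = (\<lambda>\<omega>. of_bool (\<theta> (grid t n j) \<omega>) * (x m (grid t n j) \<omega>)\<^sup>2)" for j m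
    by (simp add: Y_def of_bool_def fun_eq_iff)
  have Ys: "square_integrable M (Y j m)" if "j < n" "m \<in> I" for j m
    using measurable_F_M[OF g(1) Ym] sq[OF g] that by (simp add: square_integrable_def Y2)
  have step1: "D j \<in> borel_measurable (F (grid t n (Suc j)))" "square_integrable M (D j)"
    "\<And>U. U \<in> borel_measurable (F (grid t n j)) \<Longrightarrow> square_integrable M U \<Longrightarrow> (\<integral>\<omega>. U \<omega> * D j \<omega> \<partial>M) = 0"
    if j: "j < n" for j
    using martingale_step(1-3)[OF I B g(1)[OF j] h Ym[OF j] Ys[OF j] \<theta>m[OF j], where w=w and \<sigma>=\<sigma>]
    unfolding D_def[abs_def] grid_Suc h_def[symmetric] by auto
  have V0: "0 \<le> (\<Sum>m\<in>I. (\<sigma> m)\<^sup>2)" by (intro sum_nonneg) auto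
  then have V0': "V \<ge> 0" using V by linarith
  have "0 \<le> (\<Sum>m\<in>I. \<integral>\<omega>. of_bool (\<theta> 0 \<omega>) * (x m 0 \<omega>)\<^sup>2 \<partial>M)"
    by (intro sum_nonneg integral_nonneg_AE) auto
  then have C0: "C \<ge> 0" using C[of 0] t by linarith
  have DD: "(\<integral>\<omega>. (D j \<omega>)\<^sup>2 \<partial>M) \<le> V * (8 * h * C + 4 * h\<^sup>2 * V)" if j: "j < n" for j
  proof -
    have "(\<integral>\<omega>. (D j \<omega>)\<^sup>2 \<partial>M) \<le> (\<Sum>m\<in>I. (\<sigma> m)\<^sup>2) * (8 * h * (\<Sum>m\<in>I. \<integral>\<omega>. (Y j m \<omega>)\<^sup>2 \<partial>M) + 4 * h\<^sup>2 * (\<Sum>m\<in>I. (\<sigma> m)\<^sup>2))"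
      using martingale_step(4)[OF I B g(1)[OF j] h Ym[OF j] Ys[OF j] \<theta>m[OF j] _ w, where \<sigma>=\<sigma>]
      unfolding D_def by auto
    also have "\<dots> \<le> V * (8 * h * C + 4 * h\<^sup>2 * V)"
      unfolding Y2 using V V0 V0' C0 h
      by (intro mult_mono add_mono mult_left_mono C g j) (auto intro!: add_nonneg_nonneg mult_nonneg_nonneg sum_nonneg integral_nonneg_AE)
    finally show ?thesis .
  qed
  have md: "square_integrable M (\<lambda>\<omega>. \<Sum>j<n. p j * D j \<omega>)" "(\<integral>\<omega>. (\<Sum>j<n. p j * D j \<omega>) \<partial>M) = 0"
    "(\<integral>\<omega>. (\<Sum>j<n. p j * D j \<omega>)\<^sup>2 \<partial>M) = (\<Sum>j<n. \<integral>\<omega>. (p j * D j \<omega>)\<^sup>2 \<partial>M)"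
  proof -
    have \<tau>: "0 \<le> grid t n j" "i \<le> j \<Longrightarrow> grid t n i \<le> grid t n j" for i j
      using t n by (auto simp: grid_def divide_right_mono mult_left_mono)
    have m: "(\<lambda>\<omega>. p j * D j \<omega>) \<in> borel_measurable (F (grid t n (Suc j)))" "square_integrable M (\<lambda>\<omega>. p j * D j \<omega>)" if "j < n" for j
      using step1[OF that] by (auto intro: square_integrable_cmult)
    have o: "(\<integral>\<omega>. U \<omega> * (p j * D j \<omega>) \<partial>M) = 0" if "j < n" "U \<in> borel_measurable (F (grid t n j))" "square_integrable M U" for j U
      unfolding mult.left_commute[of _ "p j"] integral_mult_right_zero step1(3)[OF that] by simp
    note * = martingale_differences[of "grid t n" n "\<lambda>j \<omega>. p j * D j \<omega>", OF \<tau> m o]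
    show "square_integrable M (\<lambda>\<omega>. \<Sum>j<n. p j * D j \<omega>)" "(\<integral>\<omega>. (\<Sum>j<n. p j * D j \<omega>) \<partial>M) = 0"
      "(\<integral>\<omega>. (\<Sum>j<n. p j * D j \<omega>)\<^sup>2 \<partial>M) = (\<Sum>j<n. \<integral>\<omega>. (p j * D j \<omega>)\<^sup>2 \<partial>M)"
      using * by blast+
  qed
  show "square_integrable M Z" "(\<integral>\<omega>. Z \<omega> \<partial>M) = 0" unfolding Z by (rule md)+
  have "(\<integral>\<omega>. (Z \<omega>)\<^sup>2 \<partial>M) = (\<Sum>j<n. (p j)\<^sup>2 * (\<integral>\<omega>. (D j \<omega>)\<^sup>2 \<partial>M))"
    unfolding Z md(3) by (simp add: power_mult_distrib)
  also have "\<dots> \<le> (\<Sum>j<n. (exp (2 * \<bar>\<alpha>\<bar> * t))\<^sup>2 * (V * (8 * h * C + 4 * h\<^sup>2 * V)))"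
  proof (intro sum_mono mult_mono power_mono)
    fix j assume j: "j \<in> {..<n}"
    have "\<alpha> * grid t n j \<le> \<bar>\<alpha>\<bar> * t" using g[of j] j by (intro mult_mono) auto
    then show "p j \<le> exp (2 * \<bar>\<alpha>\<bar> * t)" by (simp add: p_def)
  qed (use DD in \<open>auto simp: p_def\<close>)
  also have "\<dots> = (exp (2 * \<bar>\<alpha>\<bar> * t))\<^sup>2 * (V * (8 * (real n * h) * C + 4 * (real n * h * h) * V))"
    by (simp add: power2_eq_square algebra_simps)
  \<comment> \<open>The step widths add up to t, and one further factor h is estimated by t.\<close>
  also have "\<dots> \<le> (exp (2 * \<bar>\<alpha>\<bar> * t))\<^sup>2 * (V * (8 * t * C + 4 * t\<^sup>2 * V))"
  proof -
    have nh: "real n * h = t" using n by (simp add: h_def)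
    have "h \<le> t" using n t by (simp add: h_def divide_le_eq mult_le_cancel_left1)
    then have "t * h \<le> t\<^sup>2" using t by (simp add: power2_eq_square)
    then show ?thesis unfolding nh using V0' by (intro mult_left_mono add_left_mono mult_right_mono) auto
  qed
  finally show "(\<integral>\<omega>. (Z \<omega>)\<^sup>2 \<partial>M) \<le> (exp (2 * \<bar>\<alpha>\<bar> * t))\<^sup>2 * (V * (8 * t * C + 4 * t\<^sup>2 * V))" .
qed

end

section \<open>Pathwise analysis of the equation\<close>

text \<open>The sine functions are admissible test functions with eigenvalue -(k pi)^2. Testing with
  them reduces the weak formulation to one scalar equation per mode.\<close>

lemma dirichlet_laplacian_sine_basis:
  "dirichlet_laplacian (sine_basis k) (\<lambda>x. - of_real ((real k * pi)\<^sup>2) * sine_basis k x)"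
  unfolding dirichlet_laplacian_def
proof (intro conjI)
  define v where "v x = complex_of_real (sqrt 2 * (real k * pi) * cos (real k * pi * x))" for x
  have d1: "(sine_basis k has_vector_derivative v x) (at x within A)" for x A
  proof -
    have "((\<lambda>x. sqrt 2 * sin (real k * pi * x)) has_real_derivative sqrt 2 * (real k * pi) * cos (real k * pi * x)) (at x within A)"
      by (rule derivative_eq_intros refl)+ simp
    then show ?thesis unfolding sine_basis_def[abs_def] v_def by (rule has_vector_derivative_of_real)
  qed
  have d2: "(v has_vector_derivative (- of_real ((real k * pi)\<^sup>2) * sine_basis k x)) (at x within A)" for x A
  proof -
    have "((\<lambda>x. sqrt 2 * (real k * pi) * cos (real k * pi * x)) has_real_derivative
        - ((real k * pi)\<^sup>2 * (sqrt 2 * sin (real k * pi * x)))) (at x within A)"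
      by (auto intro!: derivative_eq_intros simp: power2_eq_square)
    then have "(v has_vector_derivative of_real (- ((real k * pi)\<^sup>2 * (sqrt 2 * sin (real k * pi * x))))) (at x within A)"
      unfolding v_def[abs_def] by (rule has_vector_derivative_of_real)
    then show ?thesis by (simp add: sine_basis_def)
  qed
  have v: "v x = v 0 + (\<integral>y. - of_real ((real k * pi)\<^sup>2) * sine_basis k y \<partial>interval_measure_on 0 x)" if "x \<in> {0..1}" for x
  proof -
    have int: "(\<integral>y. indicator {0..x} y *\<^sub>R (- of_real ((real k * pi)\<^sup>2) * sine_basis k y) \<partial>lborel) = v x - v 0"
      using that by (intro integral_FTC_Icc d2 continuous_intros continuous_sine_basis) auto
    show ?thesis unfolding integral_interval_measure_on set_lebesgue_integral_def int by simp
  qed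
  show "\<exists>u u'. (AE x in I01. sine_basis k x = u x) \<and> u 0 = 0 \<and> u 1 = 0 \<and>
      (\<forall>x\<in>{0..1}. (u has_vector_derivative u' x) (at x within {0..1})) \<and>
      (\<forall>x\<in>{0..1}. u' x = u' 0 + (\<integral>y. - of_real ((real k * pi)\<^sup>2) * sine_basis k y \<partial>interval_measure_on 0 x))"
    by (intro exI[of _ "sine_basis k"] exI[of _ v] conjI AE_I2 ballI d1 refl v) (simp_all add: sine_basis_def)
qed (intro sine_basis_L2 L2_cmult)+

section \<open>Real components of the Fourier modes\<close>

definition part :: "nat \<Rightarrow> complex \<Rightarrow> real" where
  "part i z = (if i = 1 then Re z else Im z)"

definition path_component :: "(real \<Rightarrow> real \<Rightarrow> complex) \<Rightarrow> nat \<times> nat \<Rightarrow> real \<Rightarrow> real" where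
  "path_component g m s = part (snd m) (l2inner (g s) (sine_basis (fst m)))"

definition noise_strength :: "real \<Rightarrow> (nat \<Rightarrow> real) \<Rightarrow> nat \<times> nat \<Rightarrow> real" where
  "noise_strength \<epsilon> \<eta>s m = \<epsilon> * sqrt (\<eta>s (fst m))"

definition modes :: "nat \<Rightarrow> (nat \<times> nat) set" where
  "modes N = {1..N} \<times> {1, 2}"

lemma part_bounded_linear: "bounded_linear (part i)"
  unfolding part_def[abs_def] by (cases "i = 1") (simp_all add: bounded_linear_Re bounded_linear_Im)

lemma sum_modes: "(\<Sum>m\<in>modes N. f m) = (\<Sum>k=1..N. f (k, 1) + f (k, 2))" for f :: "nat \<times> nat \<Rightarrow> 'b :: comm_monoid_add"
  unfolding modes_def sum.cartesian_product' by simp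

text \<open>The properties shared by almost all paths, stated without probability: \<open>B\<close>
  is any family of continuous functions and \<open>c0\<close> the coefficients of the initial datum.
  The scalar equations are assumed only at the grid points of [0,t], a countable set of times,
  because the weak formulation has a null set of its own for every time.\<close>

locale nls_path =
  fixes g :: "real \<Rightarrow> real \<Rightarrow> complex" and B :: "nat \<Rightarrow> nat \<Rightarrow> real \<Rightarrow> real" and c0 :: "nat \<Rightarrow> complex"
    and \<eta>s :: "nat \<Rightarrow> real" and \<eta> \<alpha> \<epsilon> lam t :: real
  assumes t: "t > 0" and \<alpha>: "\<alpha> > 0"
    and \<eta>s: "\<And>k. k \<ge> 1 \<Longrightarrow> \<eta>s k \<ge> 0" and \<eta>: "(\<lambda>k. \<eta>s (Suc k)) sums \<eta>"
    and g_L2: "\<And>s. 0 \<le> s \<Longrightarrow> g s \<in> L2"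
    and g_cont: "\<And>s. 0 \<le> s \<Longrightarrow> ((\<lambda>r. l2norm (\<lambda>x. g r x - g s x)) \<longlongrightarrow> 0) (at s within {0..})"
    and g_Lp4: "(\<lambda>(s, x). g s x) \<in> Lp 4 (interval_measure_on 0 t \<Otimes>\<^sub>M I01)"
    and B_cont: "\<And>k i. k \<ge> 1 \<Longrightarrow> i \<in> {1, 2} \<Longrightarrow> continuous_on {0..t} (B k i)"
    and weak: "\<And>k n j. k \<ge> 1 \<Longrightarrow> 0 < n \<Longrightarrow> j \<le> n \<Longrightarrow>
      l2inner (g (grid t n j)) (sine_basis k) = c0 k +
        (\<integral>s. \<i> * (- of_real ((real k * pi)\<^sup>2) * l2inner (g s) (sine_basis k) + \<i> * of_real \<alpha> * l2inner (g s) (sine_basis k) +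
          of_real lam * l2inner (cubic (g s)) (sine_basis k)) \<partial>interval_measure_on 0 (grid t n j))
        + of_real (\<epsilon> * sqrt (\<eta>s k)) * Complex (B k 1 (grid t n j)) (B k 2 (grid t n j))"
begin

abbreviation "J \<equiv> interval_measure_on 0 t"

definition coeff :: "nat \<Rightarrow> real \<Rightarrow> complex" where
  "coeff k s = l2inner (g s) (sine_basis k)"

definition cubic_coeff :: "nat \<Rightarrow> real \<Rightarrow> complex" where
  "cubic_coeff k s = l2inner (cubic (g s)) (sine_basis k)"

definition drift :: "nat \<Rightarrow> real \<Rightarrow> complex" where
  "drift k s = \<i> * (- of_real ((real k * pi)\<^sup>2) * coeff k s + \<i> * of_real \<alpha> * coeff k s + of_real lam * cubic_coeff k s)"

section \<open>Continuity and integrability along one path\<close>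

lemma coeff_continuous:
  assumes "k \<ge> 1" shows "continuous_on {0..t} (coeff k)"
  unfolding continuous_on_def
proof
  fix s assume s: "s \<in> {0..t}"
  have "((\<lambda>r. l2norm (\<lambda>x. g r x - g s x)) \<longlongrightarrow> 0) (at s within {0..t})"
    by (rule tendsto_within_subset[OF g_cont]) (use s in auto)
  moreover have "\<forall>\<^sub>F r in at s within {0..t}. norm (coeff k r - coeff k s) \<le> l2norm (\<lambda>x. g r x - g s x)"
    unfolding eventually_at_filter
  proof (intro always_eventually allI impI)
    fix r assume "r \<in> {0..t}"
    with s have "g r \<in> L2" "g s \<in> L2" by (auto intro: g_L2)
    then show "norm (coeff k r - coeff k s) \<le> l2norm (\<lambda>x. g r x - g s x)"
      unfolding coeff_def using norm_l2inner_sine_basis_le[OF L2_diff assms, of "g r" "g s"]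
      by (simp add: l2inner_diff_left sine_basis_L2)
  qed
  ultimately have "((\<lambda>r. coeff k r - coeff k s) \<longlongrightarrow> 0) (at s within {0..t})"
    by (rule Lim_null_comparison[rotated])
  then show "(coeff k \<longlongrightarrow> coeff k s) (at s within {0..t})" by (simp add: LIM_zero_iff)
qed

lemma l2norm_continuous: "continuous_on {0..t} (\<lambda>s. l2norm (g s))"
  unfolding continuous_on_def
proof
  fix s assume s: "s \<in> {0..t}"
  have "((\<lambda>r. l2norm (\<lambda>x. g r x - g s x)) \<longlongrightarrow> 0) (at s within {0..t})"
    by (rule tendsto_within_subset[OF g_cont]) (use s in auto)
  moreover have "\<forall>\<^sub>F r in at s within {0..t}. norm (l2norm (g r) - l2norm (g s)) \<le> l2norm (\<lambda>x. g r x - g s x)"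
    unfolding eventually_at_filter
  proof (intro always_eventually allI impI)
    fix r assume "r \<in> {0..t}"
    with s show "norm (l2norm (g r) - l2norm (g s)) \<le> l2norm (\<lambda>x. g r x - g s x)"
      using l2norm_diff_ge[of "g r" "g s"] by (auto intro: g_L2)
  qed
  ultimately have "((\<lambda>r. l2norm (g r) - l2norm (g s)) \<longlongrightarrow> 0) (at s within {0..t})"
    by (rule Lim_null_comparison[rotated])
  then show "((\<lambda>s. l2norm (g s)) \<longlongrightarrow> l2norm (g s)) (at s within {0..t})" by (simp add: LIM_zero_iff)
qed

sublocale pair_sigma_finite J I01
  by (intro pair_sigma_finite.intro finite_measure.sigma_finite_measure finite_measure_interval_measure_on)

lemma g_measurable: "(\<lambda>(s, x). g s x) \<in> borel_measurable (J \<Otimes>\<^sub>M I01)"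
  using g_Lp4 by (simp add: Lp_def)

lemma g_pow4_integrable: "integrable (J \<Otimes>\<^sub>M I01) (\<lambda>(s, x). norm (g s x) ^ 4)"
  using g_Lp4 by (simp add: Lp_def case_prod_unfold)

lemma AE_Lp4: "AE s in J. g s \<in> Lp 4 I01"
proof -
  have "AE s in J. integrable I01 (\<lambda>x. norm (g s x) ^ 4)"
    using AE_integrable_fst'[OF g_pow4_integrable] by simp
  then show ?thesis
  proof (rule AE_mp, intro AE_I2 impI)
    fix s assume s: "s \<in> space J" and i: "integrable I01 (\<lambda>x. norm (g s x) ^ 4)"
    have "g s \<in> borel_measurable I01" using s by (intro L2_measurable g_L2) simp
    with i show "g s \<in> Lp 4 I01" by (simp add: Lp_def)
  qed
qed

lemma pow4_integrable: "integrable J (\<lambda>s. \<integral>x. norm (g s x) ^ 4 \<partial>I01)"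
  using integrable_fst'[OF g_pow4_integrable] by simp

lemma cubic_coeff_measurable: "cubic_coeff k \<in> borel_measurable J"
proof -
  have [measurable]: "(\<lambda>z. g (fst z) (snd z)) \<in> borel_measurable (J \<Otimes>\<^sub>M I01)"
    using g_measurable by (simp add: case_prod_unfold)
  have [measurable]: "(\<lambda>z. sine_basis k (snd z)) \<in> borel_measurable (J \<Otimes>\<^sub>M I01)"
    by (rule measurable_compose[OF measurable_snd]) (intro borel_measurable_interval_measure_on sine_basis_measurable)
  have "(\<lambda>z. of_real ((norm (g (fst z) (snd z)))\<^sup>2) * g (fst z) (snd z) * sine_basis k (snd z)) \<in> borel_measurable (J \<Otimes>\<^sub>M I01)"
    by measurable
  then have "(\<lambda>s. \<integral>x. of_real ((norm (g s x))\<^sup>2) * g s x * sine_basis k x \<partial>I01) \<in> borel_measurable J"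
    by (intro M2.borel_measurable_lebesgue_integral) (simp add: case_prod_unfold)
  then show ?thesis by (simp add: cubic_coeff_def[abs_def] l2inner_def cubic_def)
qed

text \<open>The bound a^3 \<le> 1 + a^4 and the boundedness of the sine functions control the
  coefficient by the spatial integral of |g|^4, which is integrable in time by Fubini.\<close>

lemma cubic_coeff_integrable: "integrable J (cubic_coeff k)"
proof (rule Bochner_Integration.integrable_bound)
  show "integrable J (\<lambda>s. sqrt 2 * (1 + (\<integral>x. norm (g s x) ^ 4 \<partial>I01)))"
    using pow4_integrable by simp
  show "cubic_coeff k \<in> borel_measurable J" by (rule cubic_coeff_measurable)
  show "AE s in J. norm (cubic_coeff k s) \<le> norm (sqrt 2 * (1 + (\<integral>x. norm (g s x) ^ 4 \<partial>I01)))"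
    using AE_Lp4
  proof eventually_elim
    case (elim s)
    have "norm (cubic_coeff k s) \<le> (\<integral>x. norm (cubic (g s) x * cnj (sine_basis k x)) \<partial>I01)"
      unfolding cubic_coeff_def l2inner_def by (rule integral_norm_bound)
    also have "\<dots> \<le> (\<integral>x. sqrt 2 * (1 + norm (g s x) ^ 4) \<partial>I01)"
    proof (rule integral_mono)
      show "integrable I01 (\<lambda>x. norm (cubic (g s) x * cnj (sine_basis k x)))"
        unfolding cnj_sine_basis
        by (intro integrable_norm integrable_times_bounded_continuous[OF cubic_integrable[OF elim] continuous_sine_basis norm_sine_basis_le])
      show "integrable I01 (\<lambda>x. sqrt 2 * (1 + norm (g s x) ^ 4))"
        using Lp4_integrable[OF elim order_refl] by simp
      show "norm (cubic (g s) x * cnj (sine_basis k x)) \<le> sqrt 2 * (1 + norm (g s x) ^ 4)" for x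
      proof -
        have "norm (g s x) ^ 3 * 1 \<le> norm (g s x) ^ 4 / 1 + 1 ^ 3 * 1 ^ 4" by (rule young_cubic) auto
        then have "norm (g s x) ^ 3 * norm (sine_basis k x) \<le> (1 + norm (g s x) ^ 4) * sqrt 2"
          by (intro mult_mono norm_sine_basis_le) auto
        then show ?thesis by (simp add: norm_mult norm_cubic mult.commute)
      qed
    qed
    also have "\<dots> = sqrt 2 * (1 + (\<integral>x. norm (g s x) ^ 4 \<partial>I01))"
      using Lp4_integrable[OF elim order_refl] by simp
    finally show ?case by simp
  qed
qed

lemma drift_integrable:
  assumes "k \<ge> 1" shows "integrable J (drift k)"
proof -
  have "integrable J (coeff k)"
    unfolding integrable_interval_measure_on_iff by (rule borel_integrable_atLeastAtMost'[OF coeff_continuous[OF assms]])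
  with cubic_coeff_integrable[of k] show ?thesis
    unfolding drift_def[abs_def] by (intro integrable_mult_right Bochner_Integration.integrable_add) auto
qed

abbreviation "component \<equiv> path_component g"

lemma component_eq: "component m s = part (snd m) (coeff (fst m) s)"
  by (simp add: path_component_def coeff_def)

lemma component_energy:
  assumes m: "m \<in> {1..} \<times> {1, 2}"
    and S: "0 \<le> S" "S \<le> t"
    and \<theta>1: "\<And>s. 0 \<le> s \<Longrightarrow> s < S \<Longrightarrow> \<theta> s" and \<theta>2: "\<And>s. S < s \<Longrightarrow> s \<le> t \<Longrightarrow> \<not> \<theta> s"
  shows "(\<lambda>n. \<Sum>j<n. martingale_term \<alpha> (noise_strength \<epsilon> \<eta>s m) \<theta> (component m) (B (fst m) (snd m)) t n j) \<longlonglongrightarrow>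
    exp (2 * \<alpha> * S) * (component m S)\<^sup>2 - (component m 0)\<^sup>2 -
    (LINT s:{0..S}|lborel. exp (2 * \<alpha> * s) * (2 * component m s * part (snd m) (drift (fst m) s) + 2 * \<alpha> * (component m s)\<^sup>2 + (noise_strength \<epsilon> \<eta>s m)\<^sup>2))"
proof (rule pathwise_energy[OF t _ _ _ _ S \<theta>1 \<theta>2])
  define k i where "k = fst m" and "i = snd m"
  then have mki: "m = (k, i)" and k: "k \<ge> 1" and i: "i \<in> {1, 2}" using m by auto
  interpret p: bounded_linear "part i" by (rule part_bounded_linear)
  show "continuous_on {0..t} (component m)"
    unfolding component_eq[abs_def] mki fst_conv snd_conv
    by (rule p.continuous_on[OF coeff_continuous[OF k]])
  show "continuous_on {0..t} (B (fst m) (snd m))" using B_cont[OF k i] by (simp add: mki)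
  have d: "integrable J (\<lambda>s. part i (drift k s))" by (rule integrable_bounded_linear[OF part_bounded_linear drift_integrable[OF k]])
  then show "set_integrable lborel {0..t} (\<lambda>s. part (snd m) (drift (fst m) s))"
    by (simp add: mki integrable_interval_measure_on_iff)
  fix n j :: nat assume nj: "0 < n" "j \<le> n"
  let ?s = "grid t n j"
  have sub: "{0..?s} \<subseteq> {0..t}" using grid_bounds[OF t nj] by auto
  have di: "integrable (interval_measure_on 0 ?s) (drift k)"
    using drift_integrable[OF k] sub unfolding integrable_interval_measure_on_iff by (auto intro: set_integrable_subset)
  have "coeff k ?s = c0 k + (\<integral>s. drift k s \<partial>interval_measure_on 0 ?s) + of_real (\<epsilon> * sqrt (\<eta>s k)) * Complex (B k 1 ?s) (B k 2 ?s)"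
    using weak[OF k nj] unfolding drift_def coeff_def cubic_coeff_def .
  then have "part i (coeff k ?s) = part i (c0 k) + (\<integral>s. part i (drift k s) \<partial>interval_measure_on 0 ?s)
      + part i (of_real (\<epsilon> * sqrt (\<eta>s k)) * Complex (B k 1 ?s) (B k 2 ?s))"
    by (simp only: p.add integral_bounded_linear[OF part_bounded_linear di])
  also have "part i (of_real (\<epsilon> * sqrt (\<eta>s k)) * Complex (B k 1 ?s) (B k 2 ?s)) = \<epsilon> * sqrt (\<eta>s k) * B k i ?s"
    using i by (auto simp: part_def)
  finally show "component m ?s = part i (c0 k) + (LINT s:{0..?s}|lborel. part (snd m) (drift (fst m) s)) + noise_strength \<epsilon> \<eta>s m * B (fst m) (snd m) ?s"
    unfolding component_eq noise_strength_def mki fst_conv snd_conv integral_interval_measure_on .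
qed

text \<open>The limit of the weighted martingale sums as the mesh shrinks, with the cancellations
  already carried out: neither the eigenvalues of the Laplacian nor a separate damping term
  remains.\<close>

definition fejer_energy :: "nat \<Rightarrow> real \<Rightarrow> real" where
  "fejer_energy N S = exp (2 * \<alpha> * S) * (\<Sum>k=1..N. fejer N k * (norm (coeff k S))\<^sup>2)
    - (\<Sum>k=1..N. fejer N k * (norm (coeff k 0))\<^sup>2)
    + 2 * lam * (LINT s:{0..S}|lborel. exp (2 * \<alpha> * s) * Im (fejer_nonlinearity N (g s)))
    - \<epsilon>\<^sup>2 * (\<Sum>k=1..N. fejer N k * \<eta>s k) / \<alpha> * (exp (2 * \<alpha> * S) - 1)"

lemma fejer_nonlinearity_coeff:
  "fejer_nonlinearity N (g s) = (\<Sum>k=1..N. of_real (fejer N k) * cubic_coeff k s * cnj (coeff k s))"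
  by (simp add: fejer_nonlinearity_def cubic_coeff_def coeff_def)

lemma exp_times_integrable:
  assumes "integrable J f" "S \<le> t"
  shows "set_integrable lborel {0..S} (\<lambda>s. exp (2 * \<alpha> * s) * (f s :: real))"
proof -
  have "integrable J (\<lambda>s. exp (2 * \<alpha> * s) * f s)"
  proof (rule Bochner_Integration.integrable_bound)
    show "integrable J (\<lambda>s. exp (2 * \<alpha> * t) * f s)" using assms by simp
    show "(\<lambda>s. exp (2 * \<alpha> * s) * f s) \<in> borel_measurable J"
      using borel_measurable_integrable[OF assms(1)]
      by (intro borel_measurable_times[OF borel_measurable_I01_continuous]) (auto intro!: continuous_intros)
    show "AE s in J. norm (exp (2 * \<alpha> * s) * f s) \<le> norm (exp (2 * \<alpha> * t) * f s)"
      using \<alpha> by (intro AE_I2) (auto simp: abs_mult intro!: mult_right_mono)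
  qed
  then show ?thesis
    unfolding integrable_interval_measure_on_iff using assms(2) by (auto intro: set_integrable_subset)
qed

lemma continuous_times_integrable:
  fixes u v :: "real \<Rightarrow> real"
  assumes u: "continuous_on {0..t} u" and v: "integrable J v"
  shows "integrable J (\<lambda>s. u s * v s)"
proof -
  obtain C where C: "\<And>s. s \<in> {0..t} \<Longrightarrow> \<bar>u s\<bar> \<le> C" using continuous_on_Icc_bounded[OF u] by blast
  have um: "u \<in> borel_measurable J"
    using borel_integrable_atLeastAtMost'[OF u] unfolding integrable_interval_measure_on_iff[symmetric] by auto
  show ?thesis
  proof (rule Bochner_Integration.integrable_bound)
    show "integrable J (\<lambda>s. C * v s)" using v by simp
    show "(\<lambda>s. u s * v s) \<in> borel_measurable J" using um v by auto
    show "AE s in J. norm (u s * v s) \<le> norm (C * v s)"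
    proof (intro AE_I2)
      fix s assume "s \<in> space J"
      then have "\<bar>u s\<bar> \<le> \<bar>C\<bar>" using C[of s] by simp
      then show "norm (u s * v s) \<le> norm (C * v s)" by (simp add: abs_mult mult_right_mono)
    qed
  qed
qed

lemma nonlinear_mode_integrable:
  assumes k: "k \<ge> 1" and S: "S \<le> t"
  shows "set_integrable lborel {0..S} (\<lambda>s. exp (2 * \<alpha> * s) * Im (cubic_coeff k s * cnj (coeff k s)))"
proof (rule exp_times_integrable[OF _ S])
  have c: "continuous_on {0..t} (\<lambda>s. Re (coeff k s))" "continuous_on {0..t} (\<lambda>s. Im (coeff k s))"
    using coeff_continuous[OF k] by (auto intro!: continuous_intros)
  have d: "integrable J (\<lambda>s. Re (cubic_coeff k s))" "integrable J (\<lambda>s. Im (cubic_coeff k s))"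
    using cubic_coeff_integrable[of k] by auto
  have "integrable J (\<lambda>s. Re (coeff k s) * Im (cubic_coeff k s) - Im (coeff k s) * Re (cubic_coeff k s))"
    by (intro Bochner_Integration.integrable_diff continuous_times_integrable c d)
  then show "integrable J (\<lambda>s. Im (cubic_coeff k s * cnj (coeff k s)))" by (simp add: mult.commute)
qed

lemma Im_fejer_nonlinearity:
  "exp (2 * \<alpha> * s) * Im (fejer_nonlinearity N (g s)) =
    (\<Sum>k=1..N. fejer N k * (exp (2 * \<alpha> * s) * Im (cubic_coeff k s * cnj (coeff k s))))"
proof -
  have "Im (of_real (fejer N k) * cubic_coeff k s * cnj (coeff k s)) = fejer N k * Im (cubic_coeff k s * cnj (coeff k s))" for k
    by (simp only: mult.assoc Im_complex_of_real Re_complex_of_real times_complex.simps mult_zero_left add_0_right)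
  then show ?thesis
    unfolding fejer_nonlinearity_coeff Im_sum by (simp only: sum_distrib_left mult.left_commute)
qed

lemma nonlinear_integral:
  assumes S: "S \<le> t"
  shows "set_integrable lborel {0..S} (\<lambda>s. exp (2 * \<alpha> * s) * Im (fejer_nonlinearity N (g s)))"
    and "(LINT s:{0..S}|lborel. exp (2 * \<alpha> * s) * Im (fejer_nonlinearity N (g s))) =
      (\<Sum>k=1..N. fejer N k * (LINT s:{0..S}|lborel. exp (2 * \<alpha> * s) * Im (cubic_coeff k s * cnj (coeff k s))))"
proof -
  have i: "integrable lborel (\<lambda>s. indicator {0..S} s *\<^sub>R (fejer N k * (exp (2 * \<alpha> * s) * Im (cubic_coeff k s * cnj (coeff k s)))))"
    if "k \<in> {1..N}" for k
    using set_integrable_mult_right[of "fejer N k", OF nonlinear_mode_integrable[OF _ S]] that by (auto simp: set_integrable_def)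
  show "set_integrable lborel {0..S} (\<lambda>s. exp (2 * \<alpha> * s) * Im (fejer_nonlinearity N (g s)))"
    unfolding set_integrable_def Im_fejer_nonlinearity scaleR_sum_right by (intro Bochner_Integration.integrable_sum i)
  show "(LINT s:{0..S}|lborel. exp (2 * \<alpha> * s) * Im (fejer_nonlinearity N (g s))) =
      (\<Sum>k=1..N. fejer N k * (LINT s:{0..S}|lborel. exp (2 * \<alpha> * s) * Im (cubic_coeff k s * cnj (coeff k s))))"
    unfolding set_lebesgue_integral_def Im_fejer_nonlinearity scaleR_sum_right
    by (subst Bochner_Integration.integral_sum[OF i])
       (auto simp only: set_lebesgue_integral_def[symmetric] set_integral_mult_right)
qed

text \<open>Only the sum of the real and the imaginary component simplifies: the Laplacian exchanges
  energy between the two. The noise counts twice, and 2 \<epsilon>^2 \<eta>_k divided by the rate 2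
  \<alpha> of the weight gives the factor in the last term.\<close>

lemma mode_energy:
  assumes k: "k \<ge> 1" and S: "0 \<le> S" "S \<le> t"
  shows "(\<Sum>i\<in>{1,2}. exp (2 * \<alpha> * S) * (component (k, i) S)\<^sup>2 - (component (k, i) 0)\<^sup>2 -
    (LINT s:{0..S}|lborel. exp (2 * \<alpha> * s) * (2 * component (k, i) s * part i (drift k s) + 2 * \<alpha> * (component (k, i) s)\<^sup>2 + (noise_strength \<epsilon> \<eta>s (k, i))\<^sup>2)))
    = exp (2 * \<alpha> * S) * (norm (coeff k S))\<^sup>2 - (norm (coeff k 0))\<^sup>2
      + 2 * lam * (LINT s:{0..S}|lborel. exp (2 * \<alpha> * s) * Im (cubic_coeff k s * cnj (coeff k s)))
      - \<epsilon>\<^sup>2 * \<eta>s k / \<alpha> * (exp (2 * \<alpha> * S) - 1)"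
proof -
  have sq: "(component (k, 1) s)\<^sup>2 + (component (k, 2) s)\<^sup>2 = (norm (coeff k s))\<^sup>2" for s
    by (simp add: component_eq part_def cmod_power2)
  have sg: "(noise_strength \<epsilon> \<eta>s (k, i))\<^sup>2 = \<epsilon>\<^sup>2 * \<eta>s k" for i
    using \<eta>s[OF k] by (simp add: noise_strength_def power_mult_distrib)
  \<comment> \<open>This is twice the real part of the drift times the conjugate of c. The multiple
    -i \<mu> contributes nothing, the damping -\<alpha> cancels against the growth of the weight,
    and the cubic term leaves an imaginary part.\<close>
  have alg: "2 * Re c * Re (\<i> * (- of_real \<mu> * c + \<i> * of_real \<alpha> * c + of_real lam * d)) +
      2 * Im c * Im (\<i> * (- of_real \<mu> * c + \<i> * of_real \<alpha> * c + of_real lam * d)) + 2 * \<alpha> * (norm c)\<^sup>2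
      = - 2 * lam * Im (d * cnj c)" for c d :: complex and \<mu> :: real
    unfolding cmod_power2 by (simp add: algebra_simps power2_eq_square)
  define f where "f i s = exp (2 * \<alpha> * s) * (2 * component (k, i) s * part i (drift k s) + 2 * \<alpha> * (component (k, i) s)\<^sup>2 + (noise_strength \<epsilon> \<eta>s (k, i))\<^sup>2)" for i s
  have cc: "continuous_on {0..t} (component (k, i))" for i
    unfolding component_eq[abs_def] fst_conv snd_conv
    by (rule bounded_linear.continuous_on[OF part_bounded_linear coeff_continuous[OF k]])
  have f_int: "set_integrable lborel {0..S} (f i)" for i
    unfolding f_def
  proof (rule exp_times_integrable[OF _ S(2)])
    have 1: "integrable J (\<lambda>s. 2 * (component (k, i) s * part i (drift k s)))"
      by (intro integrable_mult_right continuous_times_integrable cc integrable_bounded_linear[OF part_bounded_linear drift_integrable[OF k]])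
    have 2: "integrable J (\<lambda>s. 2 * \<alpha> * (component (k, i) s)\<^sup>2 + (noise_strength \<epsilon> \<eta>s (k, i))\<^sup>2)"
      unfolding integrable_interval_measure_on_iff
      by (intro borel_integrable_atLeastAtMost' continuous_intros cc)
    from Bochner_Integration.integrable_add[OF 1 2]
    show "integrable J (\<lambda>s. 2 * component (k, i) s * part i (drift k s) + 2 * \<alpha> * (component (k, i) s)\<^sup>2 + (noise_strength \<epsilon> \<eta>s (k, i))\<^sup>2)"
      by (simp add: mult.assoc add.assoc)
  qed
  have e_int: "set_integrable lborel {0..S} (\<lambda>s. 2 * \<alpha> * exp (2 * \<alpha> * s))"
    by (intro borel_integrable_atLeastAtMost' continuous_intros)
  \<comment> \<open>The form is prepared for \<open>set_integral_affine\<close>, whose constant is 0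
    here; the factor 2 \<alpha> stays with the exponential so that \<open>set_integral_exp\<close>
    integrates it.\<close>
  have f_sum: "f 1 s + f 2 s = (- 2 * lam) * (exp (2 * \<alpha> * s) * Im (cubic_coeff k s * cnj (coeff k s)))
      + (\<epsilon>\<^sup>2 * \<eta>s k / \<alpha>) * (2 * \<alpha> * exp (2 * \<alpha> * s)) + 0" for s
  proof -
    have "f 1 s + f 2 s = exp (2 * \<alpha> * s) * ((2 * Re (coeff k s) * Re (drift k s) + 2 * Im (coeff k s) * Im (drift k s)
        + 2 * \<alpha> * (norm (coeff k s))\<^sup>2) + 2 * (\<epsilon>\<^sup>2 * \<eta>s k))"
      unfolding f_def sg sq[symmetric] by (simp add: component_eq part_def algebra_simps)
    also have "\<dots> = exp (2 * \<alpha> * s) * (- 2 * lam * Im (cubic_coeff k s * cnj (coeff k s)) + 2 * (\<epsilon>\<^sup>2 * \<eta>s k))"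
      unfolding drift_def alg ..
    finally show ?thesis using \<alpha> by (simp add: algebra_simps)
  qed
  have "(LINT s:{0..S}|lborel. f 1 s) + (LINT s:{0..S}|lborel. f 2 s) = (LINT s:{0..S}|lborel. f 1 s + f 2 s)"
    by (rule set_integral_add(2)[OF f_int f_int, symmetric])
  also have "\<dots> = (- 2 * lam) * (LINT s:{0..S}|lborel. exp (2 * \<alpha> * s) * Im (cubic_coeff k s * cnj (coeff k s)))
      + (\<epsilon>\<^sup>2 * \<eta>s k / \<alpha>) * (LINT s:{0..S}|lborel. 2 * \<alpha> * exp (2 * \<alpha> * s)) + (LINT s:{0..S}|lborel. 0)"
    unfolding f_sum
    by (rule set_integral_affine[OF nonlinear_mode_integrable[OF k S(2)] e_int]) (simp add: set_integrable_def)
  also have "(LINT s:{0..S}|lborel. 2 * \<alpha> * exp (2 * \<alpha> * s)) = exp (2 * \<alpha> * S) - 1"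
    by (rule set_integral_exp[OF S(1)])
  finally have F: "(LINT s:{0..S}|lborel. f 1 s) + (LINT s:{0..S}|lborel. f 2 s) =
      (- 2 * lam) * (LINT s:{0..S}|lborel. exp (2 * \<alpha> * s) * Im (cubic_coeff k s * cnj (coeff k s)))
      + \<epsilon>\<^sup>2 * \<eta>s k / \<alpha> * (exp (2 * \<alpha> * S) - 1)" by simp
  have "(\<Sum>i\<in>{1,2}. exp (2 * \<alpha> * S) * (component (k, i) S)\<^sup>2 - (component (k, i) 0)\<^sup>2 - (LINT s:{0..S}|lborel. f i s)) =
      exp (2 * \<alpha> * S) * ((component (k, 1) S)\<^sup>2 + (component (k, 2) S)\<^sup>2) - ((component (k, 1) 0)\<^sup>2 + (component (k, 2) 0)\<^sup>2)
      - ((LINT s:{0..S}|lborel. f 1 s) + (LINT s:{0..S}|lborel. f 2 s))"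
    by (simp add: algebra_simps)
  also have "\<dots> = exp (2 * \<alpha> * S) * (norm (coeff k S))\<^sup>2 - (norm (coeff k 0))\<^sup>2
      + 2 * lam * (LINT s:{0..S}|lborel. exp (2 * \<alpha> * s) * Im (cubic_coeff k s * cnj (coeff k s)))
      - \<epsilon>\<^sup>2 * \<eta>s k / \<alpha> * (exp (2 * \<alpha> * S) - 1)"
    unfolding sq F by simp
  finally show ?thesis unfolding f_def .
qed

text \<open>The mesh shrinks while \<open>N\<close> is fixed, so only finitely many modes are
  involved and their limits may be added.\<close>

lemma fejer_energy_limit:
  assumes S: "0 \<le> S" "S \<le> t"
    and \<theta>1: "\<And>s. 0 \<le> s \<Longrightarrow> s < S \<Longrightarrow> \<theta> s" and \<theta>2: "\<And>s. S < s \<Longrightarrow> s \<le> t \<Longrightarrow> \<not> \<theta> s"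
  shows "(\<lambda>n. \<Sum>j<n. \<Sum>m\<in>modes N. fejer N (fst m) * martingale_term \<alpha> (noise_strength \<epsilon> \<eta>s m) \<theta> (component m) (B (fst m) (snd m)) t n j)
    \<longlonglongrightarrow> fejer_energy N S"
proof -
  define L where "L m = exp (2 * \<alpha> * S) * (component m S)\<^sup>2 - (component m 0)\<^sup>2 -
    (LINT s:{0..S}|lborel. exp (2 * \<alpha> * s) * (2 * component m s * part (snd m) (drift (fst m) s) + 2 * \<alpha> * (component m s)\<^sup>2 + (noise_strength \<epsilon> \<eta>s m)\<^sup>2))" for m
  have "(\<lambda>n. \<Sum>m\<in>modes N. fejer N (fst m) * (\<Sum>j<n. martingale_term \<alpha> (noise_strength \<epsilon> \<eta>s m) \<theta> (component m) (B (fst m) (snd m)) t n j))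
      \<longlonglongrightarrow> (\<Sum>m\<in>modes N. fejer N (fst m) * L m)"
    unfolding L_def
    by (intro tendsto_sum tendsto_mult tendsto_const component_energy S \<theta>1 \<theta>2) (auto simp: modes_def)
  also have "(\<Sum>m\<in>modes N. fejer N (fst m) * L m) = (\<Sum>k=1..N. fejer N k * (\<Sum>i\<in>{1,2}. L (k, i)))"
    unfolding sum_modes by (simp add: distrib_left)
  also have "\<dots> = (\<Sum>k=1..N. fejer N k * (exp (2 * \<alpha> * S) * (norm (coeff k S))\<^sup>2 - (norm (coeff k 0))\<^sup>2
      + 2 * lam * (LINT s:{0..S}|lborel. exp (2 * \<alpha> * s) * Im (cubic_coeff k s * cnj (coeff k s)))
      - \<epsilon>\<^sup>2 * \<eta>s k / \<alpha> * (exp (2 * \<alpha> * S) - 1)))"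
    by (intro sum.cong refl arg_cong2[where f="(*)"], unfold L_def fst_conv snd_conv, rule mode_energy[OF _ S]) simp
  also have "\<dots> = exp (2 * \<alpha> * S) * (\<Sum>k=1..N. fejer N k * (norm (coeff k S))\<^sup>2)
    - (\<Sum>k=1..N. fejer N k * (norm (coeff k 0))\<^sup>2)
    + 2 * lam * (\<Sum>k=1..N. fejer N k * (LINT s:{0..S}|lborel. exp (2 * \<alpha> * s) * Im (cubic_coeff k s * cnj (coeff k s))))
    - \<epsilon>\<^sup>2 * (\<Sum>k=1..N. fejer N k * \<eta>s k) / \<alpha> * (exp (2 * \<alpha> * S) - 1)"
    by (simp add: algebra_simps sum.distrib sum_subtractf sum_distrib_left sum_distrib_right sum_divide_distrib)
  also have "(\<Sum>k=1..N. fejer N k * (LINT s:{0..S}|lborel. exp (2 * \<alpha> * s) * Im (cubic_coeff k s * cnj (coeff k s)))) =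
      (LINT s:{0..S}|lborel. exp (2 * \<alpha> * s) * Im (fejer_nonlinearity N (g s)))"
    by (rule nonlinear_integral(2)[OF S(2), symmetric])
  finally show ?thesis
    unfolding fejer_energy_def by (simp add: sum.swap[of _ "modes N"] sum_distrib_left)
qed

lemma fejer_energy_tendsto:
  assumes S: "0 \<le> S" "S \<le> t"
  shows "(\<lambda>N. fejer_energy N S) \<longlonglongrightarrow>
    exp (2 * \<alpha> * S) * (l2norm (g S))\<^sup>2 - (l2norm (g 0))\<^sup>2 - \<epsilon>\<^sup>2 * \<eta> / \<alpha> * (exp (2 * \<alpha> * S) - 1)"
proof -
  have P: "(\<lambda>N. \<Sum>k=1..N. fejer N k * (norm (coeff k s))\<^sup>2) \<longlonglongrightarrow> (l2norm (g s))\<^sup>2" if "0 \<le> s" for s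
    using Parseval_sine_basis[OF g_L2[OF that]] by (intro fejer_sum_tendsto) (auto simp: coeff_def)
  have E: "(\<lambda>N. \<Sum>k=1..N. fejer N k * \<eta>s k) \<longlonglongrightarrow> \<eta>" by (intro fejer_sum_tendsto \<eta>s \<eta>)
  have "(\<lambda>N. LINT s:{0..S}|lborel. exp (2 * \<alpha> * s) * Im (fejer_nonlinearity N (g s))) \<longlonglongrightarrow> (\<integral>s. 0 \<partial>(lborel :: real measure))"
    unfolding set_lebesgue_integral_def
  proof (rule integral_dominated_convergence)
    \<comment> \<open>The majorant is the kernel bound \<open>norm_fejer_nonlinearity_le\<close>
      times the largest weight; it does not depend on \<open>N\<close>.\<close>
    let ?w = "\<lambda>s. indicator {0..t} s *\<^sub>R (exp (2 * \<alpha> * t) * (2 * (\<integral>x. norm (g s x) ^ 4 \<partial>I01)))"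
    have "integrable J (\<lambda>s. exp (2 * \<alpha> * t) * (2 * (\<integral>x. norm (g s x) ^ 4 \<partial>I01)))"
      using pow4_integrable by simp
    then show "integrable lborel ?w"
      unfolding integrable_interval_measure_on_iff set_integrable_def .
    show "(\<lambda>s. indicator {0..S} s *\<^sub>R (exp (2 * \<alpha> * s) * Im (fejer_nonlinearity N (g s)))) \<in> borel_measurable lborel" for N
      using nonlinear_integral(1)[OF S(2), of N] unfolding set_integrable_def by (rule borel_measurable_integrable)
    have ae: "AE s in lborel. s \<in> {0..t} \<longrightarrow> g s \<in> Lp 4 I01"
      using AE_Lp4 unfolding AE_interval_measure_on .
    then show "AE s in lborel. (\<lambda>N. indicator {0..S} s *\<^sub>R (exp (2 * \<alpha> * s) * Im (fejer_nonlinearity N (g s)))) \<longlonglongrightarrow> 0"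
    proof eventually_elim
      case (elim s)
      show ?case
      proof (cases "s \<in> {0..S}")
        case True
        then have "(\<lambda>N. Im (fejer_nonlinearity N (g s))) \<longlonglongrightarrow> 0"
          using elim S by (intro fejer_nonlinearity_Im_tendsto) auto
        from tendsto_mult[OF tendsto_const this, of "exp (2 * \<alpha> * s)"] True show ?thesis by simp
      qed simp
    qed
    show "AE s in lborel. norm (indicator {0..S} s *\<^sub>R (exp (2 * \<alpha> * s) * Im (fejer_nonlinearity N (g s)))) \<le> ?w s" for N
      using ae
    proof eventually_elim
      case (elim s)
      show ?case
      proof (cases "s \<in> {0..S}")
        case True
        with elim S have f: "g s \<in> Lp 4 I01" by auto
        have "exp (2 * \<alpha> * s) * \<bar>Im (fejer_nonlinearity N (g s))\<bar> \<le> exp (2 * \<alpha> * t) * (2 * (\<integral>x. norm (g s x) ^ 4 \<partial>I01))"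
          using True S \<alpha> order_trans[OF abs_Im_le_cmod norm_fejer_nonlinearity_le[OF f]] by (intro mult_mono) auto
        with True S show ?thesis by (simp add: abs_mult)
      qed (auto simp: indicator_def)
    qed
  qed simp
  then have nl: "(\<lambda>N. LINT s:{0..S}|lborel. exp (2 * \<alpha> * s) * Im (fejer_nonlinearity N (g s))) \<longlonglongrightarrow> 0" by simp
  have "(\<lambda>N. fejer_energy N S) \<longlonglongrightarrow> exp (2 * \<alpha> * S) * (l2norm (g S))\<^sup>2 - (l2norm (g 0))\<^sup>2 + 2 * lam * 0
      - \<epsilon>\<^sup>2 * \<eta> / \<alpha> * (exp (2 * \<alpha> * S) - 1)"
    unfolding fejer_energy_def using \<alpha>
    by (intro tendsto_add tendsto_diff tendsto_mult tendsto_divide tendsto_const P E S(1) nl) auto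
  then show ?thesis by simp
qed

end

section \<open>The mean energy identity\<close>

text \<open>The bound on [0,s] is tested only at rational fractions of s: countably many conditions,
  all known at time s, so that the activity condition is adapted while the supremum S need not be
  measurable. By continuity they are equivalent to the full bound. Keeping 0 in the set covers paths
  that start above R; then S = 0.\<close>

lemma exit_time:
  fixes f :: "real \<Rightarrow> real" and R t :: real
  assumes t: "0 < t" and f: "continuous_on {0..t} f"
  defines "S \<equiv> Sup {r \<in> {0..t}. r = 0 \<or> (\<forall>u\<in>{0..r}. f u \<le> R)}"
  shows "0 \<le> S" "S \<le> t"
    and "\<And>s. 0 \<le> s \<Longrightarrow> s < S \<Longrightarrow> \<forall>q\<in>\<rat> \<inter> {0..1}. f (q * s) \<le> R"
    and "\<And>s. S < s \<Longrightarrow> s \<le> t \<Longrightarrow> \<not> (\<forall>q\<in>\<rat> \<inter> {0..1}. f (q * s) \<le> R)"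
    and "(\<forall>u\<in>{0..t}. f u \<le> R) \<Longrightarrow> S = t"
proof -
  let ?A = "{r \<in> {0..t}. r = 0 \<or> (\<forall>u\<in>{0..r}. f u \<le> R)}"
  have A: "0 \<in> ?A" "bdd_above ?A" using t by (auto intro: bdd_aboveI[of _ t])
  show S0: "0 \<le> S" unfolding S_def by (rule cSup_upper[OF A])
  show "S \<le> t" unfolding S_def using A(1) by (intro cSup_least) auto
  show "\<forall>q\<in>\<rat> \<inter> {0..1}. f (q * s) \<le> R" if s: "0 \<le> s" "s < S" for s
  proof -
    obtain r where r: "r \<in> ?A" "s < r" using less_cSupE[OF s(2)[unfolded S_def]] A(1) by blast
    have "q * s \<in> {0..r}" if "q \<in> {0..1}" for q
      using that s r mult_left_le_one_le[of s q] by auto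
    then show ?thesis using r s by auto
  qed
  show "\<not> (\<forall>q\<in>\<rat> \<inter> {0..1}. f (q * s) \<le> R)" if s: "S < s" "s \<le> t" for s
  proof
    assume q: "\<forall>q\<in>\<rat> \<inter> {0..1}. f (q * s) \<le> R"
    have s0: "s > 0" using S0 s by simp
    have "f u \<le> R" if u: "u \<in> {0..s}" for u
    proof -
      define v where "v = u / s"
      have v: "0 \<le> v" "v \<le> 1" "v * s = u" using u s0 by (auto simp: v_def)
      \<comment> \<open>Rounding down with denominator n + 1 gives rational fractions converging to
        v from below, so the points \<open>a n * s\<close> do not leave the interval.\<close>
      define a where "a n = real_of_int \<lfloor>real (Suc n) * v\<rfloor> / real (Suc n)" for n
      have a: "a n \<in> \<rat> \<inter> {0..1}" "v - 1 / real (Suc n) \<le> a n" "a n \<le> v" for n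
      proof -
        have "real (Suc n) * v \<le> real (Suc n)" using v by (simp add: mult_left_le)
        then have fl: "0 \<le> real_of_int \<lfloor>real (Suc n) * v\<rfloor>" "real_of_int \<lfloor>real (Suc n) * v\<rfloor> \<le> real (Suc n)"
          using v of_int_floor_le[of "real (Suc n) * v"] by (simp, linarith)
        have "a n \<in> \<rat>" unfolding a_def by (intro Rats_divide Rats_of_int Rats_of_nat)
        then show "a n \<in> \<rat> \<inter> {0..1}" using fl by (simp add: a_def divide_le_eq)
        show "a n \<le> v" unfolding a_def by (subst pos_divide_le_eq) (auto simp: mult.commute)
        have "real (Suc n) * v - 1 \<le> real_of_int \<lfloor>real (Suc n) * v\<rfloor>" by linarith
        then have "(real (Suc n) * v - 1) / real (Suc n) \<le> a n" unfolding a_def by (intro divide_right_mono) auto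
        then show "v - 1 / real (Suc n) \<le> a n" by (simp add: diff_divide_distrib del: of_nat_Suc)
      qed
      have low: "(\<lambda>n. v - 1 / real (Suc n)) \<longlonglongrightarrow> v"
        using tendsto_diff[OF tendsto_const LIMSEQ_Suc[OF lim_1_over_n], of v] by simp
      have "a \<longlonglongrightarrow> v"
        by (rule tendsto_sandwich[OF always_eventually always_eventually low tendsto_const]) (simp_all only: a simp_thms)
      then have "(\<lambda>n. a n * s) \<longlonglongrightarrow> u" using tendsto_mult_right[of a v sequentially s] v(3) by simp
      then have "(\<lambda>n. f (a n * s)) \<longlonglongrightarrow> f u"
      proof (rule continuous_on_tendsto_compose[OF f])
        show "u \<in> {0..t}" using u s by auto
        have "a n * s \<in> {0..t}" for n
        proof -
          have "0 \<le> a n" "a n \<le> 1" using a(1)[of n] by auto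
          then have "a n * s \<le> s" "0 \<le> a n * s" using s0 by (auto intro: mult_left_le_one_le)
          with s show ?thesis by simp
        qed
        then show "\<forall>\<^sub>F n in sequentially. a n * s \<in> {0..t}" by simp
      qed
      then show ?thesis by (rule LIMSEQ_le_const2) (use q a(1) in auto)
    qed
    then have "s \<in> ?A" using s s0 by auto
    then have "s \<le> S" unfolding S_def by (rule cSup_upper[OF _ A(2)])
    with s show False by simp
  qed
  show "S = t" if "\<forall>u\<in>{0..t}. f u \<le> R"
  proof (rule antisym[OF \<open>S \<le> t\<close>])
    have "t \<in> ?A" using that t by auto
    then show "t \<le> S" unfolding S_def by (rule cSup_upper[OF _ A(2)])
  qed
qed

locale nls_setting = filtered_prob_space M F
  for M :: "'w measure" and F :: "real \<Rightarrow> 'w measure" +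
  fixes \<beta> :: "nat \<Rightarrow> nat \<Rightarrow> real \<Rightarrow> 'w \<Rightarrow> real"
    and Q :: "(real \<Rightarrow> complex) \<Rightarrow> real \<Rightarrow> complex"
    and QW \<psi> :: "real \<Rightarrow> 'w \<Rightarrow> real \<Rightarrow> complex"
    and \<psi>\<^sub>0 :: "'w \<Rightarrow> real \<Rightarrow> complex"
    and \<eta>s :: "nat \<Rightarrow> real" and \<eta> \<alpha> \<epsilon> lam :: real
  assumes family: "brownian_family M F \<beta>"
    and Q_L2: "\<And>f. f \<in> L2 \<Longrightarrow> Q f \<in> L2"
    and \<eta>s: "\<And>k. k \<ge> 1 \<Longrightarrow> \<eta>s k \<ge> 0"
    and Q_eigen: "\<And>k. k \<ge> 1 \<Longrightarrow> AE x in I01. Q (sine_basis k) x = of_real (sqrt (\<eta>s k)) * sine_basis k x"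
    and \<eta>: "(\<lambda>k. \<eta>s (Suc k)) sums \<eta>"
    and noise: "Q_wiener_process M F \<beta> Q QW"
    and \<alpha>: "\<alpha> > 0"
    and \<psi>\<^sub>0_meas: "l2_measurable (F 0) \<psi>\<^sub>0"
    and \<psi>\<^sub>0_int: "integrable M (\<lambda>\<omega>. (l2norm (\<psi>\<^sub>0 \<omega>))\<^sup>2)"
    and solution: "nls_solution M F QW \<alpha> \<epsilon> lam \<psi>\<^sub>0 \<psi>"
begin

lemma brownian: "k \<ge> 1 \<Longrightarrow> i \<in> {1, 2} \<Longrightarrow> brownian_motion M F (\<beta> k i)"
  using family by (auto simp: brownian_family_def)

lemma \<psi>_measurable: "0 \<le> s \<Longrightarrow> l2_measurable (F s) (\<psi> s)"
  using solution by (simp add: nls_solution_def)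

lemma \<psi>_L2: "0 \<le> s \<Longrightarrow> \<omega> \<in> space M \<Longrightarrow> \<psi> s \<omega> \<in> L2"
  using \<psi>_measurable[of s] space_F[of s] by (simp add: l2_measurable_def)

lemma \<psi>\<^sub>0_L2: "\<omega> \<in> space M \<Longrightarrow> \<psi>\<^sub>0 \<omega> \<in> L2"
  using \<psi>\<^sub>0_meas space_F[of 0] by (simp add: l2_measurable_def)

lemma l2norm_\<psi>_measurable: "0 \<le> s \<Longrightarrow> (\<lambda>\<omega>. l2norm (\<psi> s \<omega>)) \<in> borel_measurable (F s)"
  by (rule l2norm_measurable[OF \<psi>_measurable])

text \<open>From n = k on, the k-th coefficient of the partial sums of the noise no longer changes.
  Its distance to the coefficient of \<open>QW\<close> is at most the \<open>L2\<close> error of the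
  partial sum, whose mean square tends to 0, so the two coefficients agree almost surely.\<close>

lemma noise_coefficient:
  assumes s: "0 \<le> s" and k: "k \<ge> 1"
  shows "AE \<omega> in M. l2inner (QW s \<omega>) (sine_basis k) = of_real (sqrt (\<eta>s k)) * Complex (\<beta> k 1 s \<omega>) (\<beta> k 2 s \<omega>)"
proof -
  let ?b = "\<lambda>j \<omega>. Complex (\<beta> j 1 s \<omega>) (\<beta> j 2 s \<omega>)"
  define d where "d \<omega> = l2inner (QW s \<omega>) (sine_basis k) - of_real (sqrt (\<eta>s k)) * ?b k \<omega>" for \<omega>
  have QWm: "l2_measurable (F s) (QW s)" using noise s by (simp add: Q_wiener_process_def)
  have QWL: "QW s \<omega> \<in> L2" if "\<omega> \<in> space M" for \<omega>
    using QWm space_F[OF s] that by (simp add: l2_measurable_def)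
  have lim: "(\<lambda>n. \<integral>\<^sup>+\<omega>. ennreal ((l2norm (\<lambda>x. QW s \<omega> x - (\<Sum>j=1..n. ?b j \<omega> * Q (sine_basis j) x)))\<^sup>2) \<partial>M) \<longlonglongrightarrow> 0"
    using noise s by (simp add: Q_wiener_process_def)
  have QeL: "Q (sine_basis j) \<in> L2" for j by (rule Q_L2[OF sine_basis_L2])
  have Qe: "l2inner (Q (sine_basis j)) (sine_basis k) = of_real (sqrt (\<eta>s k)) * of_bool (j = k)" if "j \<ge> 1" for j
  proof -
    have "l2inner (Q (sine_basis j)) (sine_basis k) = l2inner (\<lambda>x. of_real (sqrt (\<eta>s j)) * sine_basis j x) (sine_basis k)"
      by (rule l2inner_cong_AE[OF QeL L2_cmult[OF sine_basis_L2] sine_basis_L2 Q_eigen[OF that]])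
    then show ?thesis by (simp add: l2inner_cmult_left sine_basis_orthonormal[OF that k])
  qed
  have d_le: "(norm (d \<omega>))\<^sup>2 \<le> (l2norm (\<lambda>x. QW s \<omega> x - (\<Sum>j=1..n. ?b j \<omega> * Q (sine_basis j) x)))\<^sup>2"
    if \<omega>: "\<omega> \<in> space M" and n: "n \<ge> k" for \<omega> n
  proof -
    let ?r = "\<lambda>x. QW s \<omega> x - (\<Sum>j=1..n. ?b j \<omega> * Q (sine_basis j) x)"
    have sL: "(\<lambda>x. \<Sum>j=1..n. ?b j \<omega> * Q (sine_basis j) x) \<in> L2"
      by (intro L2_sum L2_cmult QeL)
    have rL: "?r \<in> L2" by (rule L2_diff[OF QWL[OF \<omega>] sL])
    have "l2inner (\<lambda>x. \<Sum>j=1..n. ?b j \<omega> * Q (sine_basis j) x) (sine_basis k) = (\<Sum>j=1..n. ?b j \<omega> * l2inner (Q (sine_basis j)) (sine_basis k))"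
      by (subst l2inner_sum_left) (auto intro: L2_cmult QeL sine_basis_L2 simp: l2inner_cmult_left)
    also have "\<dots> = (\<Sum>j=1..n. if j = k then of_real (sqrt (\<eta>s k)) * ?b k \<omega> else 0)"
      by (intro sum.cong refl) (auto simp: Qe)
    also have "\<dots> = of_real (sqrt (\<eta>s k)) * ?b k \<omega>" using k n by simp
    finally have inner: "l2inner (\<lambda>x. \<Sum>j=1..n. ?b j \<omega> * Q (sine_basis j) x) (sine_basis k) = of_real (sqrt (\<eta>s k)) * ?b k \<omega>" .
    have "l2inner ?r (sine_basis k) = d \<omega>"
      unfolding l2inner_diff_left[OF QWL[OF \<omega>] sL sine_basis_L2] d_def inner ..
    then have "norm (d \<omega>) \<le> l2norm ?r" using norm_l2inner_sine_basis_le[OF rL k] by simp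
    then show ?thesis by (intro power_mono) auto
  qed
  have "(\<integral>\<^sup>+\<omega>. ennreal ((norm (d \<omega>))\<^sup>2) \<partial>M) \<le> 0"
  proof (rule LIMSEQ_le_const[OF lim], intro exI[of _ k] allI impI)
    fix n assume "n \<ge> k"
    then show "(\<integral>\<^sup>+\<omega>. ennreal ((norm (d \<omega>))\<^sup>2) \<partial>M) \<le>
        (\<integral>\<^sup>+\<omega>. ennreal ((l2norm (\<lambda>x. QW s \<omega> x - (\<Sum>j=1..n. ?b j \<omega> * Q (sine_basis j) x)))\<^sup>2) \<partial>M)"
      by (intro nn_integral_mono ennreal_leI d_le)
  qed
  then have 0: "(\<integral>\<^sup>+\<omega>. ennreal ((norm (d \<omega>))\<^sup>2) \<partial>M) = 0" by simp
  have [measurable]: "(\<lambda>\<omega>. l2inner (QW s \<omega>) (sine_basis k)) \<in> borel_measurable M"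
    by (rule measurable_F_M[OF s l2inner_measurable[OF QWm sine_basis_L2]])
  have [measurable]: "\<beta> k i s \<in> borel_measurable M" if "i \<in> {1, 2}" for i
    using brownian[OF k that] s by (intro measurable_F_M[OF s]) (simp add: brownian_motion_def)
  have "(\<lambda>\<omega>. ?b k \<omega>) \<in> borel_measurable M"
    by (simp add: borel_measurable_complex_iff)
  then have [measurable]: "d \<in> borel_measurable M" unfolding d_def[abs_def] by measurable
  have "AE \<omega> in M. ennreal ((norm (d \<omega>))\<^sup>2) = 0"
    using 0 by (subst (asm) nn_integral_0_iff_AE) auto
  then show ?thesis by eventually_elim (simp add: d_def)
qed

text \<open>The weak equation and the identification of the noise each hold outside a null set that
  depends on the mode and on the time. Only countably many triples of mode, mesh and grid index
  occur, so a single null set suffices.\<close>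

lemma AE_nls_path:
  assumes t: "t > 0"
  shows "AE \<omega> in M. nls_path (\<lambda>s. \<psi> s \<omega>) (\<lambda>k i s. \<beta> k i s \<omega>) (\<lambda>k. l2inner (\<psi>\<^sub>0 \<omega>) (sine_basis k)) \<eta>s \<eta> \<alpha> \<epsilon> lam t"
proof -
  have 1: "AE \<omega> in M. \<forall>t\<ge>0. ((\<lambda>s. l2norm (\<lambda>x. \<psi> s \<omega> x - \<psi> t \<omega> x)) \<longlongrightarrow> 0) (at t within {0..})"
    and 2: "AE \<omega> in M. \<forall>T>0. (\<lambda>(t, x). \<psi> t \<omega> x) \<in> Lp 4 (interval_measure_on 0 T \<Otimes>\<^sub>M I01)"
    using solution by (auto simp: nls_solution_def)
  have 3: "AE \<omega> in M. \<forall>k i. k \<ge> 1 \<and> i \<in> {1, 2} \<longrightarrow> continuous_on {0..t} (\<lambda>s. \<beta> k i s \<omega>)"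
    unfolding AE_all_countable
  proof (intro allI)
    fix k i :: nat
    show "AE \<omega> in M. k \<ge> 1 \<and> i \<in> {1, 2} \<longrightarrow> continuous_on {0..t} (\<lambda>s. \<beta> k i s \<omega>)"
    proof (cases "k \<ge> 1 \<and> i \<in> {1, 2}")
      case True
      then have "AE \<omega> in M. continuous_on {0..} (\<lambda>s. \<beta> k i s \<omega>)"
        using brownian[of k i] by (simp add: brownian_motion_def)
      then show ?thesis by eventually_elim (auto intro: continuous_on_subset)
    qed (rule AE_I2, blast)
  qed
  have 4: "AE \<omega> in M. \<forall>k n j. k \<ge> 1 \<and> 0 < n \<and> j \<le> n \<longrightarrow>
      l2inner (\<psi> (grid t n j) \<omega>) (sine_basis k) = l2inner (\<psi>\<^sub>0 \<omega>) (sine_basis k) +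
        (\<integral>s. \<i> * (- of_real ((real k * pi)\<^sup>2) * l2inner (\<psi> s \<omega>) (sine_basis k) + \<i> * of_real \<alpha> * l2inner (\<psi> s \<omega>) (sine_basis k) +
          of_real lam * l2inner (cubic (\<psi> s \<omega>)) (sine_basis k)) \<partial>interval_measure_on 0 (grid t n j))
        + of_real (\<epsilon> * sqrt (\<eta>s k)) * Complex (\<beta> k 1 (grid t n j) \<omega>) (\<beta> k 2 (grid t n j) \<omega>)"
    unfolding AE_all_countable
  proof (intro allI)
    fix k n j :: nat
    show "AE \<omega> in M. k \<ge> 1 \<and> 0 < n \<and> j \<le> n \<longrightarrow>
      l2inner (\<psi> (grid t n j) \<omega>) (sine_basis k) = l2inner (\<psi>\<^sub>0 \<omega>) (sine_basis k) +
        (\<integral>s. \<i> * (- of_real ((real k * pi)\<^sup>2) * l2inner (\<psi> s \<omega>) (sine_basis k) + \<i> * of_real \<alpha> * l2inner (\<psi> s \<omega>) (sine_basis k) +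
          of_real lam * l2inner (cubic (\<psi> s \<omega>)) (sine_basis k)) \<partial>interval_measure_on 0 (grid t n j))
        + of_real (\<epsilon> * sqrt (\<eta>s k)) * Complex (\<beta> k 1 (grid t n j) \<omega>) (\<beta> k 2 (grid t n j) \<omega>)"
    proof (cases "k \<ge> 1 \<and> 0 < n \<and> j \<le> n")
      case True
      let ?s = "grid t n j" and ?e = "sine_basis k"
      have s: "0 \<le> ?s" using grid_bounds[OF t, of n j] True by auto
      have k: "k \<ge> 1" using True by simp
      have "\<forall>\<phi> \<Delta>\<phi>. dirichlet_laplacian \<phi> \<Delta>\<phi> \<longrightarrow> (\<forall>t\<ge>0. AE \<omega> in M.
        l2inner (\<psi> t \<omega>) \<phi> = l2inner (\<psi>\<^sub>0 \<omega>) \<phi> +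
          (\<integral>s. \<i> * (l2inner (\<psi> s \<omega>) \<Delta>\<phi> + \<i> * of_real \<alpha> * l2inner (\<psi> s \<omega>) \<phi> +
                 of_real lam * l2inner (\<lambda>x. of_real ((norm (\<psi> s \<omega> x))\<^sup>2) * \<psi> s \<omega> x) \<phi>)
             \<partial>interval_measure_on 0 t) +
          of_real \<epsilon> * l2inner (QW t \<omega>) \<phi>)"
        using solution unfolding nls_solution_def by blast
      from this[rule_format, OF dirichlet_laplacian_sine_basis s, of k] noise_coefficient[OF s k]
      show ?thesis
      proof eventually_elim
        case (elim \<omega>)
        have c: "l2inner f (\<lambda>x. - of_real ((real k * pi)\<^sup>2) * ?e x) = - of_real ((real k * pi)\<^sup>2) * l2inner f ?e" for f
          unfolding l2inner_cmult_right by simp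
        show ?case
          using elim(1) elim(2) True unfolding c cubic_def[abs_def] by (simp add: mult.assoc)
      qed
    qed (rule AE_I2, blast)
  qed
  from 1 2 3 4 AE_space[of M] show ?thesis
  proof eventually_elim
    case (elim \<omega>)
    show ?case
    proof
      show "\<psi> s \<omega> \<in> L2" if "0 \<le> s" for s using that elim(5) by (rule \<psi>_L2)
      show "((\<lambda>r. l2norm (\<lambda>x. \<psi> r \<omega> x - \<psi> s \<omega> x)) \<longlongrightarrow> 0) (at s within {0..})" if "0 \<le> s" for s
        using elim(1) that by blast
      show "(\<lambda>(s, x). \<psi> s \<omega> x) \<in> Lp 4 (interval_measure_on 0 t \<Otimes>\<^sub>M I01)" using elim(2) t by blast
    qed (use t \<alpha> \<eta>s \<eta> elim(3,4) in blast)+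
  qed
qed

lemma AE_initial: "AE \<omega> in M. l2norm (\<psi> 0 \<omega>) = l2norm (\<psi>\<^sub>0 \<omega>)"
proof -
  have "AE \<omega> in M. AE x in I01. \<psi> 0 \<omega> x = \<psi>\<^sub>0 \<omega> x" using solution by (simp add: nls_solution_def)
  then show ?thesis using AE_space
  proof eventually_elim
    case (elim \<omega>)
    then show ?case by (intro l2norm_cong_AE \<psi>_L2 \<psi>\<^sub>0_L2) auto
  qed
qed

section \<open>Stopped martingale sums and their limits\<close>

definition fejer_martingale :: "real \<Rightarrow> (real \<Rightarrow> 'w \<Rightarrow> bool) \<Rightarrow> nat \<Rightarrow> nat \<Rightarrow> 'w \<Rightarrow> real" where
  "fejer_martingale t \<theta> N n \<omega> = (\<Sum>j<n. \<Sum>m\<in>modes N. fejer N (fst m) *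
     martingale_term \<alpha> (noise_strength \<epsilon> \<eta>s m) (\<lambda>s. \<theta> s \<omega>) (\<lambda>s. path_component (\<lambda>s. \<psi> s \<omega>) m s) (\<lambda>s. \<beta> (fst m) (snd m) s \<omega>) t n j)"

text \<open>The bound depends neither on \<open>N\<close> nor on \<open>n\<close>: Bessel's
  inequality bounds the energy of the modes by the full norm, and \<open>V\<close> is the total
  variance rate, with two real Brownian motions for every mode.\<close>

lemma fejer_martingale_moments:
  assumes t: "0 < t" and n: "0 < n"
    and \<theta>: "\<And>s. 0 \<le> s \<Longrightarrow> s \<le> t \<Longrightarrow> Measurable.pred (F s) (\<theta> s)"
    and int: "\<And>s. 0 \<le> s \<Longrightarrow> s \<le> t \<Longrightarrow> integrable M (\<lambda>\<omega>. of_bool (\<theta> s \<omega>) * (l2norm (\<psi> s \<omega>))\<^sup>2)"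
    and C: "\<And>s. 0 \<le> s \<Longrightarrow> s \<le> t \<Longrightarrow> (\<integral>\<omega>. of_bool (\<theta> s \<omega>) * (l2norm (\<psi> s \<omega>))\<^sup>2 \<partial>M) \<le> C"
  defines "V \<equiv> 2 * \<epsilon>\<^sup>2 * \<eta>"
  shows "square_integrable M (fejer_martingale t \<theta> N n)" "(\<integral>\<omega>. fejer_martingale t \<theta> N n \<omega> \<partial>M) = 0"
    "(\<integral>\<omega>. (fejer_martingale t \<theta> N n \<omega>)\<^sup>2 \<partial>M) \<le> (exp (2 * \<bar>\<alpha>\<bar> * t))\<^sup>2 * (V * (8 * t * C + 4 * t\<^sup>2 * V))"
proof -
  let ?x = "\<lambda>m s \<omega>. path_component (\<lambda>s. \<psi> s \<omega>) m s"
  have fin: "finite (modes N)" by (simp add: modes_def)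
  have B: "brownian_motion M F (\<beta> (fst m) (snd m))" if "m \<in> modes N" for m
    using that by (auto simp: modes_def intro!: brownian)
  have pm: "part i \<in> borel_measurable borel" for i
    by (intro borel_measurable_continuous_onI linear_continuous_on part_bounded_linear)
  have x: "(\<lambda>\<omega>. ?x m s \<omega>) \<in> borel_measurable (F s)" if "0 \<le> s" for s m
    unfolding path_component_def
    by (rule measurable_compose[OF l2inner_measurable[OF \<psi>_measurable[OF that] sine_basis_L2] pm])
  have sum_le: "(\<Sum>m\<in>modes N. (?x m s \<omega>)\<^sup>2) \<le> (l2norm (\<psi> s \<omega>))\<^sup>2" if "0 \<le> s" "\<omega> \<in> space M" for s \<omega>
  proof -
    have "(\<Sum>m\<in>modes N. (?x m s \<omega>)\<^sup>2) = (\<Sum>k=1..N. (norm (l2inner (\<psi> s \<omega>) (sine_basis k)))\<^sup>2)"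
      unfolding sum_modes by (simp add: path_component_def part_def cmod_power2)
    also have "\<dots> \<le> (l2norm (\<psi> s \<omega>))\<^sup>2" by (rule Bessel_inequality[OF \<psi>_L2[OF that]]) auto
    finally show ?thesis .
  qed
  have \<theta>M: "(\<lambda>\<omega>. of_bool (\<theta> s \<omega>) :: real) \<in> borel_measurable M" if "0 \<le> s" "s \<le> t" for s
    using measurable_F_M[OF that(1) \<theta>[OF that]] by measurable
  have sq: "integrable M (\<lambda>\<omega>. of_bool (\<theta> s \<omega>) * (?x m s \<omega>)\<^sup>2)" if s: "0 \<le> s" "s \<le> t" and m: "m \<in> modes N" for s m
  proof (rule Bochner_Integration.integrable_bound[OF int[OF s]])
    show "(\<lambda>\<omega>. of_bool (\<theta> s \<omega>) * (?x m s \<omega>)\<^sup>2) \<in> borel_measurable M"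
      by (intro borel_measurable_times \<theta>M s borel_measurable_power measurable_F_M[OF s(1) x[OF s(1)]])
    show "AE \<omega> in M. norm (of_bool (\<theta> s \<omega>) * (?x m s \<omega>)\<^sup>2) \<le> norm (of_bool (\<theta> s \<omega>) * (l2norm (\<psi> s \<omega>))\<^sup>2)"
    proof (rule AE_I2)
      fix \<omega> assume "\<omega> \<in> space M"
      then have "(?x m s \<omega>)\<^sup>2 \<le> (l2norm (\<psi> s \<omega>))\<^sup>2"
        using sum_le[OF s(1), of \<omega>] member_le_sum[OF m, of "\<lambda>m. (?x m s \<omega>)\<^sup>2"] fin by fastforce
      then show "norm (of_bool (\<theta> s \<omega>) * (?x m s \<omega>)\<^sup>2) \<le> norm (of_bool (\<theta> s \<omega>) * (l2norm (\<psi> s \<omega>))\<^sup>2)" by simp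
    qed
  qed
  have C': "(\<Sum>m\<in>modes N. \<integral>\<omega>. of_bool (\<theta> s \<omega>) * (?x m s \<omega>)\<^sup>2 \<partial>M) \<le> C" if s: "0 \<le> s" "s \<le> t" for s
  proof -
    have "(\<Sum>m\<in>modes N. \<integral>\<omega>. of_bool (\<theta> s \<omega>) * (?x m s \<omega>)\<^sup>2 \<partial>M) = (\<integral>\<omega>. (\<Sum>m\<in>modes N. of_bool (\<theta> s \<omega>) * (?x m s \<omega>)\<^sup>2) \<partial>M)"
      using sq[OF s] by (simp add: Bochner_Integration.integral_sum)
    also have "\<dots> \<le> (\<integral>\<omega>. of_bool (\<theta> s \<omega>) * (l2norm (\<psi> s \<omega>))\<^sup>2 \<partial>M)"
    proof (rule integral_mono[OF Bochner_Integration.integrable_sum[OF sq[OF s]] int[OF s]])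
      fix \<omega> assume "\<omega> \<in> space M"
      then show "(\<Sum>m\<in>modes N. of_bool (\<theta> s \<omega>) * (?x m s \<omega>)\<^sup>2) \<le> of_bool (\<theta> s \<omega>) * (l2norm (\<psi> s \<omega>))\<^sup>2"
        unfolding sum_distrib_left[symmetric] by (intro mult_left_mono sum_le s) auto
    qed
    also have "\<dots> \<le> C" by (rule C[OF s])
    finally show ?thesis .
  qed
  have V: "(\<Sum>m\<in>modes N. (noise_strength \<epsilon> \<eta>s m)\<^sup>2) \<le> V"
  proof -
    have "(\<Sum>m\<in>modes N. (noise_strength \<epsilon> \<eta>s m)\<^sup>2) = (\<Sum>k=1..N. 2 * \<epsilon>\<^sup>2 * \<eta>s k)"
      unfolding sum_modes by (intro sum.cong refl) (simp add: noise_strength_def power_mult_distrib \<eta>s)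
    also have "\<dots> = 2 * \<epsilon>\<^sup>2 * (\<Sum>k<N. \<eta>s (Suc k))"
      unfolding sum_distrib_left[symmetric] One_nat_def sum.atLeast1_atMost_eq ..
    also have "(\<Sum>k<N. \<eta>s (Suc k)) \<le> \<eta>"
      unfolding sums_unique[OF \<eta>] by (rule sum_le_suminf[OF sums_summable[OF \<eta>]]) (auto intro: \<eta>s)
    finally show ?thesis by (simp add: V_def mult_left_mono)
  qed
  have w: "\<bar>fejer N (fst m)\<bar> \<le> 1" if "m \<in> modes N" for m
    using that fejer_nonneg[of "fst m" N] fejer_le_one[of N "fst m"] by (auto simp: modes_def)
  note main = martingale_sum[OF fin B t n \<theta> x sq C' V w, where \<alpha>=\<alpha>, folded fejer_martingale_def]
  show "square_integrable M (fejer_martingale t \<theta> N n)" "(\<integral>\<omega>. fejer_martingale t \<theta> N n \<omega> \<partial>M) = 0"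
    "(\<integral>\<omega>. (fejer_martingale t \<theta> N n \<omega>)\<^sup>2 \<partial>M) \<le> (exp (2 * \<bar>\<alpha>\<bar> * t))\<^sup>2 * (V * (8 * t * C + 4 * t\<^sup>2 * V))"
    using main by (simp_all add: fejer_martingale_def[abs_def])
qed

text \<open>Two limits in succession, the mesh to zero for each \<open>N\<close> and then
  \<open>N\<close> to infinity, both with the same second moment bound. \<theta> and
  \<open>S\<close> remain abstract because the lemma serves twice, with the exit time of a ball and
  without stopping. \<open>Z\<close> is an integrable version of the stopped energy, whose own
  measurability is never asserted.\<close>

lemma stopped_energy:
  assumes t: "0 < t"
    and \<theta>: "\<And>s. 0 \<le> s \<Longrightarrow> s \<le> t \<Longrightarrow> Measurable.pred (F s) (\<theta> s)"
    and int: "\<And>s. 0 \<le> s \<Longrightarrow> s \<le> t \<Longrightarrow> integrable M (\<lambda>\<omega>. of_bool (\<theta> s \<omega>) * (l2norm (\<psi> s \<omega>))\<^sup>2)"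
    and C: "\<And>s. 0 \<le> s \<Longrightarrow> s \<le> t \<Longrightarrow> (\<integral>\<omega>. of_bool (\<theta> s \<omega>) * (l2norm (\<psi> s \<omega>))\<^sup>2 \<partial>M) \<le> C"
    and S: "AE \<omega> in M. 0 \<le> S \<omega> \<and> S \<omega> \<le> t \<and> (\<forall>s. 0 \<le> s \<and> s < S \<omega> \<longrightarrow> \<theta> s \<omega>) \<and> (\<forall>s. S \<omega> < s \<and> s \<le> t \<longrightarrow> \<not> \<theta> s \<omega>)"
  obtains Z where "square_integrable M Z" "(\<integral>\<omega>. Z \<omega> \<partial>M) = 0"
    "AE \<omega> in M. Z \<omega> = exp (2 * \<alpha> * S \<omega>) * (l2norm (\<psi> (S \<omega>) \<omega>))\<^sup>2 - (l2norm (\<psi>\<^sub>0 \<omega>))\<^sup>2 - \<epsilon>\<^sup>2 * \<eta> / \<alpha> * (exp (2 * \<alpha> * S \<omega>) - 1)"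
proof -
  define K where "K = (exp (2 * \<bar>\<alpha>\<bar> * t))\<^sup>2 * (2 * \<epsilon>\<^sup>2 * \<eta> * (8 * t * C + 4 * t\<^sup>2 * (2 * \<epsilon>\<^sup>2 * \<eta>)))"
  note mom = fejer_martingale_moments[OF t zero_less_Suc \<theta> int C, folded K_def]
  \<comment> \<open>\<open>fejer_energy\<close> has its meaning only on paths in the locale; the
    pointwise limit is defined for every \<omega> and agrees with it there. The shift to
    \<open>Suc n\<close> skips the degenerate grid without cells.\<close>
  define E where "E N \<omega> = lim (\<lambda>n. fejer_martingale t \<theta> N (Suc n) \<omega>)" for N \<omega>
  have path: "AE \<omega> in M. (\<forall>N. (\<lambda>n. fejer_martingale t \<theta> N (Suc n) \<omega>) \<longlonglongrightarrow> E N \<omega>) \<and>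
    (\<lambda>N. E N \<omega>) \<longlonglongrightarrow> exp (2 * \<alpha> * S \<omega>) * (l2norm (\<psi> (S \<omega>) \<omega>))\<^sup>2 - (l2norm (\<psi>\<^sub>0 \<omega>))\<^sup>2 - \<epsilon>\<^sup>2 * \<eta> / \<alpha> * (exp (2 * \<alpha> * S \<omega>) - 1)"
    using AE_nls_path[OF t] S AE_initial
  proof eventually_elim
    case (elim \<omega>)
    interpret nls_path "\<lambda>s. \<psi> s \<omega>" "\<lambda>k i s. \<beta> k i s \<omega>" "\<lambda>k. l2inner (\<psi>\<^sub>0 \<omega>) (sine_basis k)" \<eta>s \<eta> \<alpha> \<epsilon> lam t
      by (rule elim(1))
    have lim: "(\<lambda>n. fejer_martingale t \<theta> N (Suc n) \<omega>) \<longlonglongrightarrow> fejer_energy N (S \<omega>)" for N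
      unfolding fejer_martingale_def
      by (rule LIMSEQ_Suc[OF fejer_energy_limit]) (use elim(2) in auto)
    then have E: "E N \<omega> = fejer_energy N (S \<omega>)" for N unfolding E_def by (rule limI)
    have "(\<lambda>N. fejer_energy N (S \<omega>)) \<longlonglongrightarrow> exp (2 * \<alpha> * S \<omega>) * (l2norm (\<psi> (S \<omega>) \<omega>))\<^sup>2 - (l2norm (\<psi> 0 \<omega>))\<^sup>2 - \<epsilon>\<^sup>2 * \<eta> / \<alpha> * (exp (2 * \<alpha> * S \<omega>) - 1)"
      by (rule fejer_energy_tendsto) (use elim(2) in auto)
    with lim show ?case unfolding E elim(3) by blast
  qed
  have "\<exists>Z. square_integrable M Z \<and> (\<integral>\<omega>. Z \<omega> \<partial>M) = 0 \<and> (\<integral>\<omega>. (Z \<omega>)\<^sup>2 \<partial>M) \<le> K \<and> (AE \<omega> in M. Z \<omega> = E N \<omega>)" for N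
  proof -
    have "AE \<omega> in M. (\<lambda>n. fejer_martingale t \<theta> N (Suc n) \<omega>) \<longlonglongrightarrow> E N \<omega>"
      using path by eventually_elim blast
    from L2_bounded_centered_limit[OF mom this] show ?thesis by blast
  qed
  then obtain Z where Z: "\<And>N. square_integrable M (Z N)" "\<And>N. (\<integral>\<omega>. Z N \<omega> \<partial>M) = 0"
    "\<And>N. (\<integral>\<omega>. (Z N \<omega>)\<^sup>2 \<partial>M) \<le> K" "\<And>N. AE \<omega> in M. Z N \<omega> = E N \<omega>" by metis
  have "AE \<omega> in M. \<forall>N. Z N \<omega> = E N \<omega>" using Z(4) by (simp add: AE_all_countable)
  with path have "AE \<omega> in M. (\<lambda>N. Z N \<omega>) \<longlonglongrightarrow> exp (2 * \<alpha> * S \<omega>) * (l2norm (\<psi> (S \<omega>) \<omega>))\<^sup>2 - (l2norm (\<psi>\<^sub>0 \<omega>))\<^sup>2 - \<epsilon>\<^sup>2 * \<eta> / \<alpha> * (exp (2 * \<alpha> * S \<omega>) - 1)"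
    by eventually_elim simp
  from L2_bounded_centered_limit[OF Z(1-3) this] that show thesis by blast
qed

lemma \<eta>_nonneg: "\<eta> \<ge> 0"
  unfolding sums_unique[OF \<eta>] by (rule suminf_nonneg[OF sums_summable[OF \<eta>]]) (auto intro: \<eta>s)

text \<open>Before the exit from the ball of radius R the mean square is at most R^2, so
  \<open>stopped_energy\<close> applies. The mean of the stopped energy has a bound free of R, and
  Fatou's lemma carries it to the time t.\<close>

lemma second_moment_bound:
  assumes t: "0 < t"
  shows "integrable M (\<lambda>\<omega>. (l2norm (\<psi> t \<omega>))\<^sup>2)"
    and "(\<integral>\<omega>. (l2norm (\<psi> t \<omega>))\<^sup>2 \<partial>M) \<le> (\<integral>\<omega>. (l2norm (\<psi>\<^sub>0 \<omega>))\<^sup>2 \<partial>M) + \<epsilon>\<^sup>2 * \<eta> / \<alpha>"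
proof -
  define \<theta> where "\<theta> R s \<omega> = (\<forall>q\<in>\<rat> \<inter> {0..1}. l2norm (\<psi> (q * s) \<omega>) \<le> R)" for R s \<omega>
  define S where "S R \<omega> = Sup {r \<in> {0..t}. r = 0 \<or> (\<forall>u\<in>{0..r}. l2norm (\<psi> u \<omega>) \<le> R)}" for R \<omega>
  define k where "k = \<epsilon>\<^sup>2 * \<eta> / \<alpha>"
  define K where "K = k * (exp (2 * \<alpha> * t) - 1)"
  define X0 where "X0 \<omega> = (l2norm (\<psi>\<^sub>0 \<omega>))\<^sup>2" for \<omega>
  have k0: "k \<ge> 0" using \<eta>_nonneg \<alpha> by (simp add: k_def)
  \<comment> \<open>For a fraction q in [0,1] the norm at time q s is known at time s; the
    quantifier over the rationals is countable.\<close>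
  have \<theta>_meas: "Measurable.pred (F s) (\<theta> R s)" if s: "0 \<le> s" and "s \<le> t" for R s
    unfolding \<theta>_def
  proof -
    have "Measurable.pred (F s) (\<lambda>\<omega>. real_of_rat r \<in> {0..1} \<longrightarrow> l2norm (\<psi> (real_of_rat r * s) \<omega>) \<le> R)" for r
    proof (cases "real_of_rat r \<in> {0..1}")
      case True
      then have "(\<lambda>\<omega>. l2norm (\<psi> (real_of_rat r * s) \<omega>)) \<in> borel_measurable (F s)"
        using s by (intro measurable_F_mono[OF _ _ l2norm_\<psi>_measurable]) (auto intro: mult_left_le_one_le)
      then show ?thesis by measurable
    qed auto
    then have "Measurable.pred (F s) (\<lambda>\<omega>. \<forall>r. real_of_rat r \<in> {0..1} \<longrightarrow> l2norm (\<psi> (real_of_rat r * s) \<omega>) \<le> R)"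
      by measurable
    moreover have "(\<forall>q\<in>\<rat> \<inter> {0..1}. l2norm (\<psi> (q * s) \<omega>) \<le> R) \<longleftrightarrow>
        (\<forall>r. real_of_rat r \<in> {0..1} \<longrightarrow> l2norm (\<psi> (real_of_rat r * s) \<omega>) \<le> R)" for \<omega>
      by (auto simp: Rats_def)
    ultimately show "Measurable.pred (F s) (\<lambda>\<omega>. \<forall>q\<in>\<rat> \<inter> {0..1}. l2norm (\<psi> (q * s) \<omega>) \<le> R)" by simp
  qed
  have \<theta>_le: "of_bool (\<theta> R s \<omega>) * (l2norm (\<psi> s \<omega>))\<^sup>2 \<le> R\<^sup>2" for R s \<omega>
  proof (cases "\<theta> R s \<omega>")
    case True
    \<comment> \<open>The fraction 1 is among those tested, so the condition bounds the norm at the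
      time s itself.\<close>
    then have "l2norm (\<psi> (1 * s) \<omega>) \<le> R" unfolding \<theta>_def by (rule bspec) auto
    then show ?thesis using True by (simp add: power_mono l2norm_nonneg)
  qed simp
  have \<theta>_int: "integrable M (\<lambda>\<omega>. of_bool (\<theta> R s \<omega>) * (l2norm (\<psi> s \<omega>))\<^sup>2)" if s: "0 \<le> s" "s \<le> t" for R s
  proof (rule Bochner_Integration.integrable_bound[where f="\<lambda>_. R\<^sup>2"])
    have "(\<lambda>\<omega>. of_bool (\<theta> R s \<omega>) :: real) \<in> borel_measurable M"
      using measurable_F_M[OF s(1) \<theta>_meas[OF s]] by measurable
    then show "(\<lambda>\<omega>. of_bool (\<theta> R s \<omega>) * (l2norm (\<psi> s \<omega>))\<^sup>2) \<in> borel_measurable M"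
      using measurable_F_M[OF s(1) l2norm_\<psi>_measurable[OF s(1)]] by (intro borel_measurable_times borel_measurable_power)
  qed (use \<theta>_le in auto)
  have \<theta>_C: "(\<integral>\<omega>. of_bool (\<theta> R s \<omega>) * (l2norm (\<psi> s \<omega>))\<^sup>2 \<partial>M) \<le> R\<^sup>2" if s: "0 \<le> s" "s \<le> t" for R s
  proof -
    have "(\<integral>\<omega>. of_bool (\<theta> R s \<omega>) * (l2norm (\<psi> s \<omega>))\<^sup>2 \<partial>M) \<le> (\<integral>\<omega>. R\<^sup>2 \<partial>M)"
      by (intro integral_mono \<theta>_int s \<theta>_le) simp
    then show ?thesis by (simp add: prob_space)
  qed
  have cont: "AE \<omega> in M. continuous_on {0..t} (\<lambda>s. l2norm (\<psi> s \<omega>))"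
    using AE_nls_path[OF t] by eventually_elim (rule nls_path.l2norm_continuous)
  have S: "AE \<omega> in M. 0 \<le> S R \<omega> \<and> S R \<omega> \<le> t \<and> (\<forall>s. 0 \<le> s \<and> s < S R \<omega> \<longrightarrow> \<theta> R s \<omega>) \<and> (\<forall>s. S R \<omega> < s \<and> s \<le> t \<longrightarrow> \<not> \<theta> R s \<omega>)" for R
    using cont
  proof eventually_elim
    case (elim \<omega>)
    show ?case unfolding S_def \<theta>_def using exit_time(1-4)[OF t elim, where R=R] by blast
  qed
  have ex: "\<exists>Z. square_integrable M Z \<and> (\<integral>\<omega>. Z \<omega> \<partial>M) = 0 \<and>
    (AE \<omega> in M. Z \<omega> = exp (2 * \<alpha> * S R \<omega>) * (l2norm (\<psi> (S R \<omega>) \<omega>))\<^sup>2 - X0 \<omega> - k * (exp (2 * \<alpha> * S R \<omega>) - 1))" for R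
  proof -
    obtain Z where "square_integrable M Z" "(\<integral>\<omega>. Z \<omega> \<partial>M) = 0"
      "AE \<omega> in M. Z \<omega> = exp (2 * \<alpha> * S R \<omega>) * (l2norm (\<psi> (S R \<omega>) \<omega>))\<^sup>2 - (l2norm (\<psi>\<^sub>0 \<omega>))\<^sup>2 - \<epsilon>\<^sup>2 * \<eta> / \<alpha> * (exp (2 * \<alpha> * S R \<omega>) - 1)"
      by (rule stopped_energy[OF t \<theta>_meas \<theta>_int \<theta>_C S[of R]])
    then show ?thesis unfolding X0_def k_def by (intro exI[of _ Z] conjI)
  qed
  from choice[OF allI[OF ex]] obtain Z where Zp: "\<forall>R. square_integrable M (Z R) \<and> (\<integral>\<omega>. Z R \<omega> \<partial>M) = 0 \<and>
    (AE \<omega> in M. Z R \<omega> = exp (2 * \<alpha> * S R \<omega>) * (l2norm (\<psi> (S R \<omega>) \<omega>))\<^sup>2 - X0 \<omega> - k * (exp (2 * \<alpha> * S R \<omega>) - 1))"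
    by (rule exE)
  note Z = Zp[THEN spec, THEN conjunct1] Zp[THEN spec, THEN conjunct2, THEN conjunct1] Zp[THEN spec, THEN conjunct2, THEN conjunct2]
  \<comment> \<open>Adding the initial energy and \<open>K\<close>, the noise gain at the final
    time, makes the variable nonnegative, as the gain up to an earlier exit is at most
    \<open>K\<close>. Its mean is the same for all n because \<open>Z\<close> is centered.\<close>
  define W where "W n \<omega> = Z (real n) \<omega> + X0 \<omega> + K" for n :: nat and \<omega>
  have Wi: "integrable M (W n)" for n
    unfolding W_def[abs_def] X0_def using square_integrable_integrable[OF Z(1)] \<psi>\<^sub>0_int by simp
  have Zall: "AE \<omega> in M. \<forall>n. Z (real n) \<omega> = exp (2 * \<alpha> * S (real n) \<omega>) * (l2norm (\<psi> (S (real n) \<omega>) \<omega>))\<^sup>2 - X0 \<omega> - k * (exp (2 * \<alpha> * S (real n) \<omega>) - 1)"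
    using Z(3) by (simp add: AE_all_countable)
  have Sall: "AE \<omega> in M. \<forall>n. 0 \<le> S (real n) \<omega> \<and> S (real n) \<omega> \<le> t"
    unfolding AE_all_countable using S by (auto elim: eventually_mono)
  have W0: "AE \<omega> in M. 0 \<le> W n \<omega>" for n
    using Zall Sall
  proof eventually_elim
    case (elim \<omega>)
    have "\<alpha> * S (real n) \<omega> \<le> \<alpha> * t" using elim(2) \<alpha> by simp
    then have "k * (exp (2 * \<alpha> * S (real n) \<omega>) - 1) \<le> K"
      unfolding K_def using k0 by (intro mult_left_mono) auto
    moreover have "0 \<le> exp (2 * \<alpha> * S (real n) \<omega>) * (l2norm (\<psi> (S (real n) \<omega>) \<omega>))\<^sup>2" by simp
    ultimately show ?case unfolding W_def using elim(1) by (simp only:)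
  qed
  have Wlim: "AE \<omega> in M. \<forall>\<^sub>F n in sequentially. W n \<omega> = exp (2 * \<alpha> * t) * (l2norm (\<psi> t \<omega>))\<^sup>2"
    using Zall cont
  proof eventually_elim
    case (elim \<omega>)
    obtain R where R: "\<And>s. s \<in> {0..t} \<Longrightarrow> \<bar>l2norm (\<psi> s \<omega>)\<bar> \<le> R"
      using continuous_on_Icc_bounded[OF elim(2)] by blast
    obtain n0 :: nat where n0: "R \<le> real n0" using real_arch_simple by blast
    show ?case
    proof (rule eventually_mono[OF eventually_ge_at_top[of n0]])
      fix n assume "n \<ge> n0"
      \<comment> \<open>A continuous path is bounded on [0,t], so for large radii it never exits and
        \<open>W n\<close> becomes exactly the weighted energy at t.\<close>
      then have "\<forall>u\<in>{0..t}. l2norm (\<psi> u \<omega>) \<le> real n" using R n0 by fastforce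
      then have "S (real n) \<omega> = t" unfolding S_def by (rule exit_time(5)[OF t elim(2)])
      then show "W n \<omega> = exp (2 * \<alpha> * t) * (l2norm (\<psi> t \<omega>))\<^sup>2"
        unfolding W_def K_def using elim(1) by simp
    qed
  qed
  have tm: "(\<lambda>\<omega>. (l2norm (\<psi> t \<omega>))\<^sup>2) \<in> borel_measurable M"
    using measurable_F_M[OF _ l2norm_\<psi>_measurable, of t] t by (intro borel_measurable_power) auto
  have EW: "(\<integral>\<^sup>+\<omega>. ennreal (W n \<omega>) \<partial>M) = ennreal ((\<integral>\<omega>. X0 \<omega> \<partial>M) + K)" for n
  proof -
    have "(\<integral>\<omega>. W n \<omega> \<partial>M) = (\<integral>\<omega>. X0 \<omega> \<partial>M) + K"
      unfolding W_def X0_def using square_integrable_integrable[OF Z(1)] \<psi>\<^sub>0_int Z(2) by (simp add: prob_space)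
    then show ?thesis by (simp add: nn_integral_eq_integral[OF Wi W0])
  qed
  have "(\<integral>\<^sup>+\<omega>. ennreal (exp (2 * \<alpha> * t) * (l2norm (\<psi> t \<omega>))\<^sup>2) \<partial>M) = (\<integral>\<^sup>+\<omega>. liminf (\<lambda>n. ennreal (W n \<omega>)) \<partial>M)"
  proof (rule nn_integral_cong_AE)
    show "AE \<omega> in M. ennreal (exp (2 * \<alpha> * t) * (l2norm (\<psi> t \<omega>))\<^sup>2) = liminf (\<lambda>n. ennreal (W n \<omega>))"
      using Wlim
    proof eventually_elim
      case (elim \<omega>)
      then have "(\<lambda>n. ennreal (W n \<omega>)) \<longlonglongrightarrow> ennreal (exp (2 * \<alpha> * t) * (l2norm (\<psi> t \<omega>))\<^sup>2)"
        by (intro tendsto_eventually) (auto elim: eventually_mono)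
      from lim_imp_Liminf[OF sequentially_bot this] show ?case ..
    qed
  qed
  also have "\<dots> \<le> liminf (\<lambda>n. \<integral>\<^sup>+\<omega>. ennreal (W n \<omega>) \<partial>M)"
    using Wi by (intro nn_integral_liminf) auto
  also have "\<dots> = ennreal ((\<integral>\<omega>. X0 \<omega> \<partial>M) + K)"
    unfolding EW by (simp add: Liminf_const)
  finally have nn: "(\<integral>\<^sup>+\<omega>. ennreal (exp (2 * \<alpha> * t) * (l2norm (\<psi> t \<omega>))\<^sup>2) \<partial>M) \<le> ennreal ((\<integral>\<omega>. X0 \<omega> \<partial>M) + K)" .
  have i: "integrable M (\<lambda>\<omega>. exp (2 * \<alpha> * t) * (l2norm (\<psi> t \<omega>))\<^sup>2)"
    using nn tm by (intro integrableI_nonneg) (auto intro: le_less_trans)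
  from integrable_mult_right[OF i, of "exp (- (2 * \<alpha> * t))"] show i': "integrable M (\<lambda>\<omega>. (l2norm (\<psi> t \<omega>))\<^sup>2)"
    by (simp add: mult.assoc[symmetric] exp_add[symmetric])
  have K0: "K \<ge> 0" unfolding K_def using k0 t \<alpha> by simp
  have X00: "(\<integral>\<omega>. X0 \<omega> \<partial>M) \<ge> 0" by (simp add: X0_def)
  have "exp (2 * \<alpha> * t) * (\<integral>\<omega>. (l2norm (\<psi> t \<omega>))\<^sup>2 \<partial>M) \<le> (\<integral>\<omega>. X0 \<omega> \<partial>M) + K"
  proof -
    have "ennreal (\<integral>\<omega>. exp (2 * \<alpha> * t) * (l2norm (\<psi> t \<omega>))\<^sup>2 \<partial>M) \<le> ennreal ((\<integral>\<omega>. X0 \<omega> \<partial>M) + K)"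
      using nn unfolding nn_integral_eq_integral[OF i AE_I2[OF mult_nonneg_nonneg[OF exp_ge_zero zero_le_power2]]] .
    then show ?thesis using K0 X00 by (simp add: ennreal_le_iff del: ennreal_plus)
  qed
  \<comment> \<open>The growing weight is factored out, which leaves a bound independent of
    t.\<close>
  also have "\<dots> \<le> exp (2 * \<alpha> * t) * ((\<integral>\<omega>. X0 \<omega> \<partial>M) + k)"
  proof -
    have "1 * (\<integral>\<omega>. X0 \<omega> \<partial>M) \<le> exp (2 * \<alpha> * t) * (\<integral>\<omega>. X0 \<omega> \<partial>M)"
      using X00 t \<alpha> by (intro mult_right_mono) auto
    then show ?thesis unfolding K_def using k0 by (simp add: algebra_simps)
  qed
  finally show "(\<integral>\<omega>. (l2norm (\<psi> t \<omega>))\<^sup>2 \<partial>M) \<le> (\<integral>\<omega>. (l2norm (\<psi>\<^sub>0 \<omega>))\<^sup>2 \<partial>M) + \<epsilon>\<^sup>2 * \<eta> / \<alpha>"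
    unfolding X0_def k_def by simp
qed

lemma second_moment_initial:
  "integrable M (\<lambda>\<omega>. (l2norm (\<psi> 0 \<omega>))\<^sup>2)" "(\<integral>\<omega>. (l2norm (\<psi> 0 \<omega>))\<^sup>2 \<partial>M) = (\<integral>\<omega>. (l2norm (\<psi>\<^sub>0 \<omega>))\<^sup>2 \<partial>M)"
proof -
  have m: "(\<lambda>\<omega>. (l2norm (\<psi> 0 \<omega>))\<^sup>2) \<in> borel_measurable M" "(\<lambda>\<omega>. (l2norm (\<psi>\<^sub>0 \<omega>))\<^sup>2) \<in> borel_measurable M"
    using measurable_F_M[OF order_refl l2norm_\<psi>_measurable[OF order_refl]] \<psi>\<^sub>0_int by auto
  have ae: "AE \<omega> in M. (l2norm (\<psi> 0 \<omega>))\<^sup>2 = (l2norm (\<psi>\<^sub>0 \<omega>))\<^sup>2" using AE_initial by eventually_elim simp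
  show "integrable M (\<lambda>\<omega>. (l2norm (\<psi> 0 \<omega>))\<^sup>2)"
    using integrable_cong_AE[OF m ae] \<psi>\<^sub>0_int by simp
  show "(\<integral>\<omega>. (l2norm (\<psi> 0 \<omega>))\<^sup>2 \<partial>M) = (\<integral>\<omega>. (l2norm (\<psi>\<^sub>0 \<omega>))\<^sup>2 \<partial>M)"
    by (rule integral_cong_AE[OF m ae])
qed

lemma second_moment:
  assumes "0 \<le> t"
  shows "integrable M (\<lambda>\<omega>. (l2norm (\<psi> t \<omega>))\<^sup>2)"
    and "(\<integral>\<omega>. (l2norm (\<psi> t \<omega>))\<^sup>2 \<partial>M) \<le> (\<integral>\<omega>. (l2norm (\<psi>\<^sub>0 \<omega>))\<^sup>2 \<partial>M) + \<epsilon>\<^sup>2 * \<eta> / \<alpha>"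
proof -
  have "0 \<le> \<epsilon>\<^sup>2 * \<eta> / \<alpha>" using \<eta>_nonneg \<alpha> by simp
  with second_moment_bound[of t] second_moment_initial assms
  show "integrable M (\<lambda>\<omega>. (l2norm (\<psi> t \<omega>))\<^sup>2)"
    and "(\<integral>\<omega>. (l2norm (\<psi> t \<omega>))\<^sup>2 \<partial>M) \<le> (\<integral>\<omega>. (l2norm (\<psi>\<^sub>0 \<omega>))\<^sup>2 \<partial>M) + \<epsilon>\<^sup>2 * \<eta> / \<alpha>"
    by (cases "t = 0"; simp)+
qed

text \<open>With second moments bounded uniformly on [0,t], \<open>stopped_energy\<close> applies
  with the condition that is always true and with S = t. Taking the mean and multiplying by the
  inverse weight gives the formula.\<close>

lemma second_moment_identity:
  assumes "0 \<le> t"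
  shows "(\<integral>\<omega>. (l2norm (\<psi> t \<omega>))\<^sup>2 \<partial>M) =
    exp (- 2 * \<alpha> * t) * (\<integral>\<omega>. (l2norm (\<psi>\<^sub>0 \<omega>))\<^sup>2 \<partial>M) + \<epsilon>\<^sup>2 * \<eta> / \<alpha> * (1 - exp (- 2 * \<alpha> * t))"
proof (cases "t = 0")
  case True
  then show ?thesis using second_moment_initial(2) by simp
next
  case False
  with assms have t: "0 < t" by simp
  define k where "k = \<epsilon>\<^sup>2 * \<eta> / \<alpha>"
  obtain Z where Z: "square_integrable M Z" "(\<integral>\<omega>. Z \<omega> \<partial>M) = 0"
    "AE \<omega> in M. Z \<omega> = exp (2 * \<alpha> * t) * (l2norm (\<psi> t \<omega>))\<^sup>2 - (l2norm (\<psi>\<^sub>0 \<omega>))\<^sup>2 - k * (exp (2 * \<alpha> * t) - 1)"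
    unfolding k_def
    by (rule stopped_energy[OF t, where \<theta>="\<lambda>_ _. True" and S="\<lambda>_. t" and C="(\<integral>\<omega>. (l2norm (\<psi>\<^sub>0 \<omega>))\<^sup>2 \<partial>M) + \<epsilon>\<^sup>2 * \<eta> / \<alpha>"])
       (use t second_moment in auto)
  have "0 = (\<integral>\<omega>. exp (2 * \<alpha> * t) * (l2norm (\<psi> t \<omega>))\<^sup>2 - (l2norm (\<psi>\<^sub>0 \<omega>))\<^sup>2 - k * (exp (2 * \<alpha> * t) - 1) \<partial>M)"
    using Z second_moment(1)[OF assms] \<psi>\<^sub>0_int
    by (subst Z(2)[symmetric], intro integral_cong_AE) (auto simp: square_integrable_def)
  also have "\<dots> = exp (2 * \<alpha> * t) * (\<integral>\<omega>. (l2norm (\<psi> t \<omega>))\<^sup>2 \<partial>M) - (\<integral>\<omega>. (l2norm (\<psi>\<^sub>0 \<omega>))\<^sup>2 \<partial>M) - k * (exp (2 * \<alpha> * t) - 1)"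
    using second_moment(1)[OF assms] \<psi>\<^sub>0_int by (simp add: prob_space)
  finally have eq: "exp (2 * \<alpha> * t) * (\<integral>\<omega>. (l2norm (\<psi> t \<omega>))\<^sup>2 \<partial>M) = (\<integral>\<omega>. (l2norm (\<psi>\<^sub>0 \<omega>))\<^sup>2 \<partial>M) + k * (exp (2 * \<alpha> * t) - 1)"
    by simp
  have inv: "exp (- 2 * \<alpha> * t) * exp (2 * \<alpha> * t) = 1" by (simp flip: exp_add)
  have "(\<integral>\<omega>. (l2norm (\<psi> t \<omega>))\<^sup>2 \<partial>M) = exp (- 2 * \<alpha> * t) * (exp (2 * \<alpha> * t) * (\<integral>\<omega>. (l2norm (\<psi> t \<omega>))\<^sup>2 \<partial>M))"
    unfolding mult.assoc[symmetric] inv by simp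
  also have "\<dots> = exp (- 2 * \<alpha> * t) * (\<integral>\<omega>. (l2norm (\<psi>\<^sub>0 \<omega>))\<^sup>2 \<partial>M) + k * (exp (- 2 * \<alpha> * t) * exp (2 * \<alpha> * t) - exp (- 2 * \<alpha> * t))"
    unfolding eq by (simp only: distrib_left right_diff_distrib mult_ac mult_1_right)
  finally show ?thesis unfolding inv k_def .
qed

end

text \<open>The integral of a non-integrable function is 0 by convention, so integrability is part
  of the conclusion: it makes the identity one between genuine expectations. The uniform bound is
  the initial mean energy plus \<epsilon>^2 \<eta> / \<alpha>.\<close>

theorem proposition2p1:
  fixes M :: "'w measure" and F :: "real \<Rightarrow> 'w measure"
    and \<beta> :: "nat \<Rightarrow> nat \<Rightarrow> real \<Rightarrow> 'w \<Rightarrow> real"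
    and Q :: "(real \<Rightarrow> complex) \<Rightarrow> real \<Rightarrow> complex"
    and QW \<psi> :: "real \<Rightarrow> 'w \<Rightarrow> real \<Rightarrow> complex"
    and \<psi>\<^sub>0 :: "'w \<Rightarrow> real \<Rightarrow> complex"
    and \<eta>s :: "nat \<Rightarrow> real" and \<eta> \<alpha> \<epsilon> lam :: real
  assumes "filtered_prob_space M F"
    and "brownian_family M F \<beta>"
    and "positive_operator Q"
    and "commutes_with_laplacian Q"
    and "\<And>k. k \<ge> 1 \<Longrightarrow> \<eta>s k \<ge> 0"
    and "\<And>k. k \<ge> 1 \<Longrightarrow> AE x in I01. Q (sine_basis k) x = of_real (sqrt (\<eta>s k)) * sine_basis k x"
    and "(\<lambda>k. \<eta>s (Suc k)) sums \<eta>"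
    and "Q_wiener_process M F \<beta> Q QW"
    and "\<alpha> > 0" and "\<epsilon> \<ge> 0" and "lam = 1 \<or> lam = -1"
    and "l2_measurable (F 0) \<psi>\<^sub>0"
    and "integrable M (\<lambda>\<omega>. (l2norm (\<psi>\<^sub>0 \<omega>))\<^sup>2)"
    and "nls_solution M F QW \<alpha> \<epsilon> lam \<psi>\<^sub>0 \<psi>"
  shows "(\<forall>t\<ge>0. integrable M (\<lambda>\<omega>. (l2norm (\<psi> t \<omega>))\<^sup>2)) \<and>
    (\<exists>C. \<forall>t\<ge>0. (\<integral>\<omega>. (l2norm (\<psi> t \<omega>))\<^sup>2 \<partial>M) \<le> C) \<and>
    (\<forall>t\<ge>0. (\<integral>\<omega>. (l2norm (\<psi> t \<omega>))\<^sup>2 \<partial>M) =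
       exp (- 2 * \<alpha> * t) * (\<integral>\<omega>. (l2norm (\<psi>\<^sub>0 \<omega>))\<^sup>2 \<partial>M) +
       \<epsilon>\<^sup>2 * \<eta> / \<alpha> * (1 - exp (- 2 * \<alpha> * t)))"
proof -
  interpret filtered_prob_space M F by fact
  interpret nls_setting M F \<beta> Q QW \<psi> \<psi>\<^sub>0 \<eta>s \<eta> \<alpha> \<epsilon> lam
  proof
    show "Q f \<in> L2" if "f \<in> L2" for f using assms(3) that by (simp add: positive_operator_def)
  qed (use assms in auto)
  show ?thesis
    using second_moment second_moment_identity by blast
qed

end
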